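(* Let the dimension $N\ge1$ be fixed, let $q_c:=\frac{N+2}{N+1}$ and let $q\in(q_c,2)$. a) There exists a non-positive self-similar solution $$V=V(x,t)=t^{-(2-q)/(2(q-1))}\,V(xt^{-1/2},1)$$ to $u_t-\Delta u+|\nabla u|^q=0$ in $\mathbb{R}^N\times(0,\infty)$ such that $$\lim_{t\to\infty}t^{(N/2)(1-1/p)}\|V(t)\|_p=\infty\quad\text{and}\quad\lim_{t\to\infty}t^{(N/2)(1-1/p)+1/2}\|\nabla V(t)\|_p=\infty$$ for all $p\in[1,\infty]$. b) There is a constant $K=K(q)\ge0$ such that the following holds. Let $u_0\in L^1(\mathbb{R}^N)\cap W^{1,\infty}(\mathbb{R}^N)$ be non-positive with $u_0\not\equiv0$, and let $u$ be the solution of $u_t-\Delta u+|\nabla u|^q=0$ in $\mathbb{R}^N\times(0,\infty)$, $u(\cdot,0)=u_0$. If $u_0\in W^{2,\infty}(\mathbb{R}^N)$ satisfies $$\|u_0\|_\infty\,\left\|(\Delta u_0)^+\right\|_\infty^{1-2/q}>K,$$ then $$\lim_{t\to\infty}\|u(t)\|_\infty>0.$$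
   Context: For $q>1$ and every $u_0\in W^{1,\infty}(\mathbb{R}^N)$, the Cauchy problem $u_t-\Delta u+|\nabla u|^q=0$, $u(\cdot,0)=u_0$, has a unique global-in-time classical solution $u\in\mathcal{C}(\mathbb{R}^N\times[0,\infty))\cap\mathcal{C}^{2,1}(\mathbb{R}^N\times(0,\infty))$; it satisfies $\|u(t)\|_\infty\le\|u_0\|_\infty$ and $\|\nabla u(t)\|_\infty\le\|\nabla u_0\|_\infty$ for all $t>0$. "The solution" means this one. If $u_0\le0$ then $u\le0$; moreover $t\mapsto\|u(t)\|_\infty$ is non-increasing. For a real number $r$, $r^+:=\max\{r,0\}$. $\|\cdot\|_p$ is the $L^p(\mathbb{R}^N)$-norm, $u(t)=u(\cdot,t)$, and $1/p=0$ if $p=\infty$. *)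

theory Defs
  imports "HOL-Analysis.Analysis" "HOL-Probability.Essential_Supremum"
begin

section \<open>Lebesgue spaces on Euclidean space\<close>

text \<open>The norm takes the value \<^term>\<open>\<infinity>\<close> outside the space. For \<^term>\<open>p = \<infinity>\<close>,
  \<^const>\<open>esssup\<close> of a non-measurable function is \<^term>\<open>\<infinity>\<close>; for finite exponents measurability
  has to be demanded separately, as is done in the definition of the space.\<close>

definition Lp_norm :: "ennreal \<Rightarrow> ('a::euclidean_space \<Rightarrow> 'b::real_normed_vector) \<Rightarrow> ennreal" where
  "Lp_norm p f =
    (if p = \<infinity> then esssup lebesgue (\<lambda>x. ennreal (norm (f x)))
     else (let I = (\<integral>\<^sup>+ x. ennreal (norm (f x) powr enn2real p) \<partial>lebesgue)
           in if I = \<infinity> then \<infinity> else ennreal (enn2real I powr enn2real (1 / p))))"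

definition Lp_space :: "ennreal \<Rightarrow> ('a::euclidean_space \<Rightarrow> 'b::real_normed_vector) set" where
  "Lp_space p = {f \<in> borel_measurable lebesgue. Lp_norm p f < \<infinity>}"

section \<open>Classical derivatives\<close>

definition partial_deriv :: "'a \<Rightarrow> ('a::euclidean_space \<Rightarrow> real) \<Rightarrow> 'a \<Rightarrow> real" where
  "partial_deriv b f x = frechet_derivative f (at x) b"

definition grad :: "('a::euclidean_space \<Rightarrow> real) \<Rightarrow> 'a \<Rightarrow> 'a" where
  "grad f x = (\<Sum>b\<in>Basis. partial_deriv b f x *\<^sub>R b)"

definition laplacian :: "('a::euclidean_space \<Rightarrow> real) \<Rightarrow> 'a \<Rightarrow> real" where
  "laplacian f x = (\<Sum>b\<in>Basis. partial_deriv b (partial_deriv b f) x)"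

primrec C_k :: "nat \<Rightarrow> ('a::euclidean_space \<Rightarrow> real) \<Rightarrow> bool" where
  "C_k 0 f \<longleftrightarrow> continuous_on UNIV f"
| "C_k (Suc k) f \<longleftrightarrow>
     (\<forall>x. f differentiable (at x)) \<and> (\<forall>b\<in>Basis. C_k k (partial_deriv b f))"

section \<open>Weak derivatives and the Sobolev spaces of bounded functions\<close>

definition test_function :: "('a::euclidean_space \<Rightarrow> real) \<Rightarrow> bool" where
  "test_function \<phi> \<longleftrightarrow> (\<forall>k. C_k k \<phi>) \<and> compact (closure {x. \<phi> x \<noteq> 0})"

definition locally_integrable :: "('a::euclidean_space \<Rightarrow> real) \<Rightarrow> bool" where
  "locally_integrable f \<longleftrightarrow> (\<forall>S. compact S \<longrightarrow> set_integrable lebesgue S f)"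

definition has_weak_partial :: "'a \<Rightarrow> ('a::euclidean_space \<Rightarrow> real) \<Rightarrow> ('a \<Rightarrow> real) \<Rightarrow> bool" where
  "has_weak_partial b f g \<longleftrightarrow> locally_integrable f \<and> locally_integrable g \<and>
     (\<forall>\<phi>. test_function \<phi> \<longrightarrow>
        (LINT x|lebesgue. f x * partial_deriv b \<phi> x) = - (LINT x|lebesgue. g x * \<phi> x))"

text \<open>Weak derivatives are unique only up to null sets; the choice made here is irrelevant since
  the functions below are used only through their Lebesgue norms.\<close>

definition weak_partial :: "'a \<Rightarrow> ('a::euclidean_space \<Rightarrow> real) \<Rightarrow> 'a \<Rightarrow> real" where
  "weak_partial b f = (SOME g. has_weak_partial b f g)"

definition weak_grad :: "('a::euclidean_space \<Rightarrow> real) \<Rightarrow> 'a \<Rightarrow> 'a" where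
  "weak_grad f x = (\<Sum>b\<in>Basis. weak_partial b f x *\<^sub>R b)"

definition weak_laplacian :: "('a::euclidean_space \<Rightarrow> real) \<Rightarrow> 'a \<Rightarrow> real" where
  "weak_laplacian f x = (\<Sum>b\<in>Basis. weak_partial b (weak_partial b f) x)"

text \<open>The space \<open>W\<close> with differentiability index \<open>k\<close> and integrability exponent \<open>\<infinity>\<close>.\<close>

primrec W_inf :: "nat \<Rightarrow> ('a::euclidean_space \<Rightarrow> real) set" where
  "W_inf 0 = Lp_space \<infinity>"
| "W_inf (Suc k) =
     {f \<in> Lp_space \<infinity>. \<forall>b\<in>Basis. \<exists>g \<in> W_inf k. has_weak_partial b f g}"

section \<open>The viscous Hamilton-Jacobi equation\<close>

text \<open>A function of space and time is written with the time variable first, so that \<open>u t\<close> is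
  the function \<open>u(\<cdot>, t)\<close> on space. Twice continuously differentiable in space and once in time on
  the open half-space of positive times:\<close>

definition C_2_1 :: "(real \<Rightarrow> 'a::euclidean_space \<Rightarrow> real) \<Rightarrow> bool" where
  "C_2_1 u \<longleftrightarrow>
     (\<forall>t>0. \<forall>x. (\<lambda>s. u s x) differentiable (at t)) \<and>
     (\<forall>t>0. \<forall>x. u t differentiable (at x)) \<and>
     (\<forall>t>0. \<forall>x. \<forall>b\<in>Basis. partial_deriv b (u t) differentiable (at x)) \<and>
     continuous_on ({0<..} \<times> UNIV) (\<lambda>(t, x). u t x) \<and>
     continuous_on ({0<..} \<times> UNIV) (\<lambda>(t, x). deriv (\<lambda>s. u s x) t) \<and>
     (\<forall>b\<in>Basis. continuous_on ({0<..} \<times> UNIV) (\<lambda>(t, x). partial_deriv b (u t) x)) \<and>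
     (\<forall>b\<in>Basis. \<forall>c\<in>Basis. continuous_on ({0<..} \<times> UNIV)
        (\<lambda>(t, x). partial_deriv c (partial_deriv b (u t)) x))"

definition solves_VHJ :: "real \<Rightarrow> (real \<Rightarrow> 'a::euclidean_space \<Rightarrow> real) \<Rightarrow> bool" where
  "solves_VHJ q u \<longleftrightarrow> C_2_1 u \<and>
     (\<forall>t>0. \<forall>x. deriv (\<lambda>s. u s x) t - laplacian (u t) x + norm (grad (u t) x) powr q = 0)"

text \<open>The solution of the Cauchy problem with initial datum in \<open>W_inf 1\<close>. The datum is compared
  pointwise with \<open>u 0\<close>, so it has to be the continuous representative of its class. The two bounds
  are the maximum principle estimates that the (unique) classical solution obeys.\<close>

definition is_the_solution ::
    "real \<Rightarrow> ('a::euclidean_space \<Rightarrow> real) \<Rightarrow> (real \<Rightarrow> 'a \<Rightarrow> real) \<Rightarrow> bool" where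
  "is_the_solution q u0 u \<longleftrightarrow>
     continuous_on ({0..} \<times> UNIV) (\<lambda>(t, x). u t x) \<and>
     solves_VHJ q u \<and>
     u 0 = u0 \<and>
     (\<forall>t>0. Lp_norm \<infinity> (u t) \<le> Lp_norm \<infinity> u0) \<and>
     (\<forall>t>0. Lp_norm \<infinity> (grad (u t)) \<le> Lp_norm \<infinity> (weak_grad u0))"

definition self_similar_solution ::
    "real \<Rightarrow> (real \<Rightarrow> 'a::euclidean_space \<Rightarrow> real) \<Rightarrow> bool" where
  "self_similar_solution q V \<longleftrightarrow> solves_VHJ q V \<and>
     (\<forall>t>0. \<forall>x. V t x = t powr (- (2 - q) / (2 * (q - 1))) * V 1 (t powr (- 1 / 2) *\<^sub>R x))"

end

theory Submission
  imports Defs "HOL-Probability.Sinc_Integral"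
begin

text \<open>Put \<open>v = - u\<close>, so that \<open>v\<^sub>t = \<Delta>v + |\<nabla>v|\<^sup>q\<close>. Both parts rest on the explicit subsolution
  \<open>M(t) - c(t) |x - x0| powr p\<close> with \<open>p = q / (q - 1) > 2\<close> and \<open>c' = - k c powr q\<close>: the Laplacian
  costs \<open>M' = - L' c powr (q / 2)\<close>, which is integrable in time because \<open>q < 2\<close>, so that \<open>M\<close> loses
  at most \<open>L c(0) powr (1 - q / 2)\<close> in total.

  For the non-decay, the distributional bound \<open>\<Delta>u\<^sub>0 \<le> A\<close> gives a mean value inequality by which the
  averages of \<open>v(0)\<close> over small cubes stay above half of the supremum \<open>m\<close> on a ball of radius of order
  \<open>sqrt (m / A)\<close>. Spatial averages of \<open>v\<close> are supersolutions by convexity of \<open>|\<cdot>|\<^sup>q\<close>, hence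
  stay above a barrier centred there.

  The self-similar profile \<open>a F(r)\<close> is found by shooting in \<open>\<kappa> = a powr (q - 1)\<close>, the coefficient of
  \<open>|F'|\<^sup>q\<close> after the normalisation \<open>F(0) = 1\<close>. For small \<open>\<kappa>\<close> the profile stays positive; for
  some large \<open>\<kappa>\<close> it crosses zero, since a positive profile would yield a decaying solution above a
  non-decaying barrier. At the infimum of the crossing parameters the profile is positive but cannot enter the
  open regime of slow decay \<open>- r F' < Z F\<close>, and therefore decays at least like \<open>r powr - Z\<close>.\<close>

text \<open>The lower bound on q says exactly that \<open>\<alpha>\<close> = (2 - q) / (2 (q - 1))
  is below n / 2. So the wave decays more slowly than the heat kernel, which gives the divergence in
  a), and there is room between the initial slope \<open>\<alpha>\<close> / n of a profile and the
  Gaussian value 1 / 2, which gives positive profiles for weak coupling. For strong coupling the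
  amplitude a = \<open>\<kappa>\<close> powr (1 / (q - 1)) grows, while the radius on which the
  profile stays above 1 / 2 shrinks only like \<open>\<kappa>\<close> powr (- 1 / q); the barrier
  under it therefore loses an ever smaller share of its height. In b), m A powr (1 - 2 / q), with A
  the bound on the Laplacian, is invariant under the scaling of the equation. A barrier of height m
  / 2 and radius of order sqrt (m / A) keeps a positive height as soon as this product is large. The
  obstacle there is that a one-sided bound on the Laplacian keeps the datum near its minimum only on
  average, in general not pointwise. Hence the barrier is put under averages, and convexity has to
  carry the equation over to them.\<close>

abbreviation axis_deriv :: "('a::euclidean_space \<Rightarrow> real) \<Rightarrow> real \<Rightarrow> 'a \<Rightarrow> 'a \<Rightarrow> bool" where
  "axis_deriv f d b x \<equiv> ((\<lambda>s. f (x + s *\<^sub>R b)) has_real_derivative d) (at 0)"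

lemma axis_deriv_shift:
  assumes "axis_deriv f d b (x + s *\<^sub>R b)"
  shows "((\<lambda>s. f (x + s *\<^sub>R b)) has_real_derivative d) (at s)"
proof -
  have "((\<lambda>h. f (x + (s + h) *\<^sub>R b)) has_real_derivative d) (at 0)"
    using assms by (simp add: scaleR_add_left add.assoc)
  then show ?thesis
    using DERIV_shift[of "\<lambda>s. f (x + s *\<^sub>R b)" d 0 s] by (simp add: add.commute)
qed

section \<open>A minimum principle for comparison on compact sets\<close>

lemma second_derivative_local_min:
  fixes g g1 :: "real \<Rightarrow> real"
  assumes e: "e > 0" and g: "\<And>s. \<bar>s\<bar> < e \<Longrightarrow> (g has_real_derivative g1 s) (at s)"
    and g1: "(g1 has_real_derivative d2) (at 0)"
    and min: "\<And>s. \<bar>s\<bar> < e \<Longrightarrow> g 0 \<le> g s"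
  shows "g1 0 = 0" "d2 \<ge> 0"
proof -
  show z: "g1 0 = 0"
    by (rule DERIV_local_min[OF g[of 0] e]) (use e min in auto)
  show "d2 \<ge> 0"
  proof (rule ccontr)
    assume "\<not> d2 \<ge> 0"
    then obtain d where d: "d > 0" "\<And>h. h > 0 \<Longrightarrow> h < d \<Longrightarrow> g1 (0 + h) < g1 0"
      using DERIV_neg_dec_right[OF g1] by auto
    define h where "h = min d e / 2"
    have h: "h > 0" "h < d" "h < e" using d(1) e by (auto simp: h_def)
    have "g h < g 0"
    proof (rule DERIV_neg_imp_decreasing_open[OF h(1)])
      fix x assume x: "0 < x" "x < h"
      then have "g1 x < 0" using d(2)[of x] z h by auto
      with g[of x] x h show "\<exists>y. (g has_real_derivative y) (at x) \<and> y < 0" by auto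
    next
      show "continuous_on {0..h} g"
        by (rule DERIV_atLeastAtMost_imp_continuous_on) (use g h in force)
    qed
    with min[of h] h show False by auto
  qed
qed

text \<open>At a negative minimum over the compact cylinder the first axis derivatives vanish, the
  second ones are non-negative and the time derivative is at most 0, against \<open>key\<close>. As
  \<open>key\<close> is asked only where the spatial gradient of \<open>D\<close> vanishes, two
  functions whose difference is \<open>D\<close> have equal gradients there, and a nonlinear
  gradient term can be evaluated explicitly.\<close>

lemma parabolic_comparison:
  fixes D :: "real \<Rightarrow> 'a::euclidean_space \<Rightarrow> real"
  assumes K: "compact K" and cont: "continuous_on ({a..T} \<times> K) (\<lambda>(t, x). D t x)"
    and init: "\<And>x. x \<in> K \<Longrightarrow> 0 \<le> D a x"
    and bdry: "\<And>t x. a < t \<Longrightarrow> t \<le> T \<Longrightarrow> x \<in> K \<Longrightarrow> x \<notin> interior K \<Longrightarrow> 0 \<le> D t x"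
    and dt: "\<And>t x. a < t \<Longrightarrow> t \<le> T \<Longrightarrow> ((\<lambda>s. D s x) has_real_derivative Dt t x) (at t)"
    and d1: "\<And>t x b. a < t \<Longrightarrow> t \<le> T \<Longrightarrow> b \<in> Basis \<Longrightarrow> axis_deriv (D t) (D1 b t x) b x"
    and d2: "\<And>t x b. a < t \<Longrightarrow> t \<le> T \<Longrightarrow> b \<in> Basis \<Longrightarrow> axis_deriv (D1 b t) (D2 b t x) b x"
    and key: "\<And>t x. a < t \<Longrightarrow> t \<le> T \<Longrightarrow> x \<in> K \<Longrightarrow> D t x < 0 \<Longrightarrow> (\<And>b. b \<in> Basis \<Longrightarrow> D1 b t x = 0)
        \<Longrightarrow> (\<Sum>b\<in>Basis. D2 b t x) < Dt t x"
    and tx: "a \<le> t" "t \<le> T" "x \<in> K"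
  shows "0 \<le> D t x"
proof -
  have "compact ({a..T} \<times> K)" "{a..T} \<times> K \<noteq> {}" using K tx by (auto intro: compact_Times)
  from continuous_attains_inf[OF this cont] obtain t0 x0
    where 0: "a \<le> t0" "t0 \<le> T" "x0 \<in> K" and min: "\<And>s y. a \<le> s \<Longrightarrow> s \<le> T \<Longrightarrow> y \<in> K \<Longrightarrow> D t0 x0 \<le> D s y"
    by (auto simp: split_beta)
  have "0 \<le> D t0 x0"
  proof (rule ccontr)
    assume neg: "\<not> 0 \<le> D t0 x0"
    then have t0: "a < t0" using init 0 by (metis less_eq_real_def)
    then have "x0 \<in> interior K" using bdry 0 neg by blast
    then obtain e where e: "e > 0" "ball x0 e \<subseteq> K" by (auto simp: mem_interior)
    have sp: "D1 b t0 x0 = 0 \<and> D2 b t0 x0 \<ge> 0" if b: "b \<in> Basis" for b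
    proof -
      have "D1 b t0 (x0 + 0 *\<^sub>R b) = 0 \<and> D2 b t0 x0 \<ge> 0"
      proof (intro conjI second_derivative_local_min[OF e(1), where g = "\<lambda>s. D t0 (x0 + s *\<^sub>R b)" and ?g1.0 = "\<lambda>s. D1 b t0 (x0 + s *\<^sub>R b)"])
        show "((\<lambda>s. D t0 (x0 + s *\<^sub>R b)) has_real_derivative D1 b t0 (x0 + s *\<^sub>R b)) (at s)" for s
          by (rule axis_deriv_shift[OF d1[OF t0 0(2) b]])
        then show "((\<lambda>s. D t0 (x0 + s *\<^sub>R b)) has_real_derivative D1 b t0 (x0 + s *\<^sub>R b)) (at s)" for s .
        show "axis_deriv (D1 b t0) (D2 b t0 x0) b x0" by (rule d2[OF t0 0(2) b])
        then show "axis_deriv (D1 b t0) (D2 b t0 x0) b x0" .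
        fix s assume "\<bar>s\<bar> < e"
        then have "x0 + s *\<^sub>R b \<in> K" using e(2) b by (intro subsetD[OF e(2)]) (simp add: dist_norm)
        from min[OF 0(1,2) this] show "D t0 (x0 + 0 *\<^sub>R b) \<le> D t0 (x0 + s *\<^sub>R b)" by simp
        then show "D t0 (x0 + 0 *\<^sub>R b) \<le> D t0 (x0 + s *\<^sub>R b)" .
      qed
      then show ?thesis by simp
    qed
    \<comment> \<open>The minimum may lie at the final time \<open>T\<close>, so only earlier times
      are available for comparison; \<open>a < t0\<close> leaves room for them.\<close>
    have "Dt t0 x0 \<le> 0"
    proof (rule ccontr)
      assume "\<not> Dt t0 x0 \<le> 0"
      then obtain d where d: "d > 0" "\<And>h. h > 0 \<Longrightarrow> h < d \<Longrightarrow> D (t0 - h) x0 < D t0 x0"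
        using DERIV_pos_inc_left[OF dt[OF t0 0(2)]] by (meson not_less)
      define h where "h = min d (t0 - a) / 2"
      have "h > 0" "h < d" "h < t0 - a" using d(1) t0 by (auto simp: h_def min_def)
      then show False using d(2)[of h] min[of "t0 - h" x0] 0 by auto
    qed
    moreover have "0 \<le> (\<Sum>b\<in>Basis. D2 b t0 x0)" using sp by (auto intro: sum_nonneg)
    ultimately show False using key[OF t0 0(2,3)] neg sp by fastforce
  qed
  with min[OF tx] show ?thesis by linarith
qed

section \<open>Non-decaying barriers\<close>

text \<open>Supersolutions of the equation for - u. Non-negativity is included because barriers are
  compared with \<open>w\<close> on a ball at whose boundary they are at most 0. The derivatives are
  bound existentially and taken along axes: this is what \<open>parabolic_comparison\<close> asks
  for and what averages of a solution provide directly.\<close>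

definition supersolution :: "real \<Rightarrow> (real \<Rightarrow> 'a::euclidean_space \<Rightarrow> real) \<Rightarrow> bool" where
  "supersolution q w \<longleftrightarrow> (\<forall>t\<ge>0. \<forall>x. 0 \<le> w t x) \<and> continuous_on ({0..} \<times> UNIV) (\<lambda>(t, x). w t x) \<and>
     (\<exists>wt w1 w2. \<forall>t>0. \<forall>x. ((\<lambda>s. w s x) has_real_derivative wt t x) (at t) \<and>
        (\<forall>b\<in>Basis. axis_deriv (w t) (w1 b t x) b x \<and> axis_deriv (w1 b t) (w2 b t x) b x) \<and>
        (\<Sum>b\<in>Basis. w2 b t x) + norm (\<Sum>b\<in>Basis. w1 b t x *\<^sub>R b) powr q \<le> wt t x)"

lemma axis_deriv_norm_powr:
  assumes "z \<noteq> 0"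
  shows "axis_deriv (\<lambda>x. norm x powr a) (a * norm z powr (a - 2) * (z \<bullet> b)) b z"
proof -
  have "((\<lambda>s. z + s *\<^sub>R b) has_derivative (\<lambda>s. s *\<^sub>R b)) (at 0)"
    by (auto intro!: derivative_eq_intros)
  moreover have "(norm has_derivative (\<lambda>h. h \<bullet> sgn z)) (at (z + 0 *\<^sub>R b))"
    using has_derivative_norm[OF assms] by simp
  ultimately have "((\<lambda>s. norm (z + s *\<^sub>R b)) has_derivative (\<lambda>s. (s *\<^sub>R b) \<bullet> sgn z)) (at 0)"
    by (rule has_derivative_compose)
  then have n: "((\<lambda>s. norm (z + s *\<^sub>R b)) has_real_derivative (b \<bullet> sgn z)) (at 0)"
    by (simp add: has_field_derivative_def mult_commute_abs)
  have "((\<lambda>s. norm (z + s *\<^sub>R b) powr a) has_real_derivative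
     a * norm (z + 0 *\<^sub>R b) powr (a - 1) * (b \<bullet> sgn z)) (at 0)"
    using DERIV_fun_powr[OF n, of a] assms by (simp add: mult_ac)
  moreover have "norm z powr (a - 1) = norm z powr (a - 2) * norm z"
    using assms powr_add[of "norm z" "a - 2" 1] by simp
  then have "a * norm (z + 0 *\<^sub>R b) powr (a - 1) * (b \<bullet> sgn z) = a * norm z powr (a - 2) * (z \<bullet> b)"
    using assms by (simp add: sgn_div_norm inner_commute)
  ultimately show ?thesis by (simp only:)
qed

lemma axis_deriv_norm_powr':
  fixes z :: "'a::euclidean_space"
  assumes "1 < a" "b \<in> Basis"
  shows "axis_deriv (\<lambda>x. norm x powr a) (a * norm z powr (a - 2) * (z \<bullet> b)) b z"
proof (cases "z = 0")
  case False then show ?thesis by (rule axis_deriv_norm_powr)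
next
  case True
  have "((\<lambda>s::real. \<bar>s\<bar> powr (a - 1)) \<longlongrightarrow> 0 powr (a - 1)) (at 0)"
    by (rule tendsto_powr2) (use assms in \<open>auto intro!: tendsto_eq_intros\<close>)
  then have "((\<lambda>s::real. \<bar>s\<bar> powr (a - 1)) \<longlongrightarrow> 0) (at 0)" by simp
  then have "((\<lambda>s::real. \<bar>\<bar>s\<bar> powr a / s\<bar>) \<longlongrightarrow> 0) (at 0)"
    by (rule Lim_transform_eventually)
       (auto simp: eventually_at powr_diff abs_mult intro!: exI[of _ 1])
  then have "((\<lambda>s::real. \<bar>s\<bar> powr a / s) \<longlongrightarrow> 0) (at 0)"
    by (rule tendsto_rabs_zero_cancel)
  then show ?thesis using True assms by (simp add: has_field_derivative_iff)
qed

text \<open>With p > 2 the second derivative extends by 0 to the origin. Both summands are 0 there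
  because \<open>0 powr a = 0\<close>, so the possibly negative exponent p - 4 does no harm.\<close>

lemma axis_deriv_norm_powr_2:
  fixes z :: "'a::euclidean_space"
  assumes p: "2 < p" and b: "b \<in> Basis"
  shows "axis_deriv (\<lambda>x. p * norm x powr (p - 2) * (x \<bullet> b))
     (p * (p - 2) * norm z powr (p - 4) * (z \<bullet> b)\<^sup>2 + p * norm z powr (p - 2)) b z"
proof (cases "z = 0")
  case False
  have "axis_deriv (\<lambda>x. x \<bullet> b) 1 b z"
    using b by (auto intro!: derivative_eq_intros simp: inner_simps)
  from DERIV_mult[OF axis_deriv_norm_powr[OF False, where a = "p - 2" and b = b] this]
  have "axis_deriv (\<lambda>x. norm x powr (p - 2) * (x \<bullet> b))
     ((p - 2) * norm z powr (p - 4) * (z \<bullet> b)\<^sup>2 + norm z powr (p - 2)) b z"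
    by (simp add: power2_eq_square mult_ac)
  from DERIV_cmult[OF this, of p] show ?thesis by (simp add: algebra_simps)
next
  case True
  have "((\<lambda>s::real. p * \<bar>s\<bar> powr (p - 2)) \<longlongrightarrow> p * 0 powr (p - 2)) (at 0)"
    by (intro tendsto_intros tendsto_powr2) (use p in \<open>auto intro!: tendsto_eq_intros\<close>)
  then have "((\<lambda>s::real. p * \<bar>s\<bar> powr (p - 2)) \<longlongrightarrow> 0) (at 0)" by simp
  then have "((\<lambda>s::real. p * \<bar>s\<bar> powr (p - 2) * s / s) \<longlongrightarrow> 0) (at 0)"
    by (rule Lim_transform_eventually)
       (use p in \<open>auto simp: eventually_at intro!: exI[of _ 1]\<close>)
  then show ?thesis using True b p by (simp add: has_field_derivative_iff)
qed

text \<open>The left side is the Laplacian cost of the barrier. For large r the first term on the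
  right absorbs it. Otherwise r^2 is at most (C / k) c powr (1 - q), and with p = q / (q - 1)
  inserting this leaves the power c powr (q / 2).\<close>

lemma barrier_inequality:
  fixes C k q :: real
  assumes q: "1 < q" "q < 2" and p: "p = q / (q - 1)" and C: "0 < C" and k: "0 < k"
  obtains L where "0 < L"
    "\<And>c r. 0 < c \<Longrightarrow> 0 \<le> r \<Longrightarrow> c * C * r powr (p - 2) < k * c powr q * r powr p + L * c powr (q / 2)"
proof
  \<comment> \<open>The summand 1 makes the inequality strict in the second case, as
    \<open>key\<close> of \<open>parabolic_comparison\<close> requires.\<close>
  define L where "L = C * (C / k) powr ((p - 2) / 2) + 1"
  show "0 < L" using C k by (auto simp: L_def intro!: add_nonneg_pos)
  have p2: "p > 2" using q by (simp add: p field_simps)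
  fix c r :: real assume c: "0 < c" and r: "0 \<le> r"
  show "c * C * r powr (p - 2) < k * c powr q * r powr p + L * c powr (q / 2)"
  proof (cases "k * c powr q * r\<^sup>2 \<ge> c * C")
    case True
    moreover have "0 < c * C" using c C by simp
    ultimately have "r \<noteq> 0" by auto
    then have "r powr p = r\<^sup>2 * r powr (p - 2)" using r by (simp add: powr_diff powr_numeral)
    then have "c * C * r powr (p - 2) \<le> k * c powr q * r powr p"
      using mult_right_mono[OF True, of "r powr (p - 2)"] by (simp add: mult_ac)
    moreover have "0 < L * c powr (q / 2)" using \<open>0 < L\<close> c by simp
    ultimately show ?thesis by linarith
  next
    case False
    have "k * c powr q * r\<^sup>2 < c * C" using False by simp
    then have "r\<^sup>2 \<le> C / k * c powr (1 - q)" using c k by (simp add: powr_diff field_simps)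
    then have "(r\<^sup>2) powr ((p - 2) / 2) \<le> (C / k * c powr (1 - q)) powr ((p - 2) / 2)"
      using p2 by (intro powr_mono2) auto
    moreover have "(r\<^sup>2) powr ((p - 2) / 2) = r powr (p - 2)"
    proof (cases "r = 0")
      case False
      have "2 * ((p - 2) / 2) = p - 2" by simp
      moreover have "r powr 2 = r\<^sup>2" using r False by simp
      ultimately show ?thesis using powr_powr[of r 2 "(p - 2) / 2"] by (simp only:)
    qed simp
    moreover have "(1 - q) * ((p - 2) / 2) = q / 2 - 1" using q by (simp add: p field_simps)
    then have "(C / k * c powr (1 - q)) powr ((p - 2) / 2) = (C / k) powr ((p - 2) / 2) * c powr (q / 2 - 1)"
      using c C k powr_powr[of c "1 - q" "(p - 2) / 2"] powr_mult[of "C / k" "c powr (1 - q)" "(p - 2) / 2"] by (simp add: diff_divide_distrib)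
    ultimately have "r powr (p - 2) \<le> (C / k) powr ((p - 2) / 2) * c powr (q / 2 - 1)"
      by (simp only:)
    then have "c * C * r powr (p - 2) \<le> c * C * ((C / k) powr ((p - 2) / 2) * c powr (q / 2 - 1))"
      using c C by (intro mult_left_mono) auto
    also have "\<dots> = C * (C / k) powr ((p - 2) / 2) * c powr (q / 2)"
      using c powr_diff[of c "q / 2" 1] by simp
    also have "\<dots> < L * c powr (q / 2)" using c by (simp add: L_def algebra_simps)
    also have "\<dots> \<le> k * c powr q * r powr p + L * c powr (q / 2)" using k by simp
    finally show ?thesis .
  qed
qed


text \<open>\<open>L\<close> is fixed before the supersolution, the centre, the height and the
  steepness, so that it can later be played off against a large parameter. The loss is small for
  flat barriers because 1 - q / 2 > 0.\<close>

lemma supersolution_above_barrier: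
  fixes q :: real
  assumes q: "1 < q" "q < 2" and p: "p = q / (q - 1)"
  obtains L where "0 < L"
    "\<And>(w :: real \<Rightarrow> 'a::euclidean_space \<Rightarrow> real) x0 M0 c0 t. supersolution q w \<Longrightarrow> 0 < c0 \<Longrightarrow>
       (\<And>x. M0 - c0 * norm (x - x0) powr p \<le> w 0 x) \<Longrightarrow> 0 \<le> t \<Longrightarrow>
       M0 - L * c0 powr (1 - q / 2) \<le> w t x0"
proof -
  define N where "N = real DIM('a)"
  \<comment> \<open>The Laplacian of |x| powr p is C |x| powr (p - 2). The q-th power of the
    gradient of c |x| powr p is 2 k c powr q |x| powr p, since (p - 1) q = p: one half pays for the
    decrease of c, the other for the Laplacian.\<close>
  define C where "C = p * (p + N - 2)"
  define k where "k = p powr q / 2"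
  have p2: "2 < p" using q by (simp add: p field_simps)
  have N: "N \<ge> 1" by (simp add: N_def DIM_ge_Suc0)
  have C: "0 < C" and k: "0 < k" using p2 N by (auto simp: C_def k_def)
  from barrier_inequality[OF q p C k] obtain L' where L': "0 < L'"
    "\<And>c r. 0 < c \<Longrightarrow> 0 \<le> r \<Longrightarrow> c * C * r powr (p - 2) < k * c powr q * r powr p + L' * c powr (q / 2)" by blast
  \<comment> \<open>With c' = - k c powr q, the rate L' c powr (q / 2) is minus the time derivative
    of L c powr (1 - q / 2). The total loss of height is thus at most L c0 powr (1 - q / 2).\<close>
  define L where "L = L' / ((1 - q / 2) * k)"
  have L: "0 < L" using L' k q by (simp add: L_def)
  have Lk: "L * (1 - q / 2) * k = L'" using k q by (simp add: L_def)
  show ?thesis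
  proof (rule that[OF L])
    fix w :: "real \<Rightarrow> 'a \<Rightarrow> real" and x0 :: 'a and M0 c0 T :: real
    assume w: "supersolution q w" and c0: "0 < c0" and T: "0 \<le> T"
      and init: "\<And>x. M0 - c0 * norm (x - x0) powr p \<le> w 0 x"
    from w have w0: "\<And>t x. 0 \<le> t \<Longrightarrow> 0 \<le> w t x"
      and wc: "continuous_on ({0..} \<times> UNIV) (\<lambda>(t, x). w t x)"
      by (auto simp: supersolution_def)
    from w obtain wt w1 w2 where ww: "\<forall>t>0. \<forall>x. ((\<lambda>s. w s x) has_real_derivative wt t x) (at t) \<and>
        (\<forall>b\<in>Basis. axis_deriv (w t) (w1 b t x) b x \<and> axis_deriv (w1 b t) (w2 b t x) b x) \<and>
        (\<Sum>b\<in>Basis. w2 b t x) + norm (\<Sum>b\<in>Basis. w1 b t x *\<^sub>R b) powr q \<le> wt t x"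
      unfolding supersolution_def by blast
    then have
      wt: "\<And>t x. 0 < t \<Longrightarrow> ((\<lambda>s. w s x) has_real_derivative wt t x) (at t)" and
      w1: "\<And>t x b. 0 < t \<Longrightarrow> b \<in> Basis \<Longrightarrow> axis_deriv (w t) (w1 b t x) b x" and
      w2: "\<And>t x b. 0 < t \<Longrightarrow> b \<in> Basis \<Longrightarrow> axis_deriv (w1 b t) (w2 b t x) b x" and
      super: "\<And>t x. 0 < t \<Longrightarrow> (\<Sum>b\<in>Basis. w2 b t x) + norm (\<Sum>b\<in>Basis. w1 b t x *\<^sub>R b) powr q \<le> wt t x"
      by auto
    \<comment> \<open>The equation c' = - k c powr q makes c powr (1 - q) linear in time;
      \<open>e\<close> is this linear function.\<close>
    define e where "e t = c0 powr (1 - q) + (q - 1) * k * t" for t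
    define c where "c t = e t powr (- 1 / (q - 1))" for t
    define M where "M t = M0 - L * (c0 powr (1 - q / 2) - c t powr (1 - q / 2))" for t
    define r where "r x = norm (x - x0)" for x
    have e: "0 < e t" if "0 \<le> t" for t using that q k c0 by (auto simp: e_def intro!: add_pos_nonneg)
    have c: "0 < c t" if "0 \<le> t" for t using e[OF that] by (simp add: c_def)
    have "(1 - q) * (- 1 / (q - 1)) = 1" using q by (simp add: field_simps)
    then have c_0: "c 0 = c0" using c0 powr_powr[of c0 "1 - q" "- 1 / (q - 1)"] by (simp add: c_def e_def)
    have c_anti: "c t \<le> c s" if "0 \<le> s" "s \<le> t" for s t
      unfolding c_def using that q k e[OF that(1)]
      by (intro powr_mono2') (auto simp: e_def intro!: mult_left_mono)
    have M_0: "M 0 = M0" by (simp add: M_def c_0)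
    have M_le: "M t \<le> M0" if "0 \<le> t" for t
      using c_anti[of 0 t] c[OF that] that q L unfolding M_def c_0
      by (simp add: powr_mono2)
    have dc: "(c has_real_derivative - k * c t powr q) (at t)" if "0 \<le> t" for t
    proof -
      have "(e has_real_derivative (q - 1) * k) (at t)"
        unfolding e_def by (auto intro!: derivative_eq_intros)
      from DERIV_fun_powr[OF this e[OF that], of "- 1 / (q - 1)"]
      have "(c has_real_derivative - 1 / (q - 1) * e t powr (- 1 / (q - 1) - 1) * ((q - 1) * k)) (at t)"
        using q by (simp add: c_def[abs_def])
      moreover have "- 1 / (q - 1) - 1 = - 1 / (q - 1) * q" using q by (simp add: field_simps)
      then have "e t powr (- 1 / (q - 1) - 1) = c t powr q" unfolding c_def powr_powr by simp
      ultimately show ?thesis using q by (simp add: mult.commute)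
    qed
    have dM: "(M has_real_derivative - L' * c t powr (q / 2)) (at t)" if "0 \<le> t" for t
    proof -
      have "((\<lambda>t. c t powr (1 - q / 2)) has_real_derivative
          (1 - q / 2) * c t powr (1 - q / 2 - 1) * (- k * c t powr q)) (at t)"
        using DERIV_fun_powr[OF dc[OF that] c[OF that], of "1 - q / 2"] by simp
      moreover have "c t powr (1 - q / 2 - 1) * c t powr q = c t powr (q / 2)"
        by (simp add: powr_add [symmetric])
      then have "(1 - q / 2) * c t powr (1 - q / 2 - 1) * (- k * c t powr q) = - ((1 - q / 2) * k) * c t powr (q / 2)"
        by (metis (no_types, lifting) mult.assoc mult.left_commute mult_minus_left mult_minus_right)
      ultimately have d: "((\<lambda>t. c t powr (1 - q / 2)) has_real_derivative - ((1 - q / 2) * k) * c t powr (q / 2)) (at t)"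
        by (simp only:)
      have "(M has_real_derivative 0 - L * (0 - - ((1 - q / 2) * k) * c t powr (q / 2))) (at t)"
        unfolding M_def by (intro DERIV_diff DERIV_const DERIV_cmult d)
      moreover have "0 - L * (0 - - ((1 - q / 2) * k) * c t powr (q / 2)) = - L' * c t powr (q / 2)"
        unfolding Lk[symmetric] by (simp add: algebra_simps)
      ultimately show ?thesis by (simp only:)
    qed
    \<comment> \<open>Beyond this radius the barrier is at most 0 up to time \<open>T\<close>: c is
      smallest at \<open>T\<close> and the height never exceeds \<open>M0\<close>. The summand 1
      makes the radius positive.\<close>
    define \<rho> where "\<rho> = (\<bar>M0\<bar> / c T) powr (1 / p) + 1"
    have \<rho>: "M t - c t * r x powr p \<le> 0" if "\<rho> \<le> r x" "0 \<le> t" "t \<le> T" for t x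
    proof -
      have "(\<bar>M0\<bar> / c T) powr (1 / p) \<le> r x" using that by (simp add: \<rho>_def)
      then have "((\<bar>M0\<bar> / c T) powr (1 / p)) powr p \<le> r x powr p" using p2 by (intro powr_mono2) auto
      then have "\<bar>M0\<bar> / c T \<le> r x powr p" using p2 c[OF T] by (simp add: powr_powr)
      then have "\<bar>M0\<bar> \<le> c T * r x powr p" using c[OF T] by (simp add: field_simps)
      also have "\<dots> \<le> c t * r x powr p" using c_anti[OF that(2,3)] by (intro mult_right_mono) auto
      finally show ?thesis using M_le[OF that(2)] by linarith
    qed
    define D where "D t x = w t x - (M t - c t * r x powr p)" for t x
    have "0 \<le> D T x0"
    proof (rule parabolic_comparison[where K = "cball x0 \<rho>" and a = 0 and T = T and D = D
          and Dt = "\<lambda>t x. wt t x - (- L' * c t powr (q / 2) - - k * c t powr q * r x powr p)"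
          and ?D1.0 = "\<lambda>b t x. w1 b t x + c t * (p * r x powr (p - 2) * ((x - x0) \<bullet> b))"
          and ?D2.0 = "\<lambda>b t x. w2 b t x + c t * (p * (p - 2) * r x powr (p - 4) * ((x - x0) \<bullet> b)\<^sup>2 + p * r x powr (p - 2))"])
      have ct: "continuous_on {0..T} c"
        by (rule DERIV_atLeastAtMost_imp_continuous_on) (use dc in force)
      have Mt: "continuous_on {0..T} M"
        by (rule DERIV_atLeastAtMost_imp_continuous_on) (use dM in force)
      have "continuous_on ({0..T} \<times> cball x0 \<rho>) (\<lambda>z. case z of (t, x) \<Rightarrow> w t x)"
        by (rule continuous_on_subset[OF wc]) auto
      moreover have "continuous_on ({0..T} \<times> cball x0 \<rho>) (\<lambda>z. c (fst z))"
        by (rule continuous_on_compose2[OF ct]) (auto intro!: continuous_intros)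
      moreover have "continuous_on ({0..T} \<times> cball x0 \<rho>) (\<lambda>z. M (fst z))"
        by (rule continuous_on_compose2[OF Mt]) (auto intro!: continuous_intros)
      moreover have "continuous_on ({0..T} \<times> cball x0 \<rho>) (\<lambda>z. r (snd z) powr p)"
        unfolding r_def using p2 by (intro continuous_on_powr') (auto intro!: continuous_intros)
      ultimately show "continuous_on ({0..T} \<times> cball x0 \<rho>) (\<lambda>(t, x). D t x)"
        unfolding D_def split_beta by (intro continuous_on_diff continuous_on_mult)
      show "0 \<le> D 0 x" for x using init[of x] by (simp add: D_def M_0 c_0 r_def)
      show "0 \<le> D t x" if "0 < t" "t \<le> T" "x \<notin> interior (cball x0 \<rho>)" for t x
        using \<rho>[of x t] w0[of t x] that by (simp add: D_def r_def interior_cball dist_norm norm_minus_commute)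
      show "((\<lambda>s. D s x) has_real_derivative
          wt t x - (- L' * c t powr (q / 2) - - k * c t powr q * r x powr p)) (at t)" if "0 < t" "t \<le> T" for t x
        unfolding D_def using that
        by (intro DERIV_diff wt dM DERIV_cmult_right dc) auto
      show "axis_deriv (D t) (w1 b t x + c t * (p * r x powr (p - 2) * ((x - x0) \<bullet> b))) b x"
        if "0 < t" "t \<le> T" "b \<in> Basis" for t x b
      proof -
        have "axis_deriv (\<lambda>y. r y powr p) (p * r x powr (p - 2) * ((x - x0) \<bullet> b)) b x"
          using axis_deriv_norm_powr'[of p b "x - x0"] p2 that by (simp add: r_def diff_add_eq)
        from DERIV_add[OF w1[OF that(1,3), of x] DERIV_cmult[OF this, of "c t"]]
        have "((\<lambda>s. w t (x + s *\<^sub>R b) + c t * r (x + s *\<^sub>R b) powr p - M t) has_real_derivative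
           w1 b t x + c t * (p * r x powr (p - 2) * ((x - x0) \<bullet> b)) - 0) (at 0)"
          by (intro DERIV_diff DERIV_const)
        then show ?thesis by (simp add: D_def algebra_simps)
      qed
      show "axis_deriv (\<lambda>x. w1 b t x + c t * (p * r x powr (p - 2) * ((x - x0) \<bullet> b)))
          (w2 b t x + c t * (p * (p - 2) * r x powr (p - 4) * ((x - x0) \<bullet> b)\<^sup>2 + p * r x powr (p - 2))) b x"
        if "0 < t" "t \<le> T" "b \<in> Basis" for t x b
      proof -
        have "axis_deriv (\<lambda>x. p * r x powr (p - 2) * ((x - x0) \<bullet> b))
            (p * (p - 2) * r x powr (p - 4) * ((x - x0) \<bullet> b)\<^sup>2 + p * r x powr (p - 2)) b x"
          using axis_deriv_norm_powr_2[of p b "x - x0"] p2 that by (simp add: r_def diff_add_eq)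
        from DERIV_add[OF w2[OF that(1,3), of x] DERIV_cmult[OF this, of "c t"]]
        show ?thesis by simp
      qed
      show "(\<Sum>b\<in>Basis. w2 b t x + c t * (p * (p - 2) * r x powr (p - 4) * ((x - x0) \<bullet> b)\<^sup>2 + p * r x powr (p - 2)))
          < wt t x - (- L' * c t powr (q / 2) - - k * c t powr q * r x powr p)"
        if t: "0 < t" "t \<le> T" and g: "\<And>b. b \<in> Basis \<Longrightarrow> w1 b t x + c t * (p * r x powr (p - 2) * ((x - x0) \<bullet> b)) = 0" for t x
      proof -
        have ct: "0 < c t" using c t by simp
        \<comment> \<open>By \<open>g\<close> the gradient of \<open>w\<close> is that of the
          barrier, so the nonlinear term of the supersolution is known explicitly.\<close>
        have "(\<Sum>b\<in>Basis. w1 b t x *\<^sub>R b) = (\<Sum>b\<in>Basis. (- (c t * p * r x powr (p - 2))) *\<^sub>R (((x - x0) \<bullet> b) *\<^sub>R b))"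
          by (intro sum.cong refl) (use g in \<open>simp add: eq_neg_iff_add_eq_0 mult.assoc scaleR_left.minus[symmetric] del: scaleR_minus_left\<close>)
        also have "\<dots> = (- (c t * p * r x powr (p - 2))) *\<^sub>R (x - x0)"
          by (simp only: scaleR_sum_right[symmetric] euclidean_representation)
        finally have "norm (\<Sum>b\<in>Basis. w1 b t x *\<^sub>R b) = c t * p * (r x powr (p - 2) * r x)"
          using ct p2 by (simp add: r_def abs_mult)
        also have "r x powr (p - 2) * r x = r x powr (p - 1)"
          using powr_add[of "r x" "p - 2" 1] by (cases "r x = 0") (auto simp: r_def)
        finally have "norm (\<Sum>b\<in>Basis. w1 b t x *\<^sub>R b) powr q = c t powr q * p powr q * r x powr ((p - 1) * q)"
          using ct p2 by (simp add: powr_mult powr_powr r_def)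
        also have "(p - 1) * q = p" using q by (simp add: p field_simps)
        also have "p powr q = 2 * k" by (simp add: k_def)
        finally have gr: "norm (\<Sum>b\<in>Basis. w1 b t x *\<^sub>R b) powr q = 2 * (k * c t powr q * r x powr p)" by simp
        have sq: "(\<Sum>b\<in>Basis. ((x - x0) \<bullet> b)\<^sup>2) = (r x)\<^sup>2"
          unfolding r_def power2_norm_eq_inner euclidean_inner[of "x - x0" "x - x0"] by (simp add: power2_eq_square)
        have "r x powr (p - 4) * (r x)\<^sup>2 = r x powr (p - 2)"
          using powr_add[of "r x" "p - 4" 2] by (cases "r x = 0") (auto simp: r_def)
        then have "(\<Sum>b\<in>Basis. p * (p - 2) * r x powr (p - 4) * ((x - x0) \<bullet> b)\<^sup>2 + p * r x powr (p - 2)) = C * r x powr (p - 2)"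
          by (simp add: sum.distrib sum_distrib_left[symmetric] sq C_def N_def mult.assoc) (simp add: algebra_simps)
        then have "(\<Sum>b\<in>Basis. w2 b t x + c t * (p * (p - 2) * r x powr (p - 4) * ((x - x0) \<bullet> b)\<^sup>2 + p * r x powr (p - 2)))
           = (\<Sum>b\<in>Basis. w2 b t x) + c t * C * r x powr (p - 2)"
          by (simp only: sum.distrib sum_distrib_left[symmetric] mult.assoc)
        moreover have "c t * C * r x powr (p - 2) < k * c t powr q * r x powr p + L' * c t powr (q / 2)"
          by (rule L'(2)[OF ct]) (simp add: r_def)
        ultimately show ?thesis using super[OF t(1), of x] gr by simp
      qed
    qed (use T in \<open>auto simp: \<rho>_def\<close>)
    then have "M T \<le> w T x0" using p2 by (simp add: D_def r_def)
    moreover have "M0 - L * c0 powr (1 - q / 2) \<le> M T" using L by (simp add: M_def algebra_simps)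
    ultimately show "M0 - L * c0 powr (1 - q / 2) \<le> w T x0" by linarith
  qed
qed

section \<open>The profile equation\<close>

text \<open>The solution of \<open>W' + ((n - 1) / r + r / 2) W = g\<close> that is regular at \<open>r = 0\<close>.\<close>

definition volterra :: "nat \<Rightarrow> (real \<Rightarrow> real) \<Rightarrow> real \<Rightarrow> real" where
  "volterra n g r = (if r \<le> 0 then 0
     else integral {0..r} (\<lambda>s. s ^ (n - 1) * exp (s\<^sup>2 / 4) * g s) / (r ^ (n - 1) * exp (r\<^sup>2 / 4)))"

lemma indefinite_integral_continuous:
  fixes w :: "real \<Rightarrow> real"
  assumes "continuous_on UNIV w"
  shows "continuous_on UNIV (\<lambda>s. integral {0..s} w)"
proof -
  have "isCont (\<lambda>s. integral {0..s} w) s" for s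
  proof -
    define b where "b = \<bar>s\<bar> + 1"
    have "w integrable_on {0..b}"
      by (rule integrable_continuous_real) (rule continuous_on_subset[OF assms], simp)
    then have "continuous_on {0..b} (\<lambda>x. integral {0..x} w)"
      by (rule indefinite_integral_continuous_1)
    then have "continuous_on {-b<..<b} (\<lambda>x. integral {0..max 0 x} w)"
      by (rule continuous_on_compose2) (auto intro!: continuous_intros simp: b_def)
    moreover have "integral {0..max 0 x} w = integral {0..x} w" for x
      by (cases "0 \<le> x") (auto simp: max_def)
    ultimately have "continuous_on {-b<..<b} (\<lambda>x. integral {0..x} w)" by simp
    then show ?thesis by (rule continuous_on_interior) (auto simp: b_def)
  qed
  then show ?thesis by (simp add: continuous_at_imp_continuous_on)
qed

lemma indefinite_integral_derivative:
  fixes w :: "real \<Rightarrow> real"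
  assumes "continuous_on UNIV w" "0 \<le> r"
  shows "((\<lambda>x. integral {0..x} w) has_real_derivative w r) (at r within {0..})"
proof -
  have "((\<lambda>x. integral {0..x} w) has_real_derivative w r) (at r within {0..r+1})"
    by (rule integral_has_real_derivative) (use assms in \<open>auto intro: continuous_on_subset\<close>)
  moreover have "at r within {0..r+1} = at r within {0..}"
    by (rule at_within_nhd[where S = "{r-1<..<r+1}"]) auto
  ultimately show ?thesis by simp
qed

lemma at_within_Ici_pos: "0 < r \<Longrightarrow> at r within {0..} = at (r::real)"
  by (rule at_within_interior) (simp add: interior_Ici)

lemma volterra_weight_derivative:
  assumes "0 < r"
  shows "((\<lambda>r. r ^ m * exp (r\<^sup>2 / 4)) has_real_derivative (real m / r + r / 2) * (r ^ m * exp (r\<^sup>2 / 4))) (at r)"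
proof -
  have "real m * r ^ (m - 1) = real m / r * r ^ m" using assms by (cases m) auto
  then show ?thesis
    by (auto intro!: derivative_eq_intros simp: algebra_simps)
qed

lemma volterra_derivative:
  assumes g: "continuous_on UNIV g" and r: "0 < r"
  shows "(volterra n g has_real_derivative g r - (real (n - 1) / r + r / 2) * volterra n g r) (at r)"
proof -
  define k where "k r = r ^ (n - 1) * exp (r\<^sup>2 / 4)" for r :: real
  define P where "P r = integral {0..r} (\<lambda>s. k s * g s)" for r
  have kg: "continuous_on UNIV (\<lambda>s. k s * g s)"
    unfolding k_def by (intro continuous_intros g) auto
  have dP: "(P has_real_derivative k r * g r) (at r)"
    using indefinite_integral_derivative[OF kg, of r] r by (simp add: P_def[abs_def] at_within_Ici_pos)
  have dk: "(k has_real_derivative (real (n - 1) / r + r / 2) * k r) (at r)"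
    unfolding k_def by (rule volterra_weight_derivative[OF r])
  have k0: "k r \<noteq> 0" using r by (simp add: k_def)
  have "((\<lambda>r. P r / k r) has_real_derivative
      (k r * g r * k r - P r * ((real (n - 1) / r + r / 2) * k r)) / (k r * k r)) (at r)"
    by (rule DERIV_divide[OF dP dk k0])
  moreover have "(k r * g r * k r - P r * ((real (n - 1) / r + r / 2) * k r)) / (k r * k r)
     = g r - (real (n - 1) / r + r / 2) * (P r / k r)"
    using k0 by (simp add: diff_divide_distrib)
  moreover have volterra: "volterra n g r = P r / k r" if "r > 0" for r
    using that by (simp add: volterra_def P_def k_def)
  ultimately have "((\<lambda>r. P r / k r) has_real_derivative g r - (real (n - 1) / r + r / 2) * volterra n g r) (at r)"
    using r by simp
  then show ?thesis
    by (rule has_field_derivative_transform_within_open[where S = "{0<..}"]) (use r volterra in auto)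
qed

text \<open>The weight s^(n - 1) exp (s^2 / 4) increases, so dividing by its value at
  \<open>r\<close> leaves a quotient of at most 1. The singular coefficient (n - 1) / r thereby
  costs nothing in the estimates.\<close>

lemma volterra_bound:
  assumes g: "continuous_on UNIV g" and h: "continuous_on UNIV h" and r: "0 \<le> r"
    and gh: "\<And>s. 0 \<le> s \<Longrightarrow> s \<le> r \<Longrightarrow> \<bar>g s\<bar> \<le> h s"
  shows "\<bar>volterra n g r\<bar> \<le> integral {0..r} h"
proof (cases "r = 0")
  case False
  define k where "k r = r ^ (n - 1) * exp (r\<^sup>2 / 4)" for r :: real
  have k: "0 < k r" using r False by (simp add: k_def)
  have km: "0 \<le> k s" "k s \<le> k r" if "0 \<le> s" "s \<le> r" for s
    using that by (auto simp: k_def intro!: mult_mono power_mono)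
  have "norm (integral {0..r} (\<lambda>s. k s * g s)) \<le> integral {0..r} (\<lambda>s. k r * h s)"
  proof (rule integral_norm_bound_integral)
    show "(\<lambda>s. k s * g s) integrable_on {0..r}" "(\<lambda>s. k r * h s) integrable_on {0..r}"
      unfolding k_def
      by (auto intro!: integrable_continuous_real continuous_intros continuous_on_subset[OF g] continuous_on_subset[OF h])
    fix s assume "s \<in> {0..r}"
    then show "norm (k s * g s) \<le> k r * h s"
      using km[of s] gh[of s] by (auto simp: abs_mult intro!: mult_mono)
  qed
  then have "\<bar>integral {0..r} (\<lambda>s. k s * g s)\<bar> \<le> k r * integral {0..r} h" by simp
  then have "\<bar>integral {0..r} (\<lambda>s. k s * g s)\<bar> / k r \<le> integral {0..r} h"
    using k by (simp add: divide_le_eq mult.commute)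
  then show ?thesis using r False k by (simp add: volterra_def k_def abs_mult)
qed (simp add: volterra_def)

lemma volterra_minus:
  assumes g: "continuous_on UNIV g" and h: "continuous_on UNIV h"
  shows "volterra n (\<lambda>s. g s - h s) r = volterra n g r - volterra n h r"
proof -
  have "integral {0..r} (\<lambda>s. s ^ (n - 1) * exp (s\<^sup>2 / 4) * (g s - h s)) =
      integral {0..r} (\<lambda>s. s ^ (n - 1) * exp (s\<^sup>2 / 4) * g s) - integral {0..r} (\<lambda>s. s ^ (n - 1) * exp (s\<^sup>2 / 4) * h s)"
    unfolding right_diff_distrib
    by (rule integral_diff)
       (auto intro!: integrable_continuous_real continuous_intros continuous_on_subset[OF g] continuous_on_subset[OF h])
  then show ?thesis by (simp add: volterra_def diff_divide_distrib)
qed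

lemma volterra_continuous:
  assumes g: "continuous_on UNIV g"
  shows "continuous_on UNIV (volterra n g)"
proof -
  have "isCont (volterra n g) r" for r
  proof (cases "r = 0")
    case False
    show ?thesis
    proof (cases "r > 0")
      case True then show ?thesis using DERIV_isCont[OF volterra_derivative[OF g True]] by simp
    next
      case rneg: False
      have "continuous_on {..<0} (volterra n g)"
        by (rule continuous_on_eq[where f = "\<lambda>_. 0"]) (auto simp: volterra_def)
      then show ?thesis by (rule continuous_on_interior) (use False rneg in \<open>auto simp: interior_open\<close>)
    qed
  next
    case True
    have "continuous_on {0..1} (\<lambda>s. \<bar>g s\<bar>)"
      by (intro continuous_intros continuous_on_subset[OF g]) auto
    then have "bounded ((\<lambda>s. \<bar>g s\<bar>) ` {0..1})"
      by (intro compact_imp_bounded compact_continuous_image) auto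
    then obtain B where B: "\<And>s. 0 \<le> s \<Longrightarrow> s \<le> 1 \<Longrightarrow> \<bar>g s\<bar> \<le> B"
      unfolding bounded_iff by force
    have bd: "\<bar>volterra n g r\<bar> \<le> B * \<bar>r\<bar>" if "\<bar>r\<bar> < 1" for r
    proof (cases "r \<ge> 0")
      case True
      have "\<bar>volterra n g r\<bar> \<le> integral {0..r} (\<lambda>_. B)"
        by (rule volterra_bound[OF g]) (use True that B in auto)
      then show ?thesis using True by (simp add: mult.commute)
    next
      case False
      have "0 \<le> B" using B[of 0] abs_ge_zero[of "g 0"] by linarith
      then show ?thesis using False by (simp add: volterra_def mult_le_0_iff)
    qed
    have "((\<lambda>r. B * \<bar>r\<bar>) \<longlongrightarrow> B * \<bar>0\<bar>) (at (0::real))" by (intro tendsto_intros)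
    then have "((\<lambda>r. B * \<bar>r\<bar>) \<longlongrightarrow> 0) (at (0::real))" by simp
    moreover have "\<forall>\<^sub>F r in at 0. norm (volterra n g r) \<le> B * \<bar>r\<bar>"
      unfolding eventually_at by (rule exI[of _ 1]) (use bd in auto)
    ultimately have "(volterra n g \<longlongrightarrow> 0) (at 0)"
      by (rule Lim_null_comparison[rotated])
    then show ?thesis using True by (simp add: isCont_def volterra_def)
  qed
  then show ?thesis by (simp add: continuous_at_imp_continuous_on)
qed

lemma volterra_nonneg:
  assumes g: "continuous_on UNIV g" and "\<And>s. 0 \<le> s \<Longrightarrow> s \<le> r \<Longrightarrow> 0 \<le> g s"
  shows "0 \<le> volterra n g r"
proof -
  have "0 \<le> integral {0..r} (\<lambda>s. s ^ (n - 1) * exp (s\<^sup>2 / 4) * g s)"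
    by (rule integral_nonneg)
       (use assms(2) in \<open>auto intro!: integrable_continuous_real continuous_intros continuous_on_subset[OF g]\<close>)
  then show ?thesis by (simp add: volterra_def)
qed

lemma volterra_pos:
  assumes g: "continuous_on UNIV g" and r: "0 < r" and "\<And>s. 0 < s \<Longrightarrow> s < r \<Longrightarrow> 0 < g s"
  shows "0 < volterra n g r"
proof -
  define k where "k r = r ^ (n - 1) * exp (r\<^sup>2 / 4)" for r :: real
  have kg: "continuous_on UNIV (\<lambda>s. k s * g s)"
    unfolding k_def by (intro continuous_intros g) auto
  have "integral {0..0} (\<lambda>s. k s * g s) < integral {0..r} (\<lambda>s. k s * g s)"
  proof (rule DERIV_pos_imp_increasing_open[OF r])
    fix s assume "0 < s" "s < r"
    then show "\<exists>y. ((\<lambda>r. integral {0..r} (\<lambda>s. k s * g s)) has_real_derivative y) (at s) \<and> 0 < y"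
      using indefinite_integral_derivative[OF kg, of s] assms(3)[of s]
      by (intro exI[of _ "k s * g s"]) (auto simp: at_within_Ici_pos k_def)
  next
    show "continuous_on {0..r} (\<lambda>r. integral {0..r} (\<lambda>s. k s * g s))"
      by (rule continuous_on_subset[OF indefinite_integral_continuous[OF kg]]) auto
  qed
  then show ?thesis using r by (simp add: volterra_def k_def)
qed

text \<open>L'Hopital against r times the weight, that is r^n exp (r^2 / 4), whose derivative is n +
  r^2 / 2 times the weight. The limit is the slope at 0 of the regular solution: it starts the
  barrier arguments near the origin and fixes the Hessian of the radial function there.\<close>

lemma volterra_over_r:
  assumes g: "continuous_on UNIV g" and n: "1 \<le> n"
  shows "((\<lambda>r. volterra n g r / r) \<longlongrightarrow> g 0 / n) (at_right 0)"
proof -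
  define k where "k r = r ^ (n - 1) * exp (r\<^sup>2 / 4)" for r :: real
  define P where "P r = integral {0..r} (\<lambda>s. k s * g s)" for r
  define Q where "Q r = r ^ n * exp (r\<^sup>2 / 4)" for r :: real
  have kg: "continuous_on UNIV (\<lambda>s. k s * g s)"
    unfolding k_def by (intro continuous_intros g) auto
  have dP: "(P has_real_derivative k r * g r) (at r)" if "0 < r" for r
    using indefinite_integral_derivative[OF kg, of r] that by (simp add: P_def[abs_def] at_within_Ici_pos)
  have pos: "\<forall>\<^sub>F r in at_right 0. 0 < (r::real)" by (simp add: eventually_at_right_less)
  have "((\<lambda>r. P r / Q r) \<longlongrightarrow> g 0 / n) (at_right 0)"
  proof (rule lhopital_right_0[where f' = "\<lambda>r. k r * g r" and g' = "\<lambda>r. (real n / r + r / 2) * Q r"])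
    have "isCont P 0" using indefinite_integral_continuous[OF kg]
      by (simp add: continuous_on_eq_continuous_at P_def[abs_def])
    then show "(P \<longlongrightarrow> 0) (at_right 0)" by (simp add: isCont_def P_def filterlim_at_split)
    have "isCont Q 0" by (auto simp: Q_def[abs_def] intro!: continuous_intros)
    then show "(Q \<longlongrightarrow> 0) (at_right 0)" using n by (simp add: isCont_def Q_def filterlim_at_split power_0_left)
    show "\<forall>\<^sub>F r in at_right 0. Q r \<noteq> 0" using pos by eventually_elim (simp add: Q_def)
    show "\<forall>\<^sub>F r in at_right 0. (real n / r + r / 2) * Q r \<noteq> 0"
      using pos
    proof eventually_elim
      case (elim r)
      then have "0 < real n / r + r / 2" "0 < Q r" by (auto simp: Q_def intro!: add_nonneg_pos)
      then show ?case by simp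
    qed
    show "\<forall>\<^sub>F r in at_right 0. (P has_real_derivative k r * g r) (at r)"
      using pos by eventually_elim (rule dP)
    show "\<forall>\<^sub>F r in at_right 0. (Q has_real_derivative (real n / r + r / 2) * Q r) (at r)"
      using pos by eventually_elim (use volterra_weight_derivative in \<open>auto simp: Q_def[abs_def]\<close>)
    have "isCont g 0" using g by (simp add: continuous_on_eq_continuous_at)
    then have "(g \<longlongrightarrow> g 0) (at_right 0)" by (simp add: isCont_def filterlim_at_split)
    then have "((\<lambda>r. g r / (real n + r * r / 2)) \<longlongrightarrow> g 0 / (real n + 0 * 0 / 2)) (at_right 0)"
      using n by (intro tendsto_intros) auto
    then have "((\<lambda>r. g r / (real n + r * r / 2)) \<longlongrightarrow> g 0 / n) (at_right 0)" by simp
    then show "((\<lambda>r. k r * g r / ((real n / r + r / 2) * Q r)) \<longlongrightarrow> g 0 / n) (at_right 0)"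
    proof (rule Lim_transform_eventually)
      show "\<forall>\<^sub>F r in at_right 0. g r / (real n + r * r / 2) = k r * g r / ((real n / r + r / 2) * Q r)"
        using pos
      proof eventually_elim
        case (elim r)
        have "Q r = r * k r" using n by (cases n) (auto simp: Q_def k_def)
        moreover have "k r \<noteq> 0" using elim by (simp add: k_def)
        moreover have "(real n / r + r / 2) * (r * k r) = (real n + r * r / 2) * k r"
          using elim by (simp add: field_simps)
        ultimately show ?case by simp
      qed
    qed
  qed
  then show ?thesis
  proof (rule Lim_transform_eventually)
    show "\<forall>\<^sub>F r in at_right 0. P r / Q r = volterra n g r / r"
      using pos
    proof eventually_elim
      case (elim r)
      have "Q r = k r * r" using n by (cases n) (auto simp: Q_def k_def)
      then show ?case using elim by (simp add: volterra_def P_def k_def)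
    qed
  qed
qed

section \<open>Existence of profiles by a contraction, with Lipschitz dependence on the
  coupling\<close>

definition clip :: "real \<Rightarrow> real \<Rightarrow> real" where
  "clip M w = max 0 (min w M)"

text \<open>Cutting at \<open>M\<close> bounds the derivative of the power. Cutting at 0 keeps its
  base non-negative, as the sign of the unknown is not known before the fixed point is
  found.\<close>

lemma clip_powr_lipschitz:
  assumes q: "1 < q" and M: "0 < M"
  shows "\<bar>clip M x powr q - clip M y powr q\<bar> \<le> q * M powr (q - 1) * \<bar>x - y\<bar>"
proof -
  have *: "b powr q - a powr q \<le> q * M powr (q - 1) * (b - a)" if ab: "0 \<le> a" "a \<le> b" "b \<le> M" for a b
  proof (cases "a = b")
    case False
    then have "a < b" using ab by simp
    have d: "((\<lambda>x. x powr q) has_derivative (*) (q * x powr (q - 1))) (at x)" if "a < x" for x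
      using has_real_derivative_powr[of x q] that ab by (simp add: has_field_derivative_def)
    have "continuous_on {a..b} (\<lambda>x. x powr q)"
      using q ab by (intro continuous_on_powr') (auto intro!: continuous_intros)
    from mvt[OF \<open>a < b\<close> this d] obtain z
      where z: "a < z" "z < b" "b powr q - a powr q = q * z powr (q - 1) * (b - a)" by blast
    have "z powr (q - 1) \<le> M powr (q - 1)" using z ab q by (intro powr_mono2) auto
    then show ?thesis using z q ab by (auto simp: mult.commute intro!: mult_left_mono)
  qed simp
  have c: "0 \<le> clip M x" "clip M x \<le> M" "\<bar>clip M x - clip M y\<bar> \<le> \<bar>x - y\<bar>" for x y
    using M by (auto simp: clip_def max_def min_def)
  have C: "0 \<le> q * M powr (q - 1)" using q by simp
  have "\<bar>clip M x powr q - clip M y powr q\<bar> \<le> q * M powr (q - 1) * \<bar>clip M x - clip M y\<bar>"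
  proof (cases "clip M x \<le> clip M y")
    case True
    then have "clip M x powr q \<le> clip M y powr q" using c q by (intro powr_mono2) auto
    then show ?thesis using *[OF c(1) True c(2)] True by simp
  next
    case False
    then have "clip M y powr q \<le> clip M x powr q" using c q by (intro powr_mono2) auto
    then show ?thesis using *[OF c(1) _ c(2), of y x] False by simp
  qed
  also have "\<dots> \<le> q * M powr (q - 1) * \<bar>x - y\<bar>" by (rule mult_left_mono[OF c(3) C])
  finally show ?thesis .
qed

lemma clip_powr_le: "0 \<le> M \<Longrightarrow> 0 < q \<Longrightarrow> clip M w powr q \<le> M powr q"
  by (intro powr_mono2) (auto simp: clip_def)

text \<open>F is eliminated through F(s) = 1 - integral of \<open>w\<close>, so that the profile
  equation becomes a single Volterra equation for \<open>w\<close> = - F'.\<close>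

definition source :: "real \<Rightarrow> real \<Rightarrow> real \<Rightarrow> real \<Rightarrow> (real \<Rightarrow> real) \<Rightarrow> real \<Rightarrow> real" where
  "source \<alpha> q M \<kappa> w s = \<alpha> * (1 - integral {0..s} w) + \<kappa> * clip M (w s) powr q"

lemma source_continuous:
  assumes "continuous_on UNIV w" "0 < q"
  shows "continuous_on UNIV (source \<alpha> q M \<kappa> w)"
  unfolding source_def[abs_def] clip_def using assms
  by (intro continuous_intros indefinite_integral_continuous continuous_on_powr') auto

text \<open>The weight \<open>exp (\<Lambda> r)\<close> makes the integral operator a contraction on the whole half-line at once.\<close>

lemma volterra_difference:
  assumes q: "1 < q" and M: "0 < M" and \<alpha>: "0 < \<alpha>"
    and \<kappa>: "0 \<le> \<kappa>" "\<kappa> \<le> \<kappa>1" and \<Lambda>: "\<Lambda> = 2 * (\<alpha> + \<kappa>1 * (q * M powr (q - 1))) + 1"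
    and w: "continuous_on UNIV w" and v: "continuous_on UNIV v"
    and d: "\<And>s. 0 \<le> s \<Longrightarrow> \<bar>w s - v s\<bar> \<le> exp (\<Lambda> * s) * d" and d0: "0 \<le> d" and r: "0 \<le> r"
  shows "\<bar>volterra n (source \<alpha> q M \<kappa> w) r - volterra n (source \<alpha> q M \<kappa>' v) r\<bar>
     \<le> exp (\<Lambda> * r) * (d / 2 + M powr q * \<bar>\<kappa> - \<kappa>'\<bar>)"
proof -
  define L where "L = \<kappa>1 * (q * M powr (q - 1))"
  have L: "0 \<le> L" using \<kappa> q by (simp add: L_def)
  have \<Lambda>1: "1 \<le> \<Lambda>" and \<Lambda>2: "2 * (\<alpha> + L) \<le> \<Lambda>" using \<alpha> L by (auto simp: \<Lambda> L_def)
  have sw: "continuous_on UNIV (source \<alpha> q M \<kappa> w)" and sv: "continuous_on UNIV (source \<alpha> q M \<kappa>' v)"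
    using w v q by (auto intro!: source_continuous)
  have int_exp: "integral {0..s} (\<lambda>t. exp (\<Lambda> * t) * c) \<le> exp (\<Lambda> * s) * c / \<Lambda>" if "0 \<le> s" "0 \<le> c" for s c
  proof -
    have "((\<lambda>t. exp (\<Lambda> * t) * c) has_integral (exp (\<Lambda> * s) * c / \<Lambda> - exp (\<Lambda> * 0) * c / \<Lambda>)) {0..s}"
      by (rule fundamental_theorem_of_calculus[OF that(1)])
         (use \<Lambda>1 in \<open>auto intro!: derivative_eq_intros simp: has_real_derivative_iff_has_vector_derivative[symmetric]\<close>)
    from integral_unique[OF this] show ?thesis using that \<Lambda>1 by (simp del: integral_mult_left)
  qed
  define h where "h s = exp (\<Lambda> * s) * ((\<alpha> + L) * d) + M powr q * \<bar>\<kappa> - \<kappa>'\<bar>" for s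
  have ih: "(\<lambda>t. exp (\<Lambda> * t) * c) integrable_on {0..s}" for s c
    by (intro integrable_continuous_real continuous_intros)
  have "\<bar>volterra n (\<lambda>s. source \<alpha> q M \<kappa> w s - source \<alpha> q M \<kappa>' v s) r\<bar> \<le> integral {0..r} h"
  proof (rule volterra_bound[OF continuous_on_diff[OF sw sv] _ r])
    show "continuous_on UNIV h" unfolding h_def by (intro continuous_intros)
    fix s :: real assume s: "0 \<le> s"
    have wi: "w integrable_on {0..s}" and vi: "v integrable_on {0..s}"
      by (auto intro!: integrable_continuous_real continuous_on_subset[OF w] continuous_on_subset[OF v])
    have "norm (integral {0..s} (\<lambda>t. w t - v t)) \<le> integral {0..s} (\<lambda>t. exp (\<Lambda> * t) * d)"
      by (rule integral_norm_bound_integral) (use wi vi ih d in \<open>auto intro: integrable_diff\<close>)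
    also have "\<dots> \<le> exp (\<Lambda> * s) * d / \<Lambda>" by (rule int_exp[OF s d0])
    also have "\<dots> \<le> exp (\<Lambda> * s) * d" using \<Lambda>1 d0 mult_left_mono[OF \<Lambda>1, of "exp (\<Lambda> * s) * d"] by (simp add: divide_le_eq)
    finally have I: "\<bar>integral {0..s} w - integral {0..s} v\<bar> \<le> exp (\<Lambda> * s) * d"
      using integral_diff[OF wi vi] by simp
    have "\<kappa> * \<bar>clip M (w s) powr q - clip M (v s) powr q\<bar> \<le> \<kappa>1 * (q * M powr (q - 1) * \<bar>w s - v s\<bar>)"
      using \<kappa> q by (intro mult_mono clip_powr_lipschitz[OF q M]) auto
    also have "\<dots> \<le> L * (exp (\<Lambda> * s) * d)" using mult_left_mono[OF d[OF s] L]
      by (simp add: L_def mult.assoc)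
    finally have II: "\<kappa> * \<bar>clip M (w s) powr q - clip M (v s) powr q\<bar> \<le> L * (exp (\<Lambda> * s) * d)" .
    have III: "\<bar>\<kappa> - \<kappa>'\<bar> * clip M (v s) powr q \<le> \<bar>\<kappa> - \<kappa>'\<bar> * M powr q"
      using M q by (intro mult_left_mono clip_powr_le) auto
    have "source \<alpha> q M \<kappa> w s - source \<alpha> q M \<kappa>' v s =
        - (\<alpha> * (integral {0..s} w - integral {0..s} v)) + \<kappa> * (clip M (w s) powr q - clip M (v s) powr q)
        + (\<kappa> - \<kappa>') * clip M (v s) powr q"
      by (simp add: source_def algebra_simps)
    also have "\<bar>\<dots>\<bar> \<le> \<alpha> * \<bar>integral {0..s} w - integral {0..s} v\<bar> + \<kappa> * \<bar>clip M (w s) powr q - clip M (v s) powr q\<bar>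
        + \<bar>\<kappa> - \<kappa>'\<bar> * clip M (v s) powr q"
      using \<alpha> \<kappa> by (intro order.trans[OF abs_triangle_ineq] add_mono) (auto simp: abs_mult)
    also have "\<dots> \<le> \<alpha> * (exp (\<Lambda> * s) * d) + L * (exp (\<Lambda> * s) * d) + \<bar>\<kappa> - \<kappa>'\<bar> * M powr q"
      using \<alpha> by (intro add_mono mult_left_mono[OF I] II III) auto
    also have "\<dots> = h s" by (simp add: h_def algebra_simps)
    finally show "\<bar>source \<alpha> q M \<kappa> w s - source \<alpha> q M \<kappa>' v s\<bar> \<le> h s" .
  qed
  also have "integral {0..r} h = integral {0..r} (\<lambda>s. exp (\<Lambda> * s) * ((\<alpha> + L) * d)) + r * (M powr q * \<bar>\<kappa> - \<kappa>'\<bar>)"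
    unfolding h_def using r by (subst integral_add) (auto intro: ih)
  also have "\<dots> \<le> exp (\<Lambda> * r) * ((\<alpha> + L) * d) / \<Lambda> + exp (\<Lambda> * r) * (M powr q * \<bar>\<kappa> - \<kappa>'\<bar>)"
  proof (intro add_mono int_exp[OF r] mult_right_mono)
    have "r \<le> exp r" using exp_ge_add_one_self[of r] by linarith
    also have "\<dots> \<le> exp (\<Lambda> * r)" using \<Lambda>1 r by (simp add: mult_le_cancel_right1)
    finally show "r \<le> exp (\<Lambda> * r)" .
  qed (use \<alpha> L d0 in auto)
  \<comment> \<open>\<open>\<Lambda>\<close> is at least twice the Lipschitz constant
    \<open>\<alpha>\<close> + L, and integrating the exponential gains a factor 1 /
    \<open>\<Lambda>\<close>: this is the contraction factor 1 / 2. The change of the coupling is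
    kept as a separate term, from which the dependence on it will be read off.\<close>
  also have "exp (\<Lambda> * r) * ((\<alpha> + L) * d) / \<Lambda> \<le> exp (\<Lambda> * r) * (d / 2)"
  proof -
    have "(\<alpha> + L) * d \<le> d / 2 * \<Lambda>" using mult_right_mono[OF \<Lambda>2 d0] by (simp add: algebra_simps)
    then have "(\<alpha> + L) * d / \<Lambda> \<le> d / 2" using \<Lambda>1 by (simp add: divide_le_eq)
    then show ?thesis using mult_left_mono[of "(\<alpha> + L) * d / \<Lambda>" "d / 2" "exp (\<Lambda> * r)"] by simp
  qed
  finally show ?thesis unfolding volterra_minus[OF sw sv] by (simp add: algebra_simps)
qed


text \<open>Here \<open>W = - F'\<close>. Truncating \<open>W\<close> at \<open>M\<close> in the nonlinearity makes it globally Lipschitz; it is harmless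
  as long as \<open>F\<close> is positive, because then \<open>W \<le> M\<close> for the choice of \<open>M\<close> made below.\<close>

definition is_profile :: "nat \<Rightarrow> real \<Rightarrow> real \<Rightarrow> real \<Rightarrow> real \<Rightarrow> (real \<Rightarrow> real) \<Rightarrow> (real \<Rightarrow> real) \<Rightarrow> bool" where
  "is_profile n q \<alpha> M \<kappa> F W \<longleftrightarrow>
     continuous_on UNIV F \<and> continuous_on UNIV W \<and> F 0 = 1 \<and> W 0 = 0 \<and>
     (\<forall>r\<ge>0. (F has_real_derivative - W r) (at r within {0..})) \<and>
     (\<forall>r>0. (W has_real_derivative
        \<alpha> * F r + \<kappa> * clip M (W r) powr q - (real (n - 1) / r + r / 2) * W r) (at r)) \<and>
     ((\<lambda>r. W r / r) \<longlongrightarrow> \<alpha> / n) (at_right 0) \<and>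
     (\<forall>r. (\<forall>s. 0 \<le> s \<longrightarrow> s \<le> r \<longrightarrow> 0 \<le> F s) \<longrightarrow> 0 \<le> W r) \<and>
     (\<forall>r>0. (\<forall>s. 0 \<le> s \<longrightarrow> s < r \<longrightarrow> 0 < F s) \<longrightarrow> 0 < W r)"

text \<open>Banach's theorem for exp (- \<open>\<Lambda>\<close> r) W(r) among bounded continuous
  functions. The factor 1 / 2 serves all couplings up to \<open>\<kappa>1\<close>, so the distance d
  of two fixed points satisfies d \<le> d / 2 + M powr q |\<open>\<kappa>\<close> -
  \<open>\<kappa>'\<close>|, and the fixed point is Lipschitz in the coupling. The exponential
  weight is harmless, as the shooting argument looks at bounded r.\<close>

lemma profile_family:
  assumes n: "1 \<le> n" and q: "1 < q" and M: "0 < M" and \<alpha>: "0 < \<alpha>" and \<kappa>1: "0 \<le> \<kappa>1"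
  obtains F W :: "real \<Rightarrow> real \<Rightarrow> real" and C \<Lambda> where "0 < C"
    "\<And>\<kappa>. 0 \<le> \<kappa> \<Longrightarrow> \<kappa> \<le> \<kappa>1 \<Longrightarrow> is_profile n q \<alpha> M \<kappa> (F \<kappa>) (W \<kappa>)"
    "\<And>\<kappa> \<kappa>' r. 0 \<le> \<kappa> \<Longrightarrow> \<kappa> \<le> \<kappa>1 \<Longrightarrow> 0 \<le> \<kappa>' \<Longrightarrow> \<kappa>' \<le> \<kappa>1 \<Longrightarrow> 0 \<le> r \<Longrightarrow>
        \<bar>F \<kappa> r - F \<kappa>' r\<bar> \<le> C * exp (\<Lambda> * r) * \<bar>\<kappa> - \<kappa>'\<bar> \<and> \<bar>W \<kappa> r - W \<kappa>' r\<bar> \<le> C * exp (\<Lambda> * r) * \<bar>\<kappa> - \<kappa>'\<bar>"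
proof -
  define \<Lambda> where "\<Lambda> = 2 * (\<alpha> + \<kappa>1 * (q * M powr (q - 1))) + 1"
  have \<Lambda>1: "1 \<le> \<Lambda>" using \<alpha> \<kappa>1 q by (simp add: \<Lambda>_def)
  define wt where "wt b s = exp (\<Lambda> * s) * apply_bcontfun b s" for b :: "real \<Rightarrow>\<^sub>C real" and s
  define T where "T \<kappa> b r = exp (- \<Lambda> * r) * volterra n (source \<alpha> q M \<kappa> (wt b)) r" for \<kappa> b r
  have wtc: "continuous_on UNIV (wt b)" for b unfolding wt_def by (intro continuous_intros) auto
  note diff = volterra_difference[OF q M \<alpha> _ _ \<Lambda>_def wtc wtc]
  have srcc: "continuous_on UNIV (source \<alpha> q M \<kappa> (wt b))" for \<kappa> b
    using wtc q by (auto intro!: source_continuous)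
  have wd: "\<bar>wt b s - wt b' s\<bar> \<le> exp (\<Lambda> * s) * dist b b'" for b b' s
  proof -
    have "\<bar>wt b s - wt b' s\<bar> = exp (\<Lambda> * s) * dist (apply_bcontfun b s) (apply_bcontfun b' s)"
      unfolding wt_def dist_real_def right_diff_distrib[symmetric] abs_mult by simp
    then show ?thesis using dist_bounded[of b s b'] by simp
  qed
  have Td: "\<bar>T \<kappa> b r - T \<kappa>' b' r\<bar> \<le> dist b b' / 2 + M powr q * \<bar>\<kappa> - \<kappa>'\<bar>"
    if \<kappa>: "0 \<le> \<kappa>" "\<kappa> \<le> \<kappa>1" for \<kappa> \<kappa>' b b' r
  proof (cases "0 \<le> r")
    case True
    have "\<bar>T \<kappa> b r - T \<kappa>' b' r\<bar> = exp (- \<Lambda> * r) * \<bar>volterra n (source \<alpha> q M \<kappa> (wt b)) r - volterra n (source \<alpha> q M \<kappa>' (wt b')) r\<bar>"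
      unfolding T_def right_diff_distrib[symmetric] abs_mult by simp
    also have "\<dots> \<le> exp (- \<Lambda> * r) * (exp (\<Lambda> * r) * (dist b b' / 2 + M powr q * \<bar>\<kappa> - \<kappa>'\<bar>))"
      by (intro mult_left_mono diff[OF \<kappa> _ _ True] wd) auto
    also have "\<dots> = dist b b' / 2 + M powr q * \<bar>\<kappa> - \<kappa>'\<bar>"
      by (simp add: mult.assoc[symmetric] exp_add[symmetric])
    finally show ?thesis .
  next
    case False
    then show ?thesis by (simp add: T_def volterra_def)
  qed
  have T0: "\<bar>T \<kappa> 0 r\<bar> \<le> \<alpha> + \<kappa> * M powr q" if \<kappa>: "0 \<le> \<kappa>" for \<kappa> r
  proof (cases "0 \<le> r")
    case True
    have "\<bar>volterra n (source \<alpha> q M \<kappa> (wt 0)) r\<bar> \<le> integral {0..r} (\<lambda>_. \<alpha> + \<kappa> * M powr q)"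
    proof (rule volterra_bound[OF srcc _ True])
      fix s
      have "wt 0 = (\<lambda>s. 0)" by (simp add: wt_def fun_eq_iff)
      then show "\<bar>source \<alpha> q M \<kappa> (wt 0) s\<bar> \<le> \<alpha> + \<kappa> * M powr q"
        using \<alpha> \<kappa> M by (simp add: source_def clip_def)
    qed auto
    also have "\<dots> = r * (\<alpha> + \<kappa> * M powr q)" using True by simp
    also have "\<dots> \<le> exp (\<Lambda> * r) * (\<alpha> + \<kappa> * M powr q)"
    proof (rule mult_right_mono)
      have "r \<le> exp r" using exp_ge_add_one_self[of r] by linarith
      also have "\<dots> \<le> exp (\<Lambda> * r)" using \<Lambda>1 True by (simp add: mult_le_cancel_right1)
      finally show "r \<le> exp (\<Lambda> * r)" .
    qed (use \<alpha> \<kappa> in auto)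
    finally have "exp (- \<Lambda> * r) * \<bar>volterra n (source \<alpha> q M \<kappa> (wt 0)) r\<bar> \<le> exp (- \<Lambda> * r) * (exp (\<Lambda> * r) * (\<alpha> + \<kappa> * M powr q))"
      by (intro mult_left_mono) auto
    also have "\<dots> = \<alpha> + \<kappa> * M powr q" by (simp add: mult.assoc[symmetric] exp_add[symmetric])
    finally show ?thesis by (simp add: T_def abs_mult)
  next
    case False
    then show ?thesis using \<alpha> \<kappa> by (simp add: T_def volterra_def)
  qed
  have Tb: "T \<kappa> b \<in> bcontfun" if \<kappa>: "0 \<le> \<kappa>" "\<kappa> \<le> \<kappa>1" for \<kappa> b
  proof (rule bcontfun_normI)
    show "continuous_on UNIV (T \<kappa> b)"
      unfolding T_def by (intro continuous_intros volterra_continuous srcc)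
    show "norm (T \<kappa> b r) \<le> dist b 0 / 2 + (\<alpha> + \<kappa> * M powr q)" for r
    proof -
      have "\<bar>T \<kappa> b r - T \<kappa> 0 r\<bar> \<le> dist b 0 / 2" using Td[OF \<kappa>, of b r \<kappa> 0] by simp
      then show ?thesis using T0[OF \<kappa>(1), of r] unfolding real_norm_def by linarith
    qed
  qed
  define TT where "TT \<kappa> b = Bcontfun (T \<kappa> b)" for \<kappa> b
  have TT: "apply_bcontfun (TT \<kappa> b) = T \<kappa> b" if "0 \<le> \<kappa>" "\<kappa> \<le> \<kappa>1" for \<kappa> b
    using Tb[OF that] by (simp add: TT_def Bcontfun_inverse)
  have TTd: "dist (TT \<kappa> b) (TT \<kappa>' b') \<le> dist b b' / 2 + M powr q * \<bar>\<kappa> - \<kappa>'\<bar>"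
    if "0 \<le> \<kappa>" "\<kappa> \<le> \<kappa>1" "0 \<le> \<kappa>'" "\<kappa>' \<le> \<kappa>1" for \<kappa> \<kappa>' b b'
    by (rule dist_bound) (use that Td in \<open>simp add: TT dist_real_def\<close>)
  have "\<exists>b. TT \<kappa> b = b" if "0 \<le> \<kappa>" "\<kappa> \<le> \<kappa>1" for \<kappa>
    using banach_fix_type[of "1 / 2" "TT \<kappa>"] TTd[OF that that] by auto
  then obtain B where B: "\<And>\<kappa>. 0 \<le> \<kappa> \<Longrightarrow> \<kappa> \<le> \<kappa>1 \<Longrightarrow> TT \<kappa> (B \<kappa>) = B \<kappa>" by metis
  define W where "W \<kappa> = wt (B \<kappa>)" for \<kappa>
  define F where "F \<kappa> r = 1 - integral {0..r} (W \<kappa>)" for \<kappa> r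
  have Wc: "continuous_on UNIV (W \<kappa>)" for \<kappa> by (simp add: W_def wtc)
  have src: "source \<alpha> q M \<kappa> (W \<kappa>) s = \<alpha> * F \<kappa> s + \<kappa> * clip M (W \<kappa> s) powr q" for \<kappa> s
    by (simp add: source_def F_def)
  have WJ: "W \<kappa> r = volterra n (source \<alpha> q M \<kappa> (W \<kappa>)) r" if \<kappa>: "0 \<le> \<kappa>" "\<kappa> \<le> \<kappa>1" for \<kappa> r
  proof -
    have "W \<kappa> r = exp (\<Lambda> * r) * apply_bcontfun (TT \<kappa> (B \<kappa>)) r"
      by (simp add: W_def wt_def B[OF \<kappa>])
    also have "\<dots> = (exp (\<Lambda> * r) * exp (- \<Lambda> * r)) * volterra n (source \<alpha> q M \<kappa> (W \<kappa>)) r"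
      by (simp only: TT[OF \<kappa>] T_def W_def mult.assoc)
    also have "exp (\<Lambda> * r) * exp (- \<Lambda> * r) = 1" by (simp add: exp_add[symmetric])
    finally show ?thesis by simp
  qed
  have sc: "continuous_on UNIV (source \<alpha> q M \<kappa> (W \<kappa>))" for \<kappa> by (simp add: W_def srcc)
  have dF: "(F \<kappa> has_real_derivative - W \<kappa> r) (at r within {0..})" if "0 \<le> r" for \<kappa> r
    unfolding F_def[abs_def]
    by (rule derivative_eq_intros indefinite_integral_derivative[OF Wc that] refl | simp)+
  have prof: "is_profile n q \<alpha> M \<kappa> (F \<kappa>) (W \<kappa>)" if \<kappa>: "0 \<le> \<kappa>" "\<kappa> \<le> \<kappa>1" for \<kappa>
  proof -
    have eq: "W \<kappa> = volterra n (source \<alpha> q M \<kappa> (W \<kappa>))" using WJ[OF \<kappa>] by (simp add: fun_eq_iff)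
    have W0: "W \<kappa> 0 = 0" by (subst WJ[OF \<kappa>]) (simp add: volterra_def)
    have F0: "F \<kappa> 0 = 1" by (simp add: F_def)
    have "(W \<kappa> has_real_derivative source \<alpha> q M \<kappa> (W \<kappa>) r - (real (n - 1) / r + r / 2) * W \<kappa> r) (at r)" if "0 < r" for r
      using volterra_derivative[OF sc that, where n = n, of \<kappa>] by (simp add: eq[symmetric])
    moreover have "((\<lambda>r. W \<kappa> r / r) \<longlongrightarrow> \<alpha> / n) (at_right 0)"
      using volterra_over_r[OF sc n, of \<kappa>] W0 q F0 M by (simp add: eq[symmetric] src clip_def)
    moreover have "0 \<le> W \<kappa> r" if "\<forall>s. 0 \<le> s \<longrightarrow> s \<le> r \<longrightarrow> 0 \<le> F \<kappa> s" for r
      by (subst WJ[OF \<kappa>], rule volterra_nonneg[OF sc]) (use that \<alpha> \<kappa> in \<open>simp add: src\<close>)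
    moreover have "0 < W \<kappa> r" if "0 < r" "\<forall>s. 0 \<le> s \<longrightarrow> s < r \<longrightarrow> 0 < F \<kappa> s" for r
      by (subst WJ[OF \<kappa>], rule volterra_pos[OF sc that(1)]) (use that \<alpha> \<kappa> in \<open>simp add: src add_pos_nonneg\<close>)
    moreover have "continuous_on UNIV (F \<kappa>)" unfolding F_def[abs_def]
      by (intro continuous_intros indefinite_integral_continuous Wc)
    ultimately show ?thesis unfolding is_profile_def using W0 F0 Wc dF by (simp add: src)
  qed
  have Wd: "\<bar>W \<kappa> r - W \<kappa>' r\<bar> \<le> 2 * M powr q * exp (\<Lambda> * r) * \<bar>\<kappa> - \<kappa>'\<bar>"
    if \<kappa>: "0 \<le> \<kappa>" "\<kappa> \<le> \<kappa>1" "0 \<le> \<kappa>'" "\<kappa>' \<le> \<kappa>1" for \<kappa> \<kappa>' r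
  proof -
    have "dist (B \<kappa>) (B \<kappa>') \<le> dist (B \<kappa>) (B \<kappa>') / 2 + M powr q * \<bar>\<kappa> - \<kappa>'\<bar>"
      using TTd[OF \<kappa>, of "B \<kappa>" "B \<kappa>'"] by (simp add: B \<kappa>)
    then have "dist (B \<kappa>) (B \<kappa>') \<le> 2 * M powr q * \<bar>\<kappa> - \<kappa>'\<bar>" by simp
    then have "exp (\<Lambda> * r) * dist (B \<kappa>) (B \<kappa>') \<le> exp (\<Lambda> * r) * (2 * M powr q * \<bar>\<kappa> - \<kappa>'\<bar>)"
      by (intro mult_left_mono) auto
    from order.trans[OF wd this] show ?thesis by (simp add: W_def mult_ac)
  qed
  have Fd: "\<bar>F \<kappa> r - F \<kappa>' r\<bar> \<le> 2 * M powr q * exp ((\<Lambda> + 1) * r) * \<bar>\<kappa> - \<kappa>'\<bar>"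
    if \<kappa>: "0 \<le> \<kappa>" "\<kappa> \<le> \<kappa>1" "0 \<le> \<kappa>'" "\<kappa>' \<le> \<kappa>1" and r: "0 \<le> r" for \<kappa> \<kappa>' r
  proof -
    have i: "W \<kappa> integrable_on {0..r}" for \<kappa>
      by (auto intro!: integrable_continuous_real continuous_on_subset[OF Wc])
    have "norm (integral {0..r} (\<lambda>s. W \<kappa>' s - W \<kappa> s)) \<le> integral {0..r} (\<lambda>s. 2 * M powr q * exp (\<Lambda> * r) * \<bar>\<kappa> - \<kappa>'\<bar>)"
    proof (rule integral_norm_bound_integral)
      fix s assume s: "s \<in> {0..r}"
      have "\<bar>W \<kappa>' s - W \<kappa> s\<bar> \<le> 2 * M powr q * exp (\<Lambda> * s) * \<bar>\<kappa>' - \<kappa>\<bar>" by (rule Wd) (use \<kappa> in auto)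
      also have "\<dots> \<le> 2 * M powr q * exp (\<Lambda> * r) * \<bar>\<kappa>' - \<kappa>\<bar>"
        using s \<Lambda>1 by (intro mult_right_mono mult_left_mono) auto
      finally show "norm (W \<kappa>' s - W \<kappa> s) \<le> 2 * M powr q * exp (\<Lambda> * r) * \<bar>\<kappa> - \<kappa>'\<bar>" by (simp add: abs_minus_commute)
    qed (auto intro: integrable_diff i)
    also have "integral {0..r} (\<lambda>s. W \<kappa>' s - W \<kappa> s) = F \<kappa> r - F \<kappa>' r"
      using integral_diff[OF i[of \<kappa>'] i[of \<kappa>]] by (simp add: F_def)
    also have "integral {0..r} (\<lambda>s. 2 * M powr q * exp (\<Lambda> * r) * \<bar>\<kappa> - \<kappa>'\<bar>) = r * (2 * M powr q * exp (\<Lambda> * r) * \<bar>\<kappa> - \<kappa>'\<bar>)"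
      using r by simp
    \<comment> \<open>Integrating W to obtain F costs a factor r, absorbed by exp r; hence the rate
      \<open>\<Lambda>\<close> + 1 in the result.\<close>
    also have "\<dots> \<le> exp r * (2 * M powr q * exp (\<Lambda> * r) * \<bar>\<kappa> - \<kappa>'\<bar>)"
    proof (rule mult_right_mono)
      show "r \<le> exp r" using exp_ge_add_one_self[of r] by linarith
    qed auto
    also have "\<dots> = 2 * M powr q * exp ((\<Lambda> + 1) * r) * \<bar>\<kappa> - \<kappa>'\<bar>"
      by (simp add: exp_add ring_distribs)
    finally show ?thesis by simp
  qed
  have "\<bar>F \<kappa> r - F \<kappa>' r\<bar> \<le> (2 * M powr q) * exp ((\<Lambda> + 1) * r) * \<bar>\<kappa> - \<kappa>'\<bar> \<and> \<bar>W \<kappa> r - W \<kappa>' r\<bar> \<le> (2 * M powr q) * exp ((\<Lambda> + 1) * r) * \<bar>\<kappa> - \<kappa>'\<bar>"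
    if \<kappa>: "0 \<le> \<kappa>" "\<kappa> \<le> \<kappa>1" "0 \<le> \<kappa>'" "\<kappa>' \<le> \<kappa>1" and r: "0 \<le> r" for \<kappa> \<kappa>' r
  proof
    show "\<bar>F \<kappa> r - F \<kappa>' r\<bar> \<le> (2 * M powr q) * exp ((\<Lambda> + 1) * r) * \<bar>\<kappa> - \<kappa>'\<bar>" by (rule Fd[OF that])
    have "2 * M powr q * exp (\<Lambda> * r) * \<bar>\<kappa> - \<kappa>'\<bar> \<le> 2 * M powr q * exp ((\<Lambda> + 1) * r) * \<bar>\<kappa> - \<kappa>'\<bar>"
      using r by (intro mult_right_mono mult_left_mono) (auto simp: algebra_simps)
    with Wd[OF \<kappa>, of r] show "\<bar>W \<kappa> r - W \<kappa>' r\<bar> \<le> (2 * M powr q) * exp ((\<Lambda> + 1) * r) * \<bar>\<kappa> - \<kappa>'\<bar>" by linarith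
  qed
  then show ?thesis using that[of "2 * M powr q" F W "\<Lambda> + 1"] prof M by simp
qed

section \<open>Shooting\<close>

text \<open>At its first zero D arrives from above and cannot have a positive derivative.
  \<open>cross\<close> may assume positivity at all earlier points; in this way a barrier for W and
  the positivity of F on which it relies are established together.\<close>

lemma stays_positive_on:
  fixes D :: "real \<Rightarrow> real"
  assumes cont: "continuous_on {a..b} D" and a: "0 < D a"
    and cross: "\<And>r. a < r \<Longrightarrow> r \<le> b \<Longrightarrow> D r = 0 \<Longrightarrow> (\<And>s. a \<le> s \<Longrightarrow> s < r \<Longrightarrow> 0 < D s) \<Longrightarrow>
      \<exists>d>0. (D has_real_derivative d) (at r)"
    and r: "a \<le> r" "r \<le> b"
  shows "0 < D r"
proof (rule ccontr)
  assume neg: "\<not> 0 < D r"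
  define S where "S = {s \<in> {a..r}. D s \<le> 0}"
  have "closed ({a..r} \<inter> D -` {..0})"
    by (rule continuous_closed_preimage[OF continuous_on_subset[OF cont]]) (use r in auto)
  moreover have "{a..r} \<inter> D -` {..0} = S" by (auto simp: S_def)
  ultimately have "closed S" by simp
  moreover have "bounded S" by (rule bounded_subset[of "{a..r}"]) (auto simp: S_def)
  ultimately have "compact S" by (simp add: compact_eq_bounded_closed)
  moreover have "S \<noteq> {}" using neg r by (auto simp: S_def)
  ultimately obtain z where z: "z \<in> S" "\<And>s. s \<in> S \<Longrightarrow> z \<le> s"
    using continuous_attains_inf[of S "\<lambda>x. x"] by auto
  have az: "a < z" "z \<le> r" "D z \<le> 0" using z(1) a by (auto simp: S_def less_le)
  have pos: "0 < D s" if "a \<le> s" "s < z" for s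
    using z(2)[of s] that az by (force simp: S_def)
  have "D z = 0"
  proof (rule ccontr)
    assume "D z \<noteq> 0"
    then have "D z < 0" using az by simp
    moreover have "continuous_on {a..z} D" by (rule continuous_on_subset[OF cont]) (use az r in auto)
    ultimately obtain y where y: "a \<le> y" "y \<le> z" "D y = 0"
      using IVT2'[of D z 0 a] a az by auto
    with \<open>D z < 0\<close> have "y < z" by (cases "y = z") auto
    then show False using pos[OF y(1)] y by simp
  qed
  moreover have "z \<le> b" using az r by simp
  ultimately obtain d where d: "d > 0" "(D has_real_derivative d) (at z)" using cross[OF az(1)] pos by blast
  obtain e where e: "e > 0" "\<And>h. h > 0 \<Longrightarrow> h < e \<Longrightarrow> D (z - h) < D z"
    using DERIV_pos_inc_left[OF d(2,1)] by blast
  define h where "h = min e (z - a) / 2"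
  have "h > 0" "h < e" "h < z - a" using e az by (auto simp: h_def min_def)
  then show False using e(2)[of h] pos[of "z - h"] \<open>D z = 0\<close> by auto
qed

lemma stays_positive:
  fixes D :: "real \<Rightarrow> real"
  assumes "continuous_on {a..} D" "0 < D a"
    and "\<And>r. a < r \<Longrightarrow> D r = 0 \<Longrightarrow> (\<And>s. a \<le> s \<Longrightarrow> s < r \<Longrightarrow> 0 < D s) \<Longrightarrow>
      \<exists>d>0. (D has_real_derivative d) (at r)"
    and "a \<le> r"
  shows "0 < D r"
  by (rule stays_positive_on[of a r D r]) (use assms in \<open>auto intro: continuous_on_subset\<close>)

text \<open>Integrating factor: the derivative of F exp \<open>\<mu>\<close> is exp
  \<open>\<mu>\<close> (m F - W). A bound on W / F thus keeps F positive, with a Gaussian lower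
  bound for quadratic \<open>\<mu>\<close> and a power for logarithmic \<open>\<mu>\<close>.\<close>

lemma exp_weight_mono:
  fixes F :: "real \<Rightarrow> real"
  assumes "a \<le> r"
    and F: "\<And>s. a \<le> s \<Longrightarrow> s \<le> r \<Longrightarrow> (F has_real_derivative - W s) (at s)"
    and \<mu>: "\<And>s. a \<le> s \<Longrightarrow> s \<le> r \<Longrightarrow> (\<mu> has_real_derivative m s) (at s)"
    and le: "\<And>s. a < s \<Longrightarrow> s < r \<Longrightarrow> W s \<le> m s * F s"
  shows "F a * exp (\<mu> a) \<le> F r * exp (\<mu> r)"
proof (cases "a = r")
  case False
  have d: "((\<lambda>s. F s * exp (\<mu> s)) has_real_derivative exp (\<mu> s) * (m s * F s - W s)) (at s)" if "a \<le> s" "s \<le> r" for s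
    using F[OF that] \<mu>[OF that] by (auto intro!: derivative_eq_intros simp: algebra_simps)
  show ?thesis
  proof (rule DERIV_nonneg_imp_increasing_open[OF \<open>a \<le> r\<close>])
    show "\<exists>y. ((\<lambda>s. F s * exp (\<mu> s)) has_real_derivative y) (at s) \<and> 0 \<le> y" if "a < s" "s < r" for s
      using d[of s] that le[OF that] by (intro exI[of _ "exp (\<mu> s) * (m s * F s - W s)"]) auto
    show "continuous_on {a..r} (\<lambda>s. F s * exp (\<mu> s))"
      by (rule DERIV_atLeastAtMost_imp_continuous_on) (use d in blast)
  qed
qed simp

lemma is_profileD:
  assumes "is_profile n q \<alpha> M \<kappa> F W"
  shows "continuous_on UNIV F" "continuous_on UNIV W" "F 0 = 1" "W 0 = 0"
    "\<And>r. 0 < r \<Longrightarrow> (F has_real_derivative - W r) (at r)"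
    "\<And>r. 0 \<le> r \<Longrightarrow> (F has_real_derivative - W r) (at r within {0..})"
    "\<And>r. 0 < r \<Longrightarrow> (W has_real_derivative
        \<alpha> * F r + \<kappa> * clip M (W r) powr q - (real (n - 1) / r + r / 2) * W r) (at r)"
    "((\<lambda>r. W r / r) \<longlongrightarrow> \<alpha> / n) (at_right 0)"
    "\<And>r. (\<And>s. 0 \<le> s \<Longrightarrow> s \<le> r \<Longrightarrow> 0 \<le> F s) \<Longrightarrow> 0 \<le> W r"
    "\<And>r. 0 < r \<Longrightarrow> (\<And>s. 0 \<le> s \<Longrightarrow> s < r \<Longrightarrow> 0 < F s) \<Longrightarrow> 0 < W r"
proof -
  show "(F has_real_derivative - W r) (at r)" if "0 < r" for r
    using assms that at_within_Ici_pos[OF that] unfolding is_profile_def by (metis less_imp_le)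
qed (use assms in \<open>auto simp: is_profile_def\<close>)

lemma profile_decreasing:
  assumes p: "is_profile n q \<alpha> M \<kappa> F W" and pos: "\<And>s. 0 \<le> s \<Longrightarrow> s \<le> r \<Longrightarrow> 0 \<le> F s"
    and st: "0 \<le> s" "s \<le> t" "t \<le> r"
  shows "F t \<le> F s"
proof (cases "s = t")
  case False
  show ?thesis
  proof (rule DERIV_nonpos_imp_decreasing_open[OF st(2)])
    fix x assume x: "s < x" "x < t"
    have "0 \<le> W x" by (rule is_profileD(9)[OF p]) (use x st pos in auto)
    then show "\<exists>y. (F has_real_derivative y) (at x) \<and> y \<le> 0"
      using is_profileD(5)[OF p, of x] x st by (intro exI[of _ "- W x"]) auto
  next
    show "continuous_on {s..t} F" by (rule continuous_on_subset[OF is_profileD(1)[OF p]]) auto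
  qed
qed simp

text \<open>On the last interval where \<open>W \<ge> 1\<close>, whose length is at most \<open>F(0) = 1\<close>, one integrates
  \<open>(W powr (2 - q))' \<le> (2 - q) (\<alpha> + \<kappa> W)\<close>.\<close>

lemma profile_slope_bound:
  assumes p: "is_profile n q \<alpha> M \<kappa> F W" and q: "1 < q" "q < 2" and \<alpha>: "0 < \<alpha>" and \<kappa>: "0 \<le> \<kappa>" "\<kappa> \<le> \<kappa>1"
    and M: "M = (1 + (2 - q) * (\<alpha> + \<kappa>1)) powr (1 / (2 - q))"
    and r: "0 \<le> r" and pos: "\<And>s. 0 \<le> s \<Longrightarrow> s \<le> r \<Longrightarrow> 0 < F s"
  shows "0 \<le> W r" "W r \<le> M"
proof -
  note P = is_profileD[OF p]
  have pos': "\<And>s. 0 \<le> s \<Longrightarrow> s \<le> r \<Longrightarrow> 0 \<le> F s" using pos by (simp add: less_imp_le)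
  have W0: "0 \<le> W s" if "s \<le> r" for s by (rule P(9)) (use pos' that in auto)
  then show "0 \<le> W r" by simp
  have M1: "1 \<le> M" unfolding M using q \<alpha> \<kappa> by (intro ge_one_powr_ge_zero) auto
  show "W r \<le> M"
  proof (rule ccontr)
    assume "\<not> W r \<le> M"
    then have Wr: "1 < W r" "M < W r" using M1 by auto
    define S where "S = {s \<in> {0..r}. W s \<le> 1}"
    have "closed ({0..r} \<inter> W -` {..1})"
      by (rule continuous_closed_preimage) (auto intro: continuous_on_subset[OF P(2)])
    moreover have "{0..r} \<inter> W -` {..1} = S" by (auto simp: S_def)
    ultimately have "closed S" by simp
    moreover have "bounded S" by (rule bounded_subset[of "{0..r}"]) (auto simp: S_def)
    ultimately have "compact S" by (simp add: compact_eq_bounded_closed)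
    moreover have "0 \<in> S" using r P(4) by (auto simp: S_def)
    ultimately obtain z where z: "z \<in> S" "\<And>s. s \<in> S \<Longrightarrow> s \<le> z"
      using continuous_attains_sup[of S "\<lambda>x. x"] by auto
    have zr: "0 \<le> z" "z < r" "W z \<le> 1" using z(1) Wr by (auto simp: S_def less_le)
    have gt: "1 < W s" if "z < s" "s \<le> r" for s
      using z(2)[of s] that zr by (force simp: S_def)
    have "\<not> W z < 1"
    proof
      assume "W z < 1"
      moreover have "continuous_on {z..r} W" by (rule continuous_on_subset[OF P(2)]) auto
      ultimately obtain y where y: "z \<le> y" "y \<le> r" "W y = 1"
        using IVT'[of W z 1 r] Wr zr by auto
      with \<open>W z < 1\<close> have "z < y" by (cases "y = z") auto
      then show False using gt[of y] y by simp
    qed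
    then have Wz: "W z = 1" using zr by simp
    then have z0: "0 < z" using zr P(4) by (cases "z = 0") auto
    have ge: "1 \<le> W s" if "z \<le> s" "s \<le> r" for s
      using gt[of s] that Wz by (cases "s = z") auto
    have Fr: "F z \<le> 1" "0 < F r" "F r \<le> F z"
      using profile_decreasing[OF p pos', where s = 0 and t = z] P(3) zr pos r
        profile_decreasing[OF p pos', where s = z and t = r] by auto
    have "F r + r \<le> F z + z"
    proof (rule DERIV_nonpos_imp_nonincreasing[of z r "\<lambda>s. F s + s"])
      show "\<exists>y. ((\<lambda>s. F s + s) has_real_derivative y) (at s) \<and> y \<le> 0" if "z \<le> s" "s \<le> r" for s
        using P(5)[of s] that z0 ge[of s]
        by (intro exI[of _ "- W s + 1"]) (auto intro!: derivative_eq_intros)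
    qed (use zr in auto)
    then have len: "r - z \<le> 1" using Fr by linarith
    \<comment> \<open>\<open>E\<close> does not increase: by F' = - W the contribution
      \<open>\<kappa>\<close> W of the nonlinearity integrates to \<open>\<kappa>\<close> times the
      fall of F, which is at most 1, and W powr (1 - q) is at most 1 where W is at least 1.\<close>
    define E where "E s = W s powr (2 - q) - (2 - q) * (\<alpha> * s - \<kappa> * F s)" for s
    have "E r \<le> E z"
    proof (rule DERIV_nonpos_imp_nonincreasing[of z r E])
      fix s assume s: "z \<le> s" "s \<le> r"
      have s0: "0 < s" and Ws: "1 \<le> W s" using s z0 ge by auto
      define g where "g = \<alpha> * F s + \<kappa> * clip M (W s) powr q - (real (n - 1) / s + s / 2) * W s"
      have "((\<lambda>s. W s powr (2 - q)) has_real_derivative (2 - q) * W s powr (1 - q) * g) (at s)"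
        using DERIV_fun_powr[OF P(7)[OF s0], of "2 - q"] Ws by (simp add: g_def)
      then have dE: "(E has_real_derivative (2 - q) * W s powr (1 - q) * g - (2 - q) * (\<alpha> * 1 - \<kappa> * (- W s))) (at s)"
        unfolding E_def by (intro DERIV_diff DERIV_cmult P(5)[OF s0] DERIV_ident)
      have "clip M (W s) powr q \<le> W s powr q" using Ws q M1 by (intro powr_mono2) (auto simp: clip_def)
      then have "\<kappa> * clip M (W s) powr q \<le> \<kappa> * W s powr q" using \<kappa> by (intro mult_left_mono) auto
      moreover have "F s \<le> 1" using profile_decreasing[OF p pos', where s = 0 and t = s] s s0 P(3) by auto
      then have "\<alpha> * F s \<le> \<alpha>" using \<alpha> by simp
      moreover have "0 \<le> (real (n - 1) / s + s / 2) * W s" using s0 Ws by simp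
      ultimately have "g \<le> \<alpha> + \<kappa> * W s powr q" unfolding g_def by linarith
      then have "W s powr (1 - q) * g \<le> W s powr (1 - q) * (\<alpha> + \<kappa> * W s powr q)" by (intro mult_left_mono) auto
      also have "\<dots> = W s powr (1 - q) * \<alpha> + \<kappa> * (W s powr (1 - q) * W s powr q)" by (simp add: algebra_simps)
      also have "W s powr (1 - q) * W s powr q = W s" using Ws by (simp add: powr_add[symmetric])
      also have "W s powr (1 - q) * \<alpha> \<le> 1 * \<alpha>"
        using Ws q \<alpha> powr_mono[of "1 - q" 0 "W s"] by (intro mult_right_mono) auto
      finally have "W s powr (1 - q) * g \<le> \<alpha> + \<kappa> * W s" by simp
      then have "(2 - q) * (W s powr (1 - q) * g) \<le> (2 - q) * (\<alpha> + \<kappa> * W s)" using q by (intro mult_left_mono) auto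
      then have "(2 - q) * W s powr (1 - q) * g - (2 - q) * (\<alpha> * 1 - \<kappa> * (- W s)) \<le> 0" by (simp add: algebra_simps)
      with dE show "\<exists>y. (E has_real_derivative y) (at s) \<and> y \<le> 0" by blast
    qed (use zr in auto)
    then have "W r powr (2 - q) \<le> 1 + (2 - q) * (\<alpha> * (r - z) + \<kappa> * (F z - F r))"
      by (simp add: E_def Wz algebra_simps)
    also have "\<dots> \<le> 1 + (2 - q) * (\<alpha> * 1 + \<kappa>1 * 1)"
      using q \<alpha> \<kappa> len Fr by (intro add_left_mono mult_left_mono add_mono mult_mono) auto
    finally have "(W r powr (2 - q)) powr (1 / (2 - q)) \<le> M"
      unfolding M using q by (intro powr_mono2) auto
    then show False using Wr q by (simp add: powr_powr)
  qed
qed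

text \<open>The barrier is \<open>W < y r F\<close> with \<open>\<alpha> / n < y < 1 / 2\<close>: the lower limit is the initial slope, and a Gaussian
  corresponds to \<open>y = 1 / 2\<close>.\<close>

lemma small_coupling_positive:
  assumes n: "1 \<le> n" and q: "1 < q" "q < 2" and \<alpha>: "0 < \<alpha>" "\<alpha> < real n / 2"
  obtains \<kappa>0 where "0 < \<kappa>0"
    "\<And>M \<kappa> F W r. is_profile n q \<alpha> M \<kappa> F W \<Longrightarrow> 0 < M \<Longrightarrow> 0 \<le> \<kappa> \<Longrightarrow> \<kappa> \<le> \<kappa>0 \<Longrightarrow> 0 \<le> r \<Longrightarrow> 0 < F r"
proof -
  define y where "y = (\<alpha> / n + 1 / 2) / 2"
  have y: "\<alpha> / n < y" "y < 1 / 2" "0 < y" using n \<alpha> by (auto simp: y_def field_simps)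
  have ny: "0 < n * y - \<alpha>" using y n by (simp add: field_simps)
  \<comment> \<open>At a crossing the linear part of D' is F times (n y - \<open>\<alpha>\<close>) +
    y (1 / 2 - y) r^2, hence at least m (1 + r^2) F. The nonlinear part is at most
    \<open>\<kappa>0\<close> y powr q (1 + r^2) F, because F \<le> 1 and q < 2;
    \<open>\<kappa>0\<close> makes this half of the former.\<close>
  define m where "m = min (n * y - \<alpha>) (y * (1 / 2 - y))"
  have m: "0 < m" "m \<le> n * y - \<alpha>" "m \<le> y * (1 / 2 - y)" using y ny by (auto simp: m_def)
  define \<kappa>0 where "\<kappa>0 = m / (2 * y powr q)"
  show ?thesis
  proof (rule that)
    show "0 < \<kappa>0" using m y by (simp add: \<kappa>0_def)
    fix M \<kappa> :: real and F W :: "real \<Rightarrow> real" and r1 :: real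
    assume p: "is_profile n q \<alpha> M \<kappa> F W" and M: "0 < M" and \<kappa>: "0 \<le> \<kappa>" "\<kappa> \<le> \<kappa>0" and r1: "0 \<le> r1"
    note P = is_profileD[OF p]
    have "isCont F 0" using P(1) by (simp add: continuous_on_eq_continuous_at)
    then have F1: "(F \<longlongrightarrow> 1) (at_right 0)" using P(3) by (simp add: isCont_def filterlim_at_split)
    have "((\<lambda>r. y * F r - W r / r) \<longlongrightarrow> y * 1 - \<alpha> / n) (at_right 0)"
      by (intro tendsto_intros F1 P(8))
    then have "\<forall>\<^sub>F r in at_right 0. 0 < y * F r - W r / r"
      by (rule order_tendstoD) (use y in simp)
    moreover have "\<forall>\<^sub>F r in at_right 0. 0 < F r" using F1 by (rule order_tendstoD) simp
    ultimately have "\<forall>\<^sub>F r in at_right 0. 0 < y * F r - W r / r \<and> 0 < F r" by eventually_elim simp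
    then obtain b where b: "b > 0" "\<And>r. 0 < r \<Longrightarrow> r < b \<Longrightarrow> 0 < y * F r - W r / r \<and> 0 < F r"
      by (auto simp: eventually_at_right_field)
    define a where "a = b / 2"
    have a: "0 < a" "a < b" using b by (auto simp: a_def)
    have start: "0 < F r" if "0 \<le> r" "r \<le> a" for r
      using b(2)[of r] that a P(3) by (cases "r = 0") auto
    define D where "D r = y * r * F r - W r" for r
    have Fpos: "0 < F r" if "a \<le> r" "\<And>s. a \<le> s \<Longrightarrow> s < r \<Longrightarrow> 0 < D s" for r
    proof -
      have "F a * exp (y * a\<^sup>2 / 2) \<le> F r * exp (y * r\<^sup>2 / 2)"
      proof (rule exp_weight_mono[OF that(1), where W = W and m = "\<lambda>s. y * s"])
        show "(F has_real_derivative - W s) (at s)" if "a \<le> s" for s using P(5) that a by auto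
        show "((\<lambda>s. y * s\<^sup>2 / 2) has_real_derivative y * s) (at s)" for s
          by (auto intro!: derivative_eq_intros)
        show "W s \<le> y * s * F s" if "a < s" "s < r" for s
          using \<open>\<And>s. a \<le> s \<Longrightarrow> s < r \<Longrightarrow> 0 < D s\<close>[of s] that by (simp add: D_def)
      qed
      moreover have "0 < F a * exp (y * a\<^sup>2 / 2)" using start[of a] a by simp
      ultimately have "0 < F r * exp (y * r\<^sup>2 / 2)" by linarith
      then show ?thesis by (simp add: zero_less_mult_iff)
    qed
    have Dpos: "0 < D r" if "a \<le> r" for r
    proof (rule stays_positive[of a D r])
      show "continuous_on {a..} D" unfolding D_def
        by (intro continuous_intros continuous_on_subset[OF P(1)] continuous_on_subset[OF P(2)]) auto
      show "0 < D a" using b(2)[of a] a by (simp add: D_def field_simps)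
      fix r assume r: "a < r" "D r = 0" and Ds: "\<And>s. a \<le> s \<Longrightarrow> s < r \<Longrightarrow> 0 < D s"
      have r0: "0 < r" using r a by simp
      have pos: "0 < F s" if "0 \<le> s" "s \<le> r" for s
        using start[of s] Fpos[of s] Ds that by (cases "s \<le> a") auto
      have Fr: "0 < F r" "F r \<le> 1"
        using pos[of r] profile_decreasing[OF p, of r 0 r] pos r0 P(3) by (auto simp: less_imp_le)
      have Wr: "W r = y * r * F r" using r by (simp add: D_def)
      have dD: "(D has_real_derivative y * F r + - W r * (y * r)
          - (\<alpha> * F r + \<kappa> * clip M (W r) powr q - (real (n - 1) / r + r / 2) * W r)) (at r)"
        unfolding D_def
        by (rule derivative_eq_intros P(5)[OF r0] P(7)[OF r0] refl | simp)+
      have "clip M (W r) powr q \<le> W r powr q" using Wr r0 y Fr M q by (intro powr_mono2) (auto simp: clip_def)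
      also have "W r powr q = y powr q * (r powr q * F r powr q)"
        using Wr r0 y Fr by (simp add: powr_mult mult.assoc)
      also have "F r powr q \<le> F r" using powr_mono'[of 1 q "F r"] Fr q by simp
      also have "r powr q \<le> 1 + r\<^sup>2"
      proof (cases "r \<le> 1")
        case True
        then show ?thesis using powr_mono2[of q r 1] r0 q by (simp add: add_increasing2)
      next
        case False
        then show ?thesis using powr_mono[of q 2 r] q by (simp add: powr_numeral)
      qed
      finally have "clip M (W r) powr q \<le> y powr q * ((1 + r\<^sup>2) * F r)"
        using Fr by (simp add: mult_left_mono mult_right_mono)
      then have "\<kappa> * clip M (W r) powr q \<le> \<kappa>0 * (y powr q * ((1 + r\<^sup>2) * F r))"
        using \<kappa> by (intro mult_mono) auto
      also have "\<dots> = m / 2 * ((1 + r\<^sup>2) * F r)" using y by (simp add: \<kappa>0_def)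
      finally have k: "\<kappa> * clip M (W r) powr q \<le> m / 2 * ((1 + r\<^sup>2) * F r)" .
      have "(real (n - 1) / r + r / 2) * W r = (real n - 1) * y * F r + y * r\<^sup>2 / 2 * F r"
        using r0 n unfolding Wr by (simp add: field_simps power2_eq_square of_nat_diff)
      then have "y * F r + - W r * (y * r) - (\<alpha> * F r + \<kappa> * clip M (W r) powr q - (real (n - 1) / r + r / 2) * W r)
         = F r * ((n * y - \<alpha>) + y * (1 / 2 - y) * r\<^sup>2) - \<kappa> * clip M (W r) powr q"
        unfolding Wr by (simp add: algebra_simps power2_eq_square)
      moreover have "F r * (m + m * r\<^sup>2) \<le> F r * ((n * y - \<alpha>) + y * (1 / 2 - y) * r\<^sup>2)"
        using m Fr by (intro mult_left_mono add_mono mult_right_mono) auto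
      moreover have "0 < m / 2 * ((1 + r\<^sup>2) * F r)" using m Fr by (simp add: add_pos_nonneg)
      moreover have "F r * (m + m * r\<^sup>2) = m / 2 * ((1 + r\<^sup>2) * F r) + m / 2 * ((1 + r\<^sup>2) * F r)"
        by (simp add: field_simps)
      ultimately have "0 < y * F r + - W r * (y * r) - (\<alpha> * F r + \<kappa> * clip M (W r) powr q - (real (n - 1) / r + r / 2) * W r)"
        using k by linarith
      with dD show "\<exists>d>0. (D has_real_derivative d) (at r)" by blast
    qed (rule that)
    show "0 < F r1"
      using start[of r1] Fpos[of r1] Dpos r1 by (cases "r1 \<le> a") auto
  qed
qed


text \<open>Where r W = Z F, the derivative of Z F - r W is at least W times r^2 (1 / 2 -
  \<open>\<alpha>\<close> / Z) up to terms of order r. So Z > 2 \<open>\<alpha>\<close> makes slow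
  decay persist beyond some \<open>R\<close>, and meanwhile F r powr Z does not decrease.
  \<open>R\<close> is uniform in the profile, in \<open>M\<close> and in the coupling, as the
  passage to the infimum requires.\<close>

lemma slow_decay_trap:
  assumes n: "1 \<le> n" and q: "1 < q" and \<alpha>: "0 < \<alpha>" and Z: "2 * \<alpha> < Z" and \<kappa>1: "0 \<le> \<kappa>1"
  obtains R where "1 \<le> R"
    "\<And>M \<kappa> F W r s. is_profile n q \<alpha> M \<kappa> F W \<Longrightarrow> 0 < M \<Longrightarrow> 0 \<le> \<kappa> \<Longrightarrow> \<kappa> \<le> \<kappa>1 \<Longrightarrow> R \<le> r \<Longrightarrow>
      (\<And>s. 0 \<le> s \<Longrightarrow> s \<le> r \<Longrightarrow> 0 < F s) \<Longrightarrow> r * W r < Z * F r \<Longrightarrow> 0 \<le> s \<Longrightarrow> 0 < F s"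
proof -
  define \<eta> where "\<eta> = 1 / 2 - \<alpha> / Z"
  have Z0: "0 < Z" and \<eta>: "0 < \<eta>" using \<alpha> Z by (auto simp: \<eta>_def field_simps)
  \<comment> \<open>\<open>B\<close> collects the lower-order coefficients: Z + 2 of order 1 and the
    nonlinear one of order r. Beyond \<open>R\<close>, r \<open>\<eta>\<close> exceeds
    \<open>B\<close>.\<close>
  define B where "B = Z + 2 + \<kappa>1 * Z powr (q - 1)"
  have B: "0 < B" using Z0 \<kappa>1 by (simp add: B_def add_pos_nonneg)
  define R where "R = B / \<eta> + 1"
  have R: "1 \<le> R" using B \<eta> by (simp add: R_def)
  have big: "Z + 2 + r * (\<kappa>1 * Z powr (q - 1)) < r\<^sup>2 * \<eta>" if r: "R \<le> r" for r
  proof -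
    have r1: "1 \<le> r" using r R by simp
    have "B / \<eta> < r" using r by (simp add: R_def)
    then have "B < r * \<eta>" using \<eta> by (simp add: divide_less_eq)
    then have "r * B < r * (r * \<eta>)" using r1 by (intro mult_strict_left_mono) auto
    moreover have "Z + 2 \<le> r * (Z + 2)" using r1 Z0 by (simp add: mult_le_cancel_right1)
    ultimately show ?thesis by (simp add: B_def algebra_simps power2_eq_square)
  qed
  show ?thesis
  proof (rule that[OF R])
    fix M \<kappa> :: real and F W :: "real \<Rightarrow> real" and a s1 :: real
    assume p: "is_profile n q \<alpha> M \<kappa> F W" and M: "0 < M" and \<kappa>: "0 \<le> \<kappa>" "\<kappa> \<le> \<kappa>1" and s1: "0 \<le> s1" and Ra: "R \<le> a"
      and start: "\<And>s. 0 \<le> s \<Longrightarrow> s \<le> a \<Longrightarrow> 0 < F s" and Ta: "a * W a < Z * F a"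
    note P = is_profileD[OF p]
    have a: "1 \<le> a" using Ra R by simp
    define D where "D r = Z * F r - r * W r" for r
    have Fpos: "0 < F r" if "a \<le> r" "\<And>s. a \<le> s \<Longrightarrow> s < r \<Longrightarrow> 0 < D s" for r
    proof -
      have "F a * exp (Z * ln a) \<le> F r * exp (Z * ln r)"
      proof (rule exp_weight_mono[OF that(1), where W = W and m = "\<lambda>s. Z / s"])
        show "(F has_real_derivative - W s) (at s)" if "a \<le> s" for s using P(5) that a by auto
        show "((\<lambda>s. Z * ln s) has_real_derivative Z / s) (at s)" if "a \<le> s" for s
          using that a by (auto intro!: derivative_eq_intros)
        show "W s \<le> Z / s * F s" if "a < s" "s < r" for s
          using \<open>\<And>s. a \<le> s \<Longrightarrow> s < r \<Longrightarrow> 0 < D s\<close>[of s] that a by (simp add: D_def field_simps)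
      qed
      moreover have "0 < F a * exp (Z * ln a)" using start[of a] a by simp
      ultimately have "0 < F r * exp (Z * ln r)" by linarith
      then show ?thesis by (simp add: zero_less_mult_iff)
    qed
    have Dpos: "0 < D r" if "a \<le> r" for r
    proof (rule stays_positive[of a D r])
      show "continuous_on {a..} D" unfolding D_def
        by (intro continuous_intros continuous_on_subset[OF P(1)] continuous_on_subset[OF P(2)]) auto
      show "0 < D a" using Ta by (simp add: D_def)
      fix r assume r: "a < r" "D r = 0" and Ds: "\<And>s. a \<le> s \<Longrightarrow> s < r \<Longrightarrow> 0 < D s"
      have r0: "0 < r" "1 \<le> r" using r a by auto
      have pos: "0 < F s" if "0 \<le> s" "s \<le> r" for s
        using start[of s] Fpos[of s] Ds that by (cases "s \<le> a") auto
      have Fr: "0 < F r" "F r \<le> 1"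
        using pos[of r] profile_decreasing[OF p, of r 0 r] pos r0 P(3) by (auto simp: less_imp_le)
      have Wr: "F r = r * W r / Z" using r Z0 by (simp add: D_def field_simps)
      then have W0: "0 < W r" using Fr r0 Z0 by (simp add: zero_less_mult_iff zero_less_divide_iff)
      \<comment> \<open>The bound W \<le> Z turns W powr q into at most Z powr (q - 1) W, so that
        the nonlinear term is only of order r W.\<close>
      have "W r \<le> r * W r" using r0 W0 by (simp add: mult_le_cancel_right1)
      also have "\<dots> = Z * F r" using Wr Z0 by simp
      also have "\<dots> \<le> Z" using Fr Z0 by simp
      finally have WZ: "W r \<le> Z" .
      have dD: "(D has_real_derivative Z * (- W r) - (1 * W r +
          (\<alpha> * F r + \<kappa> * clip M (W r) powr q - (real (n - 1) / r + r / 2) * W r) * r)) (at r)"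
        unfolding D_def by (intro DERIV_diff DERIV_cmult P(5)[OF r0(1)] DERIV_mult DERIV_ident P(7)[OF r0(1)])
      have "clip M (W r) powr q \<le> W r powr q" using W0 M q by (intro powr_mono2) (auto simp: clip_def)
      also have "W r powr q = W r powr (q - 1) * W r" using W0 powr_add[of "W r" "q - 1" 1] by simp
      also have "\<dots> \<le> Z powr (q - 1) * W r" using W0 WZ q by (intro mult_right_mono powr_mono2) auto
      finally have "\<kappa> * clip M (W r) powr q \<le> \<kappa>1 * (Z powr (q - 1) * W r)" using \<kappa> by (intro mult_mono) auto
      then have k: "\<kappa> * clip M (W r) powr q * r \<le> \<kappa>1 * (Z powr (q - 1) * W r) * r" using r0 by (intro mult_right_mono) auto
      have b: "0 < W r * (r\<^sup>2 * \<eta> - (Z + 2 + r * (\<kappa>1 * Z powr (q - 1))))"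
        using W0 big[of r] Ra r by simp
      have "(real (n - 1) / r + r / 2) * W r * r = (real n - 1) * W r + r\<^sup>2 / 2 * W r"
        using r0 n by (simp add: field_simps power2_eq_square of_nat_diff)
      then have e: "Z * (- W r) - (1 * W r + (\<alpha> * F r + \<kappa> * clip M (W r) powr q - (real (n - 1) / r + r / 2) * W r) * r)
         = W r * (r\<^sup>2 * \<eta> + (real n - 2) - Z) - \<kappa> * clip M (W r) powr q * r"
        unfolding Wr \<eta>_def by (simp add: algebra_simps power2_eq_square)
      have "W r * 0 \<le> W r * real n" using W0 by (intro mult_left_mono) auto
      then have "0 < W r * (r\<^sup>2 * \<eta> + (real n - 2) - Z) - \<kappa> * clip M (W r) powr q * r"
        using b k by (simp add: algebra_simps)
      with dD e show "\<exists>d>0. (D has_real_derivative d) (at r)" by metis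
    qed (rule that)
    show "0 < F s1"
      using start[of s1] Fpos[of s1] Dpos s1 by (cases "s1 \<le> a") auto
  qed
qed

text \<open>At the first zero of F the function W, generated by a source that was positive before,
  is strictly positive, so the zero is transversal. This makes crossing an open condition on the
  coupling.\<close>

lemma profile_crosses_strictly:
  assumes p: "is_profile n q \<alpha> M \<kappa> F W" and r: "0 \<le> r" "F r \<le> 0"
  obtains s where "0 \<le> s" "F s < 0"
proof -
  note P = is_profileD[OF p]
  have "\<exists>z. 0 < z \<and> F z = 0 \<and> (\<forall>s. 0 \<le> s \<longrightarrow> s < z \<longrightarrow> 0 < F s)"
  proof (rule ccontr)
    assume *: "\<not> ?thesis"
    have "0 < F r"
      by (rule stays_positive[of 0 F r]) (use * r P(3) in \<open>auto intro: continuous_on_subset[OF P(1)]\<close>)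
    then show False using r by simp
  qed
  then obtain z where z: "0 < z" "F z = 0" "\<And>s. 0 \<le> s \<Longrightarrow> s < z \<Longrightarrow> 0 < F s" by blast
  have "- W z < 0" using P(10)[of z] z by simp
  from DERIV_neg_dec_right[OF P(5)[OF z(1)] this] obtain d
    where d: "d > 0" "\<And>h. h > 0 \<Longrightarrow> h < d \<Longrightarrow> F (z + h) < F z" by blast
  then have "F (z + d / 2) < 0" using z(2) by fastforce
  then show ?thesis using that[of "z + d / 2"] z(1) d(1) by simp
qed

text \<open>Continuity in the coupling is used in both directions at the infimum \<open>k\<close>.
  If the profile at \<open>k\<close> crossed zero, so would one with a slightly smaller coupling. If
  it decayed slowly at some r, crossing profiles with couplings just above \<open>k\<close> would
  enter the trap as well, and then could not cross.\<close>

lemma fast_profile_exists: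
  assumes n: "1 \<le> n" and q: "1 < q" "q < 2" and \<alpha>: "0 < \<alpha>" "\<alpha> < real n / 2" and Z: "2 * \<alpha> < Z"
    and \<kappa>1: "0 \<le> \<kappa>1" and M: "0 < M"
    and crossing: "\<And>F W. is_profile n q \<alpha> M \<kappa>1 F W \<Longrightarrow> \<exists>r\<ge>0. F r \<le> 0"
  obtains \<kappa> F W R where "0 < \<kappa>" "\<kappa> \<le> \<kappa>1" "is_profile n q \<alpha> M \<kappa> F W" "\<And>r. 0 \<le> r \<Longrightarrow> 0 < F r"
    "1 \<le> R" "\<And>r. R \<le> r \<Longrightarrow> Z * F r \<le> r * W r"
proof -
  obtain F W C \<Lambda> where C: "0 < C"
    and prof: "\<And>\<kappa>. 0 \<le> \<kappa> \<Longrightarrow> \<kappa> \<le> \<kappa>1 \<Longrightarrow> is_profile n q \<alpha> M \<kappa> (F \<kappa>) (W \<kappa>)"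
    and lip: "\<And>\<kappa> \<kappa>' r. 0 \<le> \<kappa> \<Longrightarrow> \<kappa> \<le> \<kappa>1 \<Longrightarrow> 0 \<le> \<kappa>' \<Longrightarrow> \<kappa>' \<le> \<kappa>1 \<Longrightarrow> 0 \<le> r \<Longrightarrow>
        \<bar>F \<kappa> r - F \<kappa>' r\<bar> \<le> C * exp (\<Lambda> * r) * \<bar>\<kappa> - \<kappa>'\<bar> \<and> \<bar>W \<kappa> r - W \<kappa>' r\<bar> \<le> C * exp (\<Lambda> * r) * \<bar>\<kappa> - \<kappa>'\<bar>"
    by (rule profile_family[OF n q(1) M \<alpha>(1) \<kappa>1]) blast
  obtain \<kappa>0 where \<kappa>0: "0 < \<kappa>0"
    "\<And>M \<kappa> F W r. is_profile n q \<alpha> M \<kappa> F W \<Longrightarrow> 0 < M \<Longrightarrow> 0 \<le> \<kappa> \<Longrightarrow> \<kappa> \<le> \<kappa>0 \<Longrightarrow> 0 \<le> r \<Longrightarrow> 0 < F r"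
    by (rule small_coupling_positive[OF n q \<alpha>]) blast
  obtain R where R: "1 \<le> R" and trap: "\<And>M \<kappa> F W r s. is_profile n q \<alpha> M \<kappa> F W \<Longrightarrow> 0 < M \<Longrightarrow> 0 \<le> \<kappa> \<Longrightarrow> \<kappa> \<le> \<kappa>1 \<Longrightarrow> R \<le> r \<Longrightarrow>
      (\<And>s. 0 \<le> s \<Longrightarrow> s \<le> r \<Longrightarrow> 0 < F s) \<Longrightarrow> r * W r < Z * F r \<Longrightarrow> 0 \<le> s \<Longrightarrow> 0 < F s"
    by (rule slow_decay_trap[OF n q(1) \<alpha>(1) Z \<kappa>1]) blast
  define S where "S = {\<kappa> \<in> {0..\<kappa>1}. \<exists>r\<ge>0. F \<kappa> r \<le> 0}"
  define k where "k = Inf S"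
  have S1: "\<kappa>1 \<in> S" using crossing[OF prof[of \<kappa>1]] \<kappa>1 by (simp add: S_def)
  have bdd: "bdd_below S" by (rule bdd_belowI[of _ 0]) (simp add: S_def)
  \<comment> \<open>Weak coupling never crosses, so the infimum is positive and will correspond to a
    positive amplitude.\<close>
  have S0: "\<kappa>0 \<le> \<kappa>" if \<kappa>: "\<kappa> \<in> S" for \<kappa>
  proof (rule ccontr)
    assume "\<not> \<kappa>0 \<le> \<kappa>"
    moreover obtain r where "0 \<le> r" "F \<kappa> r \<le> 0" "0 \<le> \<kappa>" "\<kappa> \<le> \<kappa>1" using \<kappa> by (auto simp: S_def)
    ultimately show False using \<kappa>0(2)[OF prof[of \<kappa>] M, of r] by simp
  qed
  have k: "\<kappa>0 \<le> k" "k \<le> \<kappa>1"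
    unfolding k_def using S0 S1 bdd by (auto intro: cInf_greatest cInf_lower)
  have kpos: "0 < F k r" if r: "0 \<le> r" for r
  proof (rule ccontr)
    assume "\<not> 0 < F k r"
    then obtain s where s: "0 \<le> s" "F k s < 0"
      using profile_crosses_strictly[OF prof[of k], of r] r k \<kappa>0 by auto
    \<comment> \<open>The Lipschitz bound moves the value at \<open>s\<close> by at most - F k s;
      the minimum with \<open>k\<close> keeps the coupling non-negative.\<close>
    define \<delta> where "\<delta> = min k (- F k s / (C * exp (\<Lambda> * s)))"
    have \<delta>: "0 < \<delta>" "\<delta> \<le> k" "\<delta> \<le> - F k s / (C * exp (\<Lambda> * s))" using k \<kappa>0(1) s C by (auto simp: \<delta>_def divide_neg_pos)
    have "\<delta> * (C * exp (\<Lambda> * s)) \<le> - F k s" using \<delta>(3) C by (subst (asm) pos_le_divide_eq) auto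
    then have "C * exp (\<Lambda> * s) * \<delta> \<le> - F k s" by (simp add: mult.commute)
    moreover have "\<bar>F (k - \<delta>) s - F k s\<bar> \<le> C * exp (\<Lambda> * s) * \<bar>k - \<delta> - k\<bar>"
      using lip[of "k - \<delta>" k s] s \<delta> k by auto
    ultimately have "F (k - \<delta>) s \<le> 0" using \<delta>(1) by (auto simp: abs_le_iff)
    then have "k - \<delta> \<in> S" using \<delta> k s by (auto simp: S_def)
    then have "Inf S \<le> k - \<delta>" by (rule cInf_lower[OF _ bdd])
    then show False using \<delta>(1) k_def by linarith
  qed
  have "Z * F k r \<le> r * W k r" if r: "R \<le> r" for r
  proof (rule ccontr)
    assume "\<not> Z * F k r \<le> r * W k r"
    then have T: "0 < Z * F k r - r * W k r" by simp
    have r0: "0 \<le> r" using r R by simp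
    have "compact {0..r}" "{0..r} \<noteq> {}" "continuous_on {0..r} (F k)"
      using r0 by (auto intro: continuous_on_subset[OF is_profileD(1)[OF prof[of k]]] simp: k less_imp_le[OF less_le_trans[OF \<kappa>0(1) k(1)]])
    from continuous_attains_inf[OF this] obtain x where x: "0 \<le> x" "\<And>y. 0 \<le> y \<Longrightarrow> y \<le> r \<Longrightarrow> F k x \<le> F k y" by auto
    define E where "E = C * exp (\<bar>\<Lambda>\<bar> * r)"
    have E: "0 < E" using C by (simp add: E_def)
    have Es: "C * exp (\<Lambda> * s) \<le> E" if "0 \<le> s" "s \<le> r" for s
    proof -
      have "\<Lambda> * s \<le> \<bar>\<Lambda>\<bar> * r" using that by (intro mult_mono) auto
      then show ?thesis using C by (simp add: E_def)
    qed
    \<comment> \<open>The first quotient keeps F positive on all of [0, r], since F k x is the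
      minimum there; the second preserves r W < Z F at r. Halving makes both bounds strict.\<close>
    define \<delta> where "\<delta> = min (F k x / E) ((Z * F k r - r * W k r) / ((\<bar>Z\<bar> + r) * E)) / 2"
    have Zr: "0 < (\<bar>Z\<bar> + r) * E" using r R E by (intro mult_pos_pos) auto
    have \<delta>: "0 < \<delta>" "\<delta> < F k x / E" "\<delta> < (Z * F k r - r * W k r) / ((\<bar>Z\<bar> + r) * E)"
    proof -
      have half: "0 < min X Y / 2 \<and> min X Y / 2 < X \<and> min X Y / 2 < Y" if "0 < X" "0 < Y" for X Y :: real
        using that by (auto simp: min_def)
      have "0 < F k x / E" "0 < (Z * F k r - r * W k r) / ((\<bar>Z\<bar> + r) * E)"
        using kpos[OF x(1)] E T Zr by auto
      from half[OF this] show "0 < \<delta>" "\<delta> < F k x / E" "\<delta> < (Z * F k r - r * W k r) / ((\<bar>Z\<bar> + r) * E)"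
        unfolding \<delta>_def by blast+
    qed
    have "k < k + \<delta>" using \<delta> by simp
    then obtain \<kappa> where \<kappa>: "\<kappa> \<in> S" "\<kappa> < k + \<delta>" "k \<le> \<kappa>"
      using cInf_less_iff[of S "k + \<delta>"] S1 bdd cInf_lower[OF _ bdd] unfolding k_def by blast
    have \<kappa>': "0 \<le> \<kappa>" "\<kappa> \<le> \<kappa>1" "0 \<le> k" using \<kappa> k \<kappa>0 by (auto simp: S_def)
    have near: "\<bar>F \<kappa> s - F k s\<bar> \<le> E * \<delta>" "\<bar>W \<kappa> s - W k s\<bar> \<le> E * \<delta>" if s: "0 \<le> s" "s \<le> r" for s
    proof -
      have "C * exp (\<Lambda> * s) * \<bar>\<kappa> - k\<bar> \<le> E * \<delta>"
        using Es[OF s] \<kappa> E by (intro mult_mono) auto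
      then show "\<bar>F \<kappa> s - F k s\<bar> \<le> E * \<delta>" "\<bar>W \<kappa> s - W k s\<bar> \<le> E * \<delta>"
        using lip[of \<kappa> k s] \<kappa>' k s by linarith+
    qed
    have pos: "0 < F \<kappa> s" if s: "0 \<le> s" "s \<le> r" for s
    proof -
      have "E * \<delta> < F k x" using \<delta>(2) E by (simp add: less_divide_eq mult.commute)
      then show ?thesis using near(1)[OF s] x(2)[OF s] by linarith
    qed
    have "r * W \<kappa> r < Z * F \<kappa> r"
    proof -
      have "\<bar>Z * (F \<kappa> r - F k r)\<bar> \<le> \<bar>Z\<bar> * (E * \<delta>)" using near(1)[OF r0] by (simp add: abs_mult mult_left_mono)
      moreover have "\<bar>r * (W \<kappa> r - W k r)\<bar> \<le> r * (E * \<delta>)" using near(2)[OF r0] r0 by (simp add: abs_mult mult_left_mono)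
      moreover have "\<delta> * ((\<bar>Z\<bar> + r) * E) < Z * F k r - r * W k r" using \<delta>(3) Zr by (simp add: less_divide_eq)
      ultimately show ?thesis by (simp add: algebra_simps abs_le_iff)
    qed
    moreover obtain s where "0 \<le> s" "F \<kappa> s \<le> 0" using \<kappa> by (auto simp: S_def)
    ultimately show False using trap[OF prof[OF \<kappa>'(1,2)] M \<kappa>'(1,2) r pos, of s] by simp
  qed
  then show ?thesis using that[of k "F k" "W k" R] k \<kappa>0(1) prof[of k] kpos R by simp
qed


text \<open>By \<open>fast\<close>, F r^(2 n + 1) does not increase. For W the curve B / r^(2 n) is
  a barrier: at a crossing F is at most W, the nonlinear term at most a constant times W, and the
  drift r / 2 outweighs both. The weight in the conclusion is one whose integrability is easily
  checked.\<close>

lemma fast_profile_decay: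
  assumes p: "is_profile n q \<alpha> M \<kappa> F W" and n: "1 \<le> n" and q: "1 < q" and \<alpha>: "0 < \<alpha>" and \<kappa>: "0 \<le> \<kappa>" and M: "0 < M"
    and pos: "\<And>r. 0 \<le> r \<Longrightarrow> 0 < F r" and W: "\<And>r. 0 \<le> r \<Longrightarrow> 0 \<le> W r" "\<And>r. 0 \<le> r \<Longrightarrow> W r \<le> M"
    and R: "1 \<le> R" and fast: "\<And>r. R \<le> r \<Longrightarrow> (2 * real n + 1) * F r \<le> r * W r"
  obtains C where "0 < C" "\<And>r. 0 \<le> r \<Longrightarrow> F r \<le> C / (1 + r\<^sup>2) ^ n" "\<And>r. 0 \<le> r \<Longrightarrow> W r \<le> C / (1 + r\<^sup>2) ^ n"
proof -
  note P = is_profileD[OF p]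
  have F1: "F r \<le> 1" if "0 \<le> r" for r
    using profile_decreasing[OF p, of r 0 r] pos that P(3) by (auto simp: less_imp_le)
  define CF where "CF = R ^ (2 * n + 1)"
  have CF: "0 < CF" using R by (simp add: CF_def)
  have FR: "F r \<le> CF / r ^ (2 * n + 1)" if r: "R \<le> r" for r
  proof -
    have "F r * r ^ (2 * n + 1) \<le> F R * R ^ (2 * n + 1)"
    proof (rule DERIV_nonpos_imp_nonincreasing[OF r])
      fix s assume s: "R \<le> s"
      have s0: "0 < s" using s R by simp
      have "((\<lambda>s. F s * s ^ (2 * n + 1)) has_real_derivative
          F s * (real (2 * n + 1) * s ^ (2 * n)) + - W s * s ^ (2 * n + 1)) (at s)"
        by (rule derivative_eq_intros P(5)[OF s0] refl | simp)+
      moreover have "F s * (real (2 * n + 1) * s ^ (2 * n)) + - W s * s ^ (2 * n + 1)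
          = s ^ (2 * n) * ((2 * real n + 1) * F s - s * W s)" by (simp add: algebra_simps)
      moreover have "\<dots> \<le> 0" using fast[OF s] s0 by (intro mult_nonneg_nonpos) auto
      ultimately show "\<exists>y. ((\<lambda>s. F s * s ^ (2 * n + 1)) has_real_derivative y) (at s) \<and> y \<le> 0" by metis
    qed
    also have "\<dots> \<le> CF" using F1[of R] R by (simp add: CF_def mult_left_le_one_le pos less_imp_le)
    finally show ?thesis using r R by (simp add: pos_le_divide_eq)
  qed
  define m where "m = 2 * n"
  \<comment> \<open>Beyond \<open>a\<close>, r / 2 exceeds the sum of the coefficients of W at a
    crossing: m from the slope of the barrier, \<open>\<kappa>\<close> M powr (q - 1) from the
    nonlinearity, \<open>\<alpha>\<close> from the term with F.\<close>
  define a where "a = R + 2 * (real m + \<kappa> * M powr (q - 1) + \<alpha>)"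
  have "0 \<le> \<kappa> * M powr (q - 1)" using \<kappa> by simp
  then have a: "R \<le> a" "1 \<le> a" "2 * (real m + \<kappa> * M powr (q - 1) + \<alpha>) < a" using R \<alpha> by (auto simp: a_def)
  \<comment> \<open>The first summand yields F \<le> W at a crossing, the second puts the barrier
    above W at \<open>a\<close>.\<close>
  define B where "B = CF + (M + 1) * a ^ m"
  have B: "CF \<le> B" "(M + 1) * a ^ m \<le> B" "0 < B" using CF M a by (auto simp: B_def intro!: add_pos_pos)
  have WR: "W r \<le> B / r ^ m" if ar: "a \<le> r" for r
  proof -
    have "0 < B / r ^ m - W r"
    proof (rule stays_positive[of a "\<lambda>r. B / r ^ m - W r" r])
      show "continuous_on {a..} (\<lambda>r. B / r ^ m - W r)"
        by (intro continuous_intros continuous_on_subset[OF P(2)]) (use a in auto)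
      have "W a < M + 1" using W(2)[of a] a by simp
      also have "M + 1 \<le> B / a ^ m" using B a by (simp add: pos_le_divide_eq)
      finally show "0 < B / a ^ m - W a" by simp
      fix r assume r: "a < r" "B / r ^ m - W r = 0"
      have r0: "1 \<le> r" "0 < r" "R \<le> r" using r a by auto
      have Wr: "W r = B / r ^ m" using r by simp
      have W0: "0 < W r" using Wr B r0 by simp
      have m1: "real m * r ^ (m - 1) = real m / r * r ^ m" using r0 by (cases m) auto
      have "((\<lambda>r. B / r ^ m) has_real_derivative (0 * r ^ m - B * (real m * r ^ (m - 1))) / (r ^ m * r ^ m)) (at r)"
        by (intro DERIV_divide DERIV_const) (use r0 in \<open>auto intro!: derivative_eq_intros\<close>)
      moreover have "(0 * r ^ m - B * (real m * r ^ (m - 1))) / (r ^ m * r ^ m) = - (real m / r * W r)"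
        unfolding m1 Wr using r0 by simp
      ultimately have "((\<lambda>r. B / r ^ m) has_real_derivative - (real m / r * W r)) (at r)" by simp
      then have d: "((\<lambda>r. B / r ^ m - W r) has_real_derivative - (real m / r * W r)
           - (\<alpha> * F r + \<kappa> * clip M (W r) powr q - (real (n - 1) / r + r / 2) * W r)) (at r)"
        by (intro DERIV_diff P(7)[OF r0(2)])
      have "clip M (W r) = W r" using W(2)[of r] W0 r0 by (simp add: clip_def)
      then have "clip M (W r) powr q = W r powr (q - 1) * W r" using W0 powr_add[of "W r" "q - 1" 1] by simp
      also have "\<dots> \<le> M powr (q - 1) * W r" using W0 W(2)[of r] r0 q by (intro mult_right_mono powr_mono2) auto
      finally have k: "\<kappa> * clip M (W r) powr q \<le> \<kappa> * (M powr (q - 1) * W r)" using \<kappa> by (intro mult_left_mono) auto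
      have "F r \<le> CF / r ^ (2 * n + 1)" by (rule FR[OF r0(3)])
      also have "\<dots> \<le> B / r ^ m" using B r0 CF by (intro frac_le) (auto simp: m_def mult_le_cancel_right1)
      finally have "F r \<le> W r" by (simp only: Wr)
      then have f: "\<alpha> * F r \<le> \<alpha> * W r" using \<alpha> by (intro mult_left_mono) auto
      have mr: "real m / r * W r \<le> real m * W r" using r0 W0 by (intro mult_right_mono) (auto simp: divide_le_eq mult_le_cancel_left1)
      have "(real m + \<kappa> * M powr (q - 1) + \<alpha>) * W r < r / 2 * W r" using a r W0 by (intro mult_strict_right_mono) auto
      moreover have "0 \<le> real (n - 1) / r * W r" using r0 W0 by simp
      ultimately have "0 < - (real m / r * W r) - (\<alpha> * F r + \<kappa> * clip M (W r) powr q - (real (n - 1) / r + r / 2) * W r)"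
        using k f mr by (simp add: distrib_right)
      with d show "\<exists>d>0. ((\<lambda>r. B / r ^ m - W r) has_real_derivative d) (at r)" by blast
    qed (rule ar)
    then show ?thesis by simp
  qed
  define C where "C = (M + 1) * (1 + a\<^sup>2) ^ n + B * 2 ^ n"
  have C: "0 < C" using M B by (auto simp: C_def intro!: add_pos_pos mult_pos_pos zero_less_power add_pos_nonneg)
  have bd: "X \<le> C / (1 + r\<^sup>2) ^ n" if r: "0 \<le> r" and X: "X \<le> M + 1" "a \<le> r \<Longrightarrow> X \<le> B / r ^ m" for X r
  proof (cases "r \<le> a")
    case True
    have "X * (1 + r\<^sup>2) ^ n \<le> (M + 1) * (1 + a\<^sup>2) ^ n"
      using X(1) M r True by (intro mult_mono power_mono add_left_mono) auto
    also have "\<dots> \<le> C" using B by (simp add: C_def)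
    finally show ?thesis by (subst pos_le_divide_eq) (auto intro!: zero_less_power add_pos_nonneg)
  next
    case False
    then have r1: "1 \<le> r" using a by simp
    have "(1 + r\<^sup>2) ^ n \<le> (2 * r\<^sup>2) ^ n" using r1 by (intro power_mono) auto
    also have "\<dots> = 2 ^ n * r ^ m" by (simp add: power_mult_distrib m_def power_mult)
    finally have *: "(1 + r\<^sup>2) ^ n \<le> 2 ^ n * r ^ m" .
    have "X * (1 + r\<^sup>2) ^ n \<le> B / r ^ m * (1 + r\<^sup>2) ^ n" using X(2) False by (intro mult_right_mono) auto
    also have "\<dots> \<le> B / r ^ m * (2 ^ n * r ^ m)" using * B r1 by (intro mult_left_mono) auto
    also have "\<dots> = B * 2 ^ n" using r1 by simp
    also have "\<dots> \<le> C" using M by (simp add: C_def)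
    finally show ?thesis by (subst pos_le_divide_eq) (auto intro!: zero_less_power add_pos_nonneg)
  qed
  show ?thesis
  proof (rule that[OF C])
    fix r :: real assume r: "0 \<le> r"
    show "W r \<le> C / (1 + r\<^sup>2) ^ n" by (rule bd[OF r]) (use W(2)[OF r] WR in auto)
    have "F r \<le> B / r ^ m" if "a \<le> r"
    proof -
      have "F r \<le> CF / r ^ (2 * n + 1)" using FR a that by simp
      also have "\<dots> \<le> B / r ^ m" using B that a CF by (intro frac_le) (auto simp: m_def mult_le_cancel_right1)
      finally show ?thesis .
    qed
    then show "F r \<le> C / (1 + r\<^sup>2) ^ n" by (intro bd[OF r]) (use F1[OF r] M in auto)
  qed
qed

lemma profile_initial_plateau:
  assumes p: "is_profile n q \<alpha> M \<kappa> F W" and n: "1 \<le> n" and q: "1 < q" and \<alpha>: "0 < \<alpha>" and \<kappa>: "0 \<le> \<kappa>" and M: "0 < M"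
    and pos: "\<And>r. 0 \<le> r \<Longrightarrow> 0 < F r" and \<rho>: "\<kappa> * (2 * \<alpha> * \<rho>) powr q < \<alpha>" and r: "0 \<le> r" "r \<le> \<rho>"
  shows "1 - \<alpha> * r\<^sup>2 \<le> F r"
proof -
  note P = is_profileD[OF p]
  have F1: "F r \<le> 1" if "0 \<le> r" for r
    using profile_decreasing[OF p, of r 0 r] pos that P(3) by (auto simp: less_imp_le)
  have "\<alpha> / n \<le> \<alpha>" using n \<alpha> by (simp add: divide_le_eq mult_le_cancel_left1)
  then have "\<forall>\<^sub>F r in at_right 0. W r / r < 2 * \<alpha>"
    by (intro order_tendstoD(2)[OF P(8)]) (use \<alpha> in linarith)
  then obtain b where b: "b > 0" "\<And>r. 0 < r \<Longrightarrow> r < b \<Longrightarrow> W r / r < 2 * \<alpha>"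
    by (auto simp: eventually_at_right_field)
  define a where "a = b / 2"
  have a: "0 < a" "a < b" using b by (auto simp: a_def)
  have W: "W s \<le> 2 * \<alpha> * s" if s: "0 < s" "s \<le> \<rho>" for s
  proof (cases "s < a")
    case True
    then show ?thesis using b(2)[of s] s a by (simp add: divide_less_eq less_imp_le)
  next
    case False
    have "0 < 2 * \<alpha> * s - W s"
    proof (rule stays_positive_on[of a \<rho> "\<lambda>s. 2 * \<alpha> * s - W s" s])
      show "continuous_on {a..\<rho>} (\<lambda>s. 2 * \<alpha> * s - W s)"
        by (intro continuous_intros continuous_on_subset[OF P(2)]) auto
      show "0 < 2 * \<alpha> * a - W a" using b(2)[of a] a by (simp add: divide_less_eq)
      fix r assume r: "a < r" "r \<le> \<rho>" "2 * \<alpha> * r - W r = 0"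
      have r0: "0 < r" using r a by simp
      have d: "((\<lambda>s. 2 * \<alpha> * s - W s) has_real_derivative
          2 * \<alpha> * 1 - (\<alpha> * F r + \<kappa> * clip M (W r) powr q - (real (n - 1) / r + r / 2) * W r)) (at r)"
        by (intro DERIV_diff P(7)[OF r0] DERIV_cmult DERIV_ident)
      have Wr: "W r = 2 * \<alpha> * r" using r by simp
      have "2 * \<alpha> * r \<le> 2 * \<alpha> * \<rho>" using r \<alpha> by (intro mult_left_mono) auto
      then have "W r \<le> 2 * \<alpha> * \<rho>" by (simp only: Wr)
      moreover have "0 \<le> \<alpha> * \<rho>" using r r0 \<alpha> by simp
      ultimately have "clip M (W r) powr q \<le> (2 * \<alpha> * \<rho>) powr q"
        using q M by (intro powr_mono2) (auto simp: clip_def)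
      then have "\<kappa> * clip M (W r) powr q \<le> \<kappa> * (2 * \<alpha> * \<rho>) powr q" using \<kappa> by (intro mult_left_mono) auto
      moreover have "\<alpha> * F r \<le> \<alpha>" using F1[of r] r0 \<alpha> by simp
      moreover have "0 \<le> (real (n - 1) / r + r / 2) * W r" using r0 Wr \<alpha> by simp
      ultimately have "0 < 2 * \<alpha> * 1 - (\<alpha> * F r + \<kappa> * clip M (W r) powr q - (real (n - 1) / r + r / 2) * W r)"
        using \<rho> by linarith
      with d show "\<exists>d>0. ((\<lambda>s. 2 * \<alpha> * s - W s) has_real_derivative d) (at r)" by blast
    qed (use False s in auto)
    then show ?thesis by simp
  qed
  have "F 0 + \<alpha> * 0\<^sup>2 \<le> F r + \<alpha> * r\<^sup>2"
  proof (rule DERIV_nonneg_imp_increasing_open[OF r(1)])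
    fix x assume x: "0 < x" "x < r"
    have "((\<lambda>s. F s + \<alpha> * s\<^sup>2) has_real_derivative - W x + \<alpha> * (2 * x)) (at x)"
      using P(5)[OF x(1)] by (auto intro!: derivative_eq_intros)
    moreover have "0 \<le> - W x + \<alpha> * (2 * x)" using W[of x] x r by simp
    ultimately show "\<exists>y. ((\<lambda>s. F s + \<alpha> * s\<^sup>2) has_real_derivative y) (at x) \<and> 0 \<le> y" by blast
  qed (intro continuous_intros continuous_on_subset[OF P(1)], auto)
  then show ?thesis using P(3) by simp
qed

section \<open>The self-similar solution\<close>

text \<open>The gradient of \<open>F(|x|)\<close> is \<open>- slope_ratio (|x|) x\<close>, and \<open>slope_defect\<close> is \<open>r\<close> times the derivative of
  \<open>slope_ratio\<close>, written so that it is continuous at \<open>r = 0\<close>.\<close>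

definition slope_ratio :: "nat \<Rightarrow> real \<Rightarrow> (real \<Rightarrow> real) \<Rightarrow> real \<Rightarrow> real" where
  "slope_ratio n \<alpha> W r = (if r \<le> 0 then \<alpha> / n else W r / r)"

definition slope_defect :: "nat \<Rightarrow> real \<Rightarrow> real \<Rightarrow> real \<Rightarrow> (real \<Rightarrow> real) \<Rightarrow> (real \<Rightarrow> real) \<Rightarrow> real \<Rightarrow> real" where
  "slope_defect n q \<alpha> \<kappa> F W r = \<alpha> * F r + \<kappa> * W r powr q - (n + r\<^sup>2 / 2) * slope_ratio n \<alpha> W r"

text \<open>The truncation level is hidden in an existential: once W stays below it, the truncation
  is inactive and the genuine profile equation holds.\<close>

definition is_positive_profile :: "nat \<Rightarrow> real \<Rightarrow> real \<Rightarrow> real \<Rightarrow> (real \<Rightarrow> real) \<Rightarrow> (real \<Rightarrow> real) \<Rightarrow> bool" where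
  "is_positive_profile n q \<alpha> \<kappa> F W \<longleftrightarrow> (\<exists>M>0. is_profile n q \<alpha> M \<kappa> F W \<and> (\<forall>r\<ge>0. 0 < F r \<and> 0 \<le> W r \<and> W r \<le> M))"

lemma is_positive_profileD:
  assumes "is_positive_profile n q \<alpha> \<kappa> F W"
  shows "continuous_on UNIV F" "continuous_on UNIV W" "F 0 = 1" "W 0 = 0"
    "\<And>r. 0 < r \<Longrightarrow> (F has_real_derivative - W r) (at r)"
    "\<And>r. 0 \<le> r \<Longrightarrow> (F has_real_derivative - W r) (at r within {0..})"
    "\<And>r. 0 < r \<Longrightarrow> (W has_real_derivative
        \<alpha> * F r + \<kappa> * W r powr q - (real (n - 1) / r + r / 2) * W r) (at r)"
    "((\<lambda>r. W r / r) \<longlongrightarrow> \<alpha> / n) (at_right 0)"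
    "\<And>r. 0 \<le> r \<Longrightarrow> 0 < F r" "\<And>r. 0 \<le> r \<Longrightarrow> 0 \<le> W r" "\<And>r. 0 < r \<Longrightarrow> 0 < W r"
proof -
  from assms obtain M where M: "M > 0" "is_profile n q \<alpha> M \<kappa> F W"
    and b: "\<And>r. 0 \<le> r \<Longrightarrow> 0 < F r \<and> 0 \<le> W r \<and> W r \<le> M"
    by (auto simp: is_positive_profile_def)
  note P = is_profileD[OF M(2)]
  show "continuous_on UNIV F" "continuous_on UNIV W" "F 0 = 1" "W 0 = 0"
    "((\<lambda>r. W r / r) \<longlongrightarrow> \<alpha> / n) (at_right 0)" by (rule P)+
  show "(F has_real_derivative - W r) (at r)" if "0 < r" for r by (rule P(5)[OF that])
  show "(F has_real_derivative - W r) (at r within {0..})" if "0 \<le> r" for r by (rule P(6)[OF that])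
  show "(W has_real_derivative
        \<alpha> * F r + \<kappa> * W r powr q - (real (n - 1) / r + r / 2) * W r) (at r)" if "0 < r" for r
  proof -
    have "clip M (W r) = W r" using b[of r] that by (simp add: clip_def)
    then show ?thesis using P(7)[OF that] by simp
  qed
  show "0 < F r" "0 \<le> W r" if "0 \<le> r" for r using b[OF that] by auto
  show "0 < W r" if "0 < r" for r by (rule P(10)[OF that]) (use b in auto)
qed

lemma slope_ratio_continuous:
  assumes p: "is_positive_profile n q \<alpha> \<kappa> F W"
  shows "continuous_on {0..} (slope_ratio n \<alpha> W)"
proof -
  note P = is_positive_profileD[OF p]
  have "(slope_ratio n \<alpha> W \<longlongrightarrow> slope_ratio n \<alpha> W r) (at r within {0..})" if "r \<in> {0..}" for r
  proof (cases "r = 0")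
    case True
    have "((\<lambda>r. W r / r) \<longlongrightarrow> \<alpha> / n) (at 0 within {0..})"
      using P(8) by (simp add: at_within_Ici_at_right)
    moreover have "\<forall>\<^sub>F r in at 0 within {0..}. W r / r = slope_ratio n \<alpha> W r"
      by (auto simp: eventually_at slope_ratio_def intro!: exI[of _ 1])
    ultimately have "(slope_ratio n \<alpha> W \<longlongrightarrow> \<alpha> / n) (at 0 within {0..})" by (rule Lim_transform_eventually)
    then show ?thesis using True by (simp add: slope_ratio_def)
  next
    case False
    then have r: "0 < r" using that by simp
    have "isCont (\<lambda>r. W r / r) r" using P(2) r
      by (intro continuous_intros) (auto simp: continuous_on_eq_continuous_at)
    then have "((\<lambda>r. W r / r) \<longlongrightarrow> W r / r) (at r)" by (simp add: isCont_def)
    moreover have "\<forall>\<^sub>F x in at r. W x / x = slope_ratio n \<alpha> W x"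
    proof -
      have "\<forall>\<^sub>F x in at r. x \<in> {0<..}" by (rule eventually_at_in_open') (use r in auto)
      then show ?thesis by eventually_elim (simp add: slope_ratio_def)
    qed
    ultimately have "(slope_ratio n \<alpha> W \<longlongrightarrow> W r / r) (at r)" by (rule Lim_transform_eventually)
    then have "(slope_ratio n \<alpha> W \<longlongrightarrow> slope_ratio n \<alpha> W r) (at r)"
      using r by (simp add: slope_ratio_def)
    then show ?thesis by (rule tendsto_within_subset) simp
  qed
  then show ?thesis by (simp add: continuous_on_def)
qed

lemma slope_ratio_norm_continuous:
  assumes p: "is_positive_profile n q \<alpha> \<kappa> F W"
  shows "continuous_on UNIV (\<lambda>x :: 'a::euclidean_space. slope_ratio n \<alpha> W (norm x))"
  by (rule continuous_on_compose2[OF slope_ratio_continuous[OF p]]) (auto intro!: continuous_intros)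

lemma profile_norm_continuous:
  assumes p: "is_positive_profile n q \<alpha> \<kappa> F W"
  shows "continuous_on UNIV (\<lambda>x :: 'a::euclidean_space. F (norm x))"
    "continuous_on UNIV (\<lambda>x :: 'a::euclidean_space. W (norm x))"
proof -
  note c = continuous_on_compose2[OF _ continuous_on_norm_id, of UNIV _ UNIV, simplified]
  show "continuous_on UNIV (\<lambda>x :: 'a. F (norm x))" "continuous_on UNIV (\<lambda>x :: 'a. W (norm x))"
    by (rule c, rule is_positive_profileD[OF p])+
qed

lemma slope_defect_norm_continuous:
  assumes p: "is_positive_profile n q \<alpha> \<kappa> F W" and q: "0 < q"
  shows "continuous_on UNIV (\<lambda>x :: 'a::euclidean_space. slope_defect n q \<alpha> \<kappa> F W (norm x))"
proof -
  have "continuous_on UNIV (\<lambda>x :: 'a. W (norm x) powr q)"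
    by (rule continuous_on_powr'[OF profile_norm_continuous(2)[OF p] continuous_on_const])
       (use q is_positive_profileD(10)[OF p] in auto)
  then show ?thesis unfolding slope_defect_def
    by (intro continuous_on_add continuous_on_diff continuous_on_mult profile_norm_continuous[OF p]
      slope_ratio_norm_continuous[OF p] continuous_on_const continuous_on_divide continuous_on_power continuous_on_norm_id) auto
qed

text \<open>The limit \<open>\<alpha>\<close> / n of W / r is exactly the value for which the terms
  cancel, and this cancellation makes the Hessian of F(|x|) continuous at the origin.\<close>

lemma slope_defect_0:
  assumes p: "is_positive_profile n q \<alpha> \<kappa> F W" and "1 \<le> n"
  shows "slope_defect n q \<alpha> \<kappa> F W 0 = 0"
  using assms(2) is_positive_profileD(3,4)[OF p] by (simp add: slope_defect_def slope_ratio_def)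

lemma profile_norm_derivative:
  assumes p: "is_positive_profile n q \<alpha> \<kappa> F W"
  shows "((\<lambda>x :: 'a::euclidean_space. F (norm x)) has_derivative (\<lambda>h. - slope_ratio n \<alpha> W (norm x) * (x \<bullet> h))) (at x)"
proof (cases "x = 0")
  case False
  note P = is_positive_profileD[OF p]
  have "(F has_derivative (*) (- W (norm x))) (at (norm x))"
    using P(5)[of "norm x"] False by (simp add: has_field_derivative_def)
  from has_derivative_compose[OF has_derivative_norm[OF False] this]
  have "((\<lambda>x. F (norm x)) has_derivative (\<lambda>h. - W (norm x) * (h \<bullet> sgn x))) (at x)" .
  moreover have "- W (norm x) * (h \<bullet> sgn x) = - slope_ratio n \<alpha> W (norm x) * (x \<bullet> h)" for h
    using False by (simp add: slope_ratio_def sgn_div_norm inner_commute field_simps)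
  ultimately show ?thesis by (simp only:)
next
  case True
  note P = is_positive_profileD[OF p]
  have "((\<lambda>r. (F r - F 0) / (r - 0)) \<longlongrightarrow> - W 0) (at_right 0)"
    using P(6)[of 0] by (simp add: has_field_derivative_iff at_within_Ici_at_right)
  then have l: "((\<lambda>r. (F r - 1) / r) \<longlongrightarrow> 0) (at_right 0)" using P(3,4) by simp
  have "filterlim norm (at_right 0) (at (0::'a))"
    by (auto simp: filterlim_at eventually_at intro!: tendsto_eq_intros exI[of _ 1])
  from filterlim_compose[OF l this] have "((\<lambda>h::'a. (F (norm h) - 1) / norm h) \<longlongrightarrow> 0) (at 0)" .
  from tendsto_norm[OF this] have "((\<lambda>h::'a. norm (F (0 + norm h) - 1) / norm h) \<longlongrightarrow> 0) (at 0)" by simp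
  then show ?thesis using True P(3) by (simp add: has_derivative_at)
qed

lemma slope_ratio_derivative:
  assumes p: "is_positive_profile n q \<alpha> \<kappa> F W" and n: "1 \<le> n" and r: "0 < r"
  shows "(slope_ratio n \<alpha> W has_real_derivative slope_defect n q \<alpha> \<kappa> F W r / r) (at r)"
proof -
  note P = is_positive_profileD[OF p]
  define g where "g = \<alpha> * F r + \<kappa> * W r powr q"
  have "((\<lambda>r. W r / r) has_real_derivative ((g - (real (n - 1) / r + r / 2) * W r) * r - W r * 1) / (r * r)) (at r)"
    unfolding g_def by (rule DERIV_divide[OF P(7)[OF r] DERIV_ident]) (use r in simp)
  also have "((g - (real (n - 1) / r + r / 2) * W r) * r - W r * 1) / (r * r) = (g - (n + r\<^sup>2 / 2) * (W r / r)) / r"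
    using r n by (simp add: field_simps power2_eq_square of_nat_diff)
  also have "\<dots> = slope_defect n q \<alpha> \<kappa> F W r / r" using r by (simp add: slope_defect_def slope_ratio_def g_def)
  finally show ?thesis
    by (rule has_field_derivative_transform_within_open[where S = "{0<..}"]) (use r in \<open>auto simp: slope_ratio_def\<close>)
qed

text \<open>Away from 0 this is the product rule. At 0 the factor x . b already vanishes to first
  order, so that continuity of the slope ratio suffices.\<close>

lemma slope_ratio_norm_derivative:
  fixes x b :: "'a::euclidean_space"
  assumes p: "is_positive_profile n q \<alpha> \<kappa> F W" and n: "1 \<le> n" and b: "b \<in> Basis"
  shows "((\<lambda>x. slope_ratio n \<alpha> W (norm x) * (x \<bullet> b)) has_derivative
     (\<lambda>h. slope_defect n q \<alpha> \<kappa> F W (norm x) * (x \<bullet> h) * (x \<bullet> b) / (norm x)\<^sup>2 + slope_ratio n \<alpha> W (norm x) * (h \<bullet> b))) (at x)"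
proof (cases "x = 0")
  case False
  let ?E = "slope_defect n q \<alpha> \<kappa> F W (norm x)"
  have "(slope_ratio n \<alpha> W has_derivative (*) (?E / norm x)) (at (norm x))"
    using slope_ratio_derivative[OF p n, of "norm x"] False by (simp add: has_field_derivative_def)
  from has_derivative_compose[OF has_derivative_norm[OF False] this]
  have "((\<lambda>x. slope_ratio n \<alpha> W (norm x)) has_derivative (\<lambda>h. ?E / norm x * (h \<bullet> sgn x))) (at x)" .
  moreover have "((\<lambda>x. x \<bullet> b) has_derivative (\<lambda>h. h \<bullet> b)) (at x)" by (auto intro!: derivative_eq_intros)
  ultimately have "((\<lambda>x. slope_ratio n \<alpha> W (norm x) * (x \<bullet> b)) has_derivative
      (\<lambda>h. slope_ratio n \<alpha> W (norm x) * (h \<bullet> b) + ?E / norm x * (h \<bullet> sgn x) * (x \<bullet> b))) (at x)"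
    by (rule has_derivative_mult)
  moreover have "slope_ratio n \<alpha> W (norm x) * (h \<bullet> b) + ?E / norm x * (h \<bullet> sgn x) * (x \<bullet> b)
     = ?E * (x \<bullet> h) * (x \<bullet> b) / (norm x)\<^sup>2 + slope_ratio n \<alpha> W (norm x) * (h \<bullet> b)" for h
    using False by (simp add: sgn_div_norm inner_commute power2_eq_square field_simps)
  ultimately show ?thesis by (simp only:)
next
  case True
  let ?Y = "\<lambda>x::'a. slope_ratio n \<alpha> W (norm x)"
  have "isCont ?Y 0" using slope_ratio_norm_continuous[OF p, where 'a = 'a] by (simp add: continuous_on_eq_continuous_at)
  then have "((\<lambda>h. \<bar>?Y h - ?Y 0\<bar>) \<longlongrightarrow> 0) (at 0)"
    by (simp add: isCont_def tendsto_rabs_zero LIM_zero)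
  then have "((\<lambda>h. norm (?Y h * (h \<bullet> b) - ?Y 0 * (h \<bullet> b)) / norm h) \<longlongrightarrow> 0) (at 0)"
  proof (rule Lim_null_comparison[rotated])
    show "\<forall>\<^sub>F h in at 0. norm (norm (?Y h * (h \<bullet> b) - ?Y 0 * (h \<bullet> b)) / norm h) \<le> \<bar>?Y h - ?Y 0\<bar>"
    proof (rule always_eventually, rule allI)
      fix h :: 'a
      have "\<bar>?Y h - ?Y 0\<bar> * \<bar>h \<bullet> b\<bar> \<le> \<bar>?Y h - ?Y 0\<bar> * norm h"
        by (intro mult_left_mono Basis_le_norm[OF b]) auto
      then show "norm (norm (?Y h * (h \<bullet> b) - ?Y 0 * (h \<bullet> b)) / norm h) \<le> \<bar>?Y h - ?Y 0\<bar>"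
        by (cases "h = 0") (simp_all add: left_diff_distrib[symmetric] abs_mult divide_le_eq)
    qed
  qed
  then have "((\<lambda>h. norm (?Y (0 + h) * ((0 + h) \<bullet> b) - ?Y 0 * (0 \<bullet> b) - ?Y 0 * (h \<bullet> b)) / norm h) \<longlongrightarrow> 0) (at 0)" by simp
  moreover have "bounded_linear (\<lambda>h::'a. ?Y 0 * (h \<bullet> b))"
    by (intro bounded_linear_const_mult bounded_linear_inner_left)
  ultimately have "((\<lambda>x. ?Y x * (x \<bullet> b)) has_derivative (\<lambda>h. ?Y 0 * (h \<bullet> b))) (at 0)"
    unfolding has_derivative_at by blast
  then show ?thesis using True by simp
qed

text \<open>Minus the second derivative of F(|x|) in the directions \<open>b\<close> and
  \<open>c\<close>. At x = 0 the first summand is 0, which is also its limit because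
  \<open>slope_defect\<close> vanishes there.\<close>

definition second_profile :: "nat \<Rightarrow> real \<Rightarrow> real \<Rightarrow> real \<Rightarrow> (real \<Rightarrow> real) \<Rightarrow> (real \<Rightarrow> real) \<Rightarrow> 'a::euclidean_space \<Rightarrow> 'a \<Rightarrow> 'a \<Rightarrow> real" where
  "second_profile n q \<alpha> \<kappa> F W b c x =
     slope_defect n q \<alpha> \<kappa> F W (norm x) * (x \<bullet> c) * (x \<bullet> b) / (norm x)\<^sup>2 + slope_ratio n \<alpha> W (norm x) * (c \<bullet> b)"

lemma second_profile_continuous:
  fixes b c :: "'a::euclidean_space"
  assumes p: "is_positive_profile n q \<alpha> \<kappa> F W" and n: "1 \<le> n" and q: "0 < q" and bc: "b \<in> Basis" "c \<in> Basis"
  shows "continuous_on UNIV (second_profile n q \<alpha> \<kappa> F W b c)"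
proof -
  let ?E = "\<lambda>x::'a. slope_defect n q \<alpha> \<kappa> F W (norm x)"
  let ?f = "\<lambda>x::'a. ?E x * (x \<bullet> c) * (x \<bullet> b) / (norm x)\<^sup>2"
  have Ec: "isCont ?E x" for x using slope_defect_norm_continuous[OF p q, where 'a = 'a]
    by (simp add: continuous_on_eq_continuous_at)
  have "isCont ?f x" for x
  proof (cases "x = 0")
    case False
    then show ?thesis by (intro continuous_intros Ec) auto
  next
    case True
    have "(?E \<longlongrightarrow> 0) (at 0)" using Ec[of 0] slope_defect_0[OF p n] by (simp add: isCont_def)
    then have "((\<lambda>x. \<bar>?E x\<bar>) \<longlongrightarrow> 0) (at 0)" by (rule tendsto_rabs_zero)
    then have "(?f \<longlongrightarrow> 0) (at 0)"
    proof (rule Lim_null_comparison[rotated])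
      show "\<forall>\<^sub>F x in at 0. norm (?f x) \<le> \<bar>?E x\<bar>"
      proof (rule always_eventually, rule allI)
        fix x :: 'a
        have "\<bar>x \<bullet> c\<bar> * \<bar>x \<bullet> b\<bar> \<le> norm x * norm x" by (intro mult_mono Basis_le_norm bc) auto
        then have "\<bar>?E x\<bar> * (\<bar>x \<bullet> c\<bar> * \<bar>x \<bullet> b\<bar>) \<le> \<bar>?E x\<bar> * (norm x * norm x)" by (rule mult_left_mono) simp
        then show "norm (?f x) \<le> \<bar>?E x\<bar>"
          by (cases "x = 0") (simp_all add: abs_mult divide_le_eq power2_eq_square mult.assoc)
      qed
    qed
    then show ?thesis using True by (simp add: isCont_def)
  qed
  then have "continuous_on UNIV ?f" by (simp add: continuous_at_imp_continuous_on)
  moreover have "continuous_on UNIV (\<lambda>x::'a. slope_ratio n \<alpha> W (norm x) * (c \<bullet> b))"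
    by (intro continuous_on_mult slope_ratio_norm_continuous[OF p] continuous_intros)
  ultimately show ?thesis unfolding second_profile_def by (rule continuous_on_add)
qed

lemma partial_deriv_eq:
  "(f has_derivative f') (at x) \<Longrightarrow> partial_deriv b f x = f' b"
  by (simp add: partial_deriv_def frechet_derivative_at[symmetric])

section \<open>The wave carried by a profile, its derivatives and its equation\<close>

definition self_similar_wave :: "real \<Rightarrow> real \<Rightarrow> (real \<Rightarrow> real) \<Rightarrow> real \<Rightarrow> 'a::euclidean_space \<Rightarrow> real" where
  "self_similar_wave \<alpha> a F t x = - (a * t powr - \<alpha> * F (norm (t powr (- 1 / 2) *\<^sub>R x)))"

lemma self_similar_wave_derivative:
  fixes x :: "'a::euclidean_space"
  assumes p: "is_positive_profile n q \<alpha> \<kappa> F W" and t: "0 < t"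
  defines "\<xi> \<equiv> t powr (- 1 / 2) *\<^sub>R x"
  shows "(self_similar_wave \<alpha> a F t has_derivative
    (\<lambda>h. a * t powr (- \<alpha> - 1 / 2) * (slope_ratio n \<alpha> W (norm \<xi>) * (\<xi> \<bullet> h)))) (at x)"
proof -
  let ?s = "t powr (- 1 / 2)"
  have "((\<lambda>x::'a. ?s *\<^sub>R x) has_derivative (\<lambda>h. ?s *\<^sub>R h)) (at x)"
    by (auto intro!: derivative_eq_intros)
  from has_derivative_compose[OF this profile_norm_derivative[OF p, of "?s *\<^sub>R x"]]
  have "((\<lambda>x::'a. F (norm (?s *\<^sub>R x))) has_derivative
      (\<lambda>h. - slope_ratio n \<alpha> W (norm \<xi>) * (\<xi> \<bullet> (?s *\<^sub>R h)))) (at x)"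
    by (simp only: \<xi>_def)
  from has_derivative_minus[OF has_derivative_mult_right[OF this, of "a * t powr - \<alpha>"]]
  have "(self_similar_wave \<alpha> a F t has_derivative
      (\<lambda>h. - (a * t powr - \<alpha> * (- slope_ratio n \<alpha> W (norm \<xi>) * (\<xi> \<bullet> (?s *\<^sub>R h)))))) (at x)"
    by (simp only: self_similar_wave_def[abs_def])
  moreover have "t powr (- \<alpha> - 1 / 2) = t powr - \<alpha> * ?s" by (simp add: powr_add[symmetric])
  then have "- (a * t powr - \<alpha> * (- slope_ratio n \<alpha> W (norm \<xi>) * (\<xi> \<bullet> (?s *\<^sub>R h))))
      = a * t powr (- \<alpha> - 1 / 2) * (slope_ratio n \<alpha> W (norm \<xi>) * (\<xi> \<bullet> h))" for h
    by (simp add: mult_ac)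
  ultimately show ?thesis by (simp only:)
qed

lemma partial_self_similar_wave:
  fixes x :: "'a::euclidean_space"
  assumes p: "is_positive_profile n q \<alpha> \<kappa> F W" and t: "0 < t"
  shows "partial_deriv b (self_similar_wave \<alpha> a F t) x = a * t powr (- \<alpha> - 1 / 2) *
    (slope_ratio n \<alpha> W (norm (t powr (- 1 / 2) *\<^sub>R x)) * ((t powr (- 1 / 2) *\<^sub>R x) \<bullet> b))"
  by (rule partial_deriv_eq[OF self_similar_wave_derivative[OF p t]])

lemma self_similar_wave_second_derivative:
  fixes x :: "'a::euclidean_space"
  assumes p: "is_positive_profile n q \<alpha> \<kappa> F W" and t: "0 < t" and n: "1 \<le> n" and b: "b \<in> Basis"
  shows "(partial_deriv b (self_similar_wave \<alpha> a F t) has_derivative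
    (\<lambda>h. a * t powr (- \<alpha> - 1) * second_profile n q \<alpha> \<kappa> F W b h (t powr (- 1 / 2) *\<^sub>R x))) (at x)"
proof -
  let ?s = "t powr (- 1 / 2)"
  let ?D = "\<lambda>h. slope_defect n q \<alpha> \<kappa> F W (norm (?s *\<^sub>R x)) * ((?s *\<^sub>R x) \<bullet> h) * ((?s *\<^sub>R x) \<bullet> b) / (norm (?s *\<^sub>R x))\<^sup>2
       + slope_ratio n \<alpha> W (norm (?s *\<^sub>R x)) * (h \<bullet> b)"
  have "((\<lambda>x::'a. ?s *\<^sub>R x) has_derivative (\<lambda>h. ?s *\<^sub>R h)) (at x)"
    by (auto intro!: derivative_eq_intros)
  from has_derivative_compose[OF this slope_ratio_norm_derivative[OF p n b, of "?s *\<^sub>R x"]]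
  have "((\<lambda>x. slope_ratio n \<alpha> W (norm (?s *\<^sub>R x)) * ((?s *\<^sub>R x) \<bullet> b)) has_derivative (\<lambda>h. ?D (?s *\<^sub>R h))) (at x)" .
  from has_derivative_mult_right[OF this, of "a * t powr (- \<alpha> - 1 / 2)"]
  have "(partial_deriv b (self_similar_wave \<alpha> a F t) has_derivative (\<lambda>h. a * t powr (- \<alpha> - 1 / 2) * ?D (?s *\<^sub>R h))) (at x)"
    unfolding partial_self_similar_wave[OF p t, abs_def] .
  moreover have "?D (?s *\<^sub>R h) = ?s * second_profile n q \<alpha> \<kappa> F W b h (?s *\<^sub>R x)" for h
    by (simp add: second_profile_def algebra_simps)
  moreover have "- \<alpha> - 1 = (- \<alpha> - 1 / 2) + (- 1 / 2)" by simp
  then have "t powr (- \<alpha> - 1) = t powr (- \<alpha> - 1 / 2) * ?s" by (simp only: powr_add)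
  ultimately show ?thesis by (simp only: mult.assoc)
qed

lemma second_partial_self_similar_wave:
  fixes x :: "'a::euclidean_space"
  assumes p: "is_positive_profile n q \<alpha> \<kappa> F W" and t: "0 < t" and n: "1 \<le> n" and b: "b \<in> Basis"
  shows "partial_deriv c (partial_deriv b (self_similar_wave \<alpha> a F t)) x =
    a * t powr (- \<alpha> - 1) * second_profile n q \<alpha> \<kappa> F W b c (t powr (- 1 / 2) *\<^sub>R x)"
  by (rule partial_deriv_eq[OF self_similar_wave_second_derivative[OF p t n b]])

lemma self_similar_wave_time_derivative:
  fixes x :: "'a::euclidean_space"
  assumes p: "is_positive_profile n q \<alpha> \<kappa> F W" and t: "0 < t"
  defines "\<xi> \<equiv> t powr (- 1 / 2) *\<^sub>R x"
  shows "((\<lambda>s. self_similar_wave \<alpha> a F s x) has_real_derivative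
    a * t powr (- \<alpha> - 1) * (\<alpha> * F (norm \<xi>) - slope_ratio n \<alpha> W (norm \<xi>) * (norm \<xi>)\<^sup>2 / 2)) (at t)"
proof -
  let ?Y = "slope_ratio n \<alpha> W (norm \<xi>)"
  have pw: "((\<lambda>s. s powr r) has_real_derivative r * t powr (r - 1)) (at t)" for r
    by (rule has_real_derivative_powr[OF t])
  have "((\<lambda>s. s powr (- 1 / 2) *\<^sub>R x) has_derivative (\<lambda>h. (h * (- 1 / 2 * t powr (- 1 / 2 - 1))) *\<^sub>R x)) (at t)"
    by (rule has_derivative_scaleR_left)
       (use pw[of "- 1 / 2"] in \<open>simp only: has_field_derivative_def mult_commute_abs\<close>)
  from has_derivative_compose[OF this profile_norm_derivative[OF p, of "t powr (- 1 / 2) *\<^sub>R x"]]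
  have "((\<lambda>s. F (norm (s powr (- 1 / 2) *\<^sub>R x))) has_derivative
      (\<lambda>h. - ?Y * (\<xi> \<bullet> (h * (- 1 / 2 * t powr (- 1 / 2 - 1))) *\<^sub>R x))) (at t)" by (simp only: \<xi>_def)
  moreover have "- ?Y * (\<xi> \<bullet> (h * (- 1 / 2 * t powr (- 1 / 2 - 1))) *\<^sub>R x) = (?Y * (norm \<xi>)\<^sup>2 / 2 * t powr - 1) * h" for h
  proof -
    have "- 1 / 2 - 1 = - 1 + (- 1 / 2 :: real)" by simp
    then have e: "t powr (- 1 / 2 - 1) = t powr - 1 * t powr (- 1 / 2)" by (simp only: powr_add)
    have nx: "(norm \<xi>)\<^sup>2 = t powr (- 1 / 2) * (\<xi> \<bullet> x)"
      unfolding power2_norm_eq_inner by (simp add: \<xi>_def)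
    have "\<xi> \<bullet> (t powr (- 1 / 2 - 1) *\<^sub>R x) = t powr - 1 * (norm \<xi>)\<^sup>2"
      unfolding inner_scaleR_right nx e by (simp only: mult.assoc)
    then have "\<xi> \<bullet> (h * (- 1 / 2 * t powr (- 1 / 2 - 1))) *\<^sub>R x = - h / 2 * (t powr - 1 * (norm \<xi>)\<^sup>2)"
      by (simp add: algebra_simps)
    then show ?thesis by (simp add: algebra_simps)
  qed
  ultimately have f: "((\<lambda>s. F (norm (s powr (- 1 / 2) *\<^sub>R x))) has_real_derivative ?Y * (norm \<xi>)\<^sup>2 / 2 * t powr - 1) (at t)"
    by (simp only: has_field_derivative_def)
  have "((\<lambda>s. - (a * s powr - \<alpha> * F (norm (s powr (- 1 / 2) *\<^sub>R x)))) has_real_derivative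
      - (a * (- \<alpha> * t powr (- \<alpha> - 1)) * F (norm \<xi>) + ?Y * (norm \<xi>)\<^sup>2 / 2 * t powr - 1 * (a * t powr - \<alpha>))) (at t)"
    unfolding \<xi>_def by (intro DERIV_minus DERIV_mult DERIV_cmult pw f[unfolded \<xi>_def])
  moreover have "- \<alpha> - 1 = - \<alpha> + - 1" by simp
  then have "t powr (- \<alpha> - 1) = t powr - \<alpha> * t powr - 1" by (simp only: powr_add)
  then have "- (a * (- \<alpha> * t powr (- \<alpha> - 1)) * F (norm \<xi>) + ?Y * (norm \<xi>)\<^sup>2 / 2 * t powr - 1 * (a * t powr - \<alpha>))
     = a * t powr (- \<alpha> - 1) * (\<alpha> * F (norm \<xi>) - ?Y * (norm \<xi>)\<^sup>2 / 2)"
    by (simp add: algebra_simps)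
  ultimately show ?thesis by (simp only: self_similar_wave_def)
qed

lemma scaled_argument_continuous:
  assumes "continuous_on UNIV G"
  shows "continuous_on ({0<..} \<times> UNIV) (\<lambda>(t, x :: 'a::euclidean_space). (G (t powr (- 1 / 2) *\<^sub>R x) :: real))"
  unfolding split_beta
  by (rule continuous_on_compose2[OF assms]) (auto intro!: continuous_intros)

lemma scaled_function_continuous:
  assumes "continuous_on UNIV G"
  shows "continuous_on ({0<..} \<times> UNIV) (\<lambda>(t, x :: 'a::euclidean_space). c * t powr r * (G (t powr (- 1 / 2) *\<^sub>R x) :: real))"
proof -
  have "continuous_on ({0<..} \<times> (UNIV :: 'a set)) (\<lambda>z. c * fst z powr r)"
    by (auto intro!: continuous_intros)
  from continuous_on_mult[OF this scaled_argument_continuous[OF assms, unfolded split_beta]]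
  show ?thesis by (simp add: split_beta)
qed

lemma C_2_1_self_similar_wave:
  assumes p: "is_positive_profile n q \<alpha> \<kappa> F W" and n: "1 \<le> n" and q: "0 < q"
  shows "C_2_1 (self_similar_wave \<alpha> a F :: real \<Rightarrow> 'a::euclidean_space \<Rightarrow> real)"
  unfolding C_2_1_def
proof (intro conjI allI impI ballI)
  let ?V = "self_similar_wave \<alpha> a F :: real \<Rightarrow> 'a \<Rightarrow> real"
  fix t :: real and x :: 'a assume t: "0 < t"
  show "(\<lambda>s. ?V s x) differentiable at t"
    using self_similar_wave_time_derivative[OF p t, of a x] by (auto simp: real_differentiable_def)
  show "?V t differentiable at x"
    using self_similar_wave_derivative[OF p t, of a x] by (auto simp: differentiable_def)
  show "partial_deriv b (?V t) differentiable at x" if "b \<in> Basis" for b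
    using self_similar_wave_second_derivative[OF p t n that, of a x] by (auto simp: differentiable_def)
next
  let ?V = "self_similar_wave \<alpha> a F :: real \<Rightarrow> 'a \<Rightarrow> real"
  let ?Y = "\<lambda>x::'a. slope_ratio n \<alpha> W (norm x)"
  have Yc: "continuous_on UNIV ?Y" by (rule slope_ratio_norm_continuous[OF p])
  have "continuous_on ({0<..} \<times> UNIV) (\<lambda>(t, x::'a). (- a) * t powr - \<alpha> * F (norm (t powr (- 1 / 2) *\<^sub>R x)))"
    by (rule scaled_function_continuous[OF profile_norm_continuous(1)[OF p]])
  then show "continuous_on ({0<..} \<times> UNIV) (\<lambda>(t, x). ?V t x)"
    by (simp add: self_similar_wave_def)
  have "continuous_on UNIV (\<lambda>x::'a. \<alpha> * F (norm x) - ?Y x * (norm x)\<^sup>2 / 2)"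
    by (intro continuous_on_diff continuous_on_mult continuous_on_const profile_norm_continuous[OF p]
        continuous_on_divide Yc continuous_on_power continuous_on_norm_id) auto
  from scaled_function_continuous[OF this, of a "- \<alpha> - 1"]
  show "continuous_on ({0<..} \<times> UNIV) (\<lambda>(t, x). deriv (\<lambda>s. ?V s x) t)"
    by (rule continuous_on_eq) (auto simp: DERIV_imp_deriv[OF self_similar_wave_time_derivative[OF p]])
  fix b :: 'a assume b: "b \<in> Basis"
  have "continuous_on UNIV (\<lambda>x::'a. ?Y x * (x \<bullet> b))"
    by (intro continuous_on_mult Yc continuous_intros)
  from scaled_function_continuous[OF this, of a "- \<alpha> - 1 / 2"]
  show "continuous_on ({0<..} \<times> UNIV) (\<lambda>(t, x). partial_deriv b (?V t) x)"
    by (rule continuous_on_eq) (auto simp: partial_self_similar_wave[OF p])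
  fix c :: 'a assume c: "c \<in> Basis"
  from scaled_function_continuous[OF second_profile_continuous[OF p n q b c], of a "- \<alpha> - 1"]
  show "continuous_on ({0<..} \<times> UNIV) (\<lambda>(t, x). partial_deriv c (partial_deriv b (?V t)) x)"
    by (rule continuous_on_eq) (auto simp: second_partial_self_similar_wave[OF p _ n b])
qed

lemma sum_inner_square: "(\<Sum>b\<in>Basis. (x \<bullet> b) * (x \<bullet> b)) = (norm (x::'a::euclidean_space))\<^sup>2"
  by (simp add: power2_norm_eq_inner euclidean_inner[of x x])

lemma grad_self_similar_wave:
  fixes x :: "'a::euclidean_space"
  assumes p: "is_positive_profile n q \<alpha> \<kappa> F W" and t: "0 < t"
  defines "\<xi> \<equiv> t powr (- 1 / 2) *\<^sub>R x"
  shows "grad (self_similar_wave \<alpha> a F t) x = (a * t powr (- \<alpha> - 1 / 2) * slope_ratio n \<alpha> W (norm \<xi>)) *\<^sub>R \<xi>"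
proof -
  have "grad (self_similar_wave \<alpha> a F t) x =
      (\<Sum>b\<in>Basis. (a * t powr (- \<alpha> - 1 / 2) * slope_ratio n \<alpha> W (norm \<xi>)) *\<^sub>R ((\<xi> \<bullet> b) *\<^sub>R b))"
    unfolding grad_def partial_self_similar_wave[OF p t] \<xi>_def[symmetric] by (simp add: mult.assoc)
  then show ?thesis by (simp only: scaleR_sum_right[symmetric] euclidean_representation)
qed

lemma norm_grad_self_similar_wave:
  fixes x :: "'a::euclidean_space"
  assumes p: "is_positive_profile n q \<alpha> \<kappa> F W" and t: "0 < t" and a: "0 < a"
  shows "norm (grad (self_similar_wave \<alpha> a F t) x) = a * t powr (- \<alpha> - 1 / 2) * W (norm (t powr (- 1 / 2) *\<^sub>R x))"
proof -
  define \<xi> where "\<xi> = t powr (- 1 / 2) *\<^sub>R x"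
  have "norm (grad (self_similar_wave \<alpha> a F t) x) = a * t powr (- \<alpha> - 1 / 2) * (\<bar>slope_ratio n \<alpha> W (norm \<xi>)\<bar> * norm \<xi>)"
    unfolding grad_self_similar_wave[OF p t] \<xi>_def[symmetric] using a by (simp add: abs_mult)
  also have "\<bar>slope_ratio n \<alpha> W (norm \<xi>)\<bar> * norm \<xi> = W (norm \<xi>)"
    using is_positive_profileD(4,10)[OF p] by (auto simp: slope_ratio_def)
  finally show ?thesis by (simp add: \<xi>_def)
qed

text \<open>The diagonal of the Hessian sums to \<open>slope_defect\<close> plus n times the slope
  ratio, and the latter cancels against the same term inside \<open>slope_defect\<close>. What
  remains differs from the time derivative by the nonlinear term alone.\<close>

lemma laplacian_self_similar_wave:
  fixes x :: "'a::euclidean_space"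
  assumes p: "is_positive_profile DIM('a) q \<alpha> \<kappa> F W" and t: "0 < t"
  defines "\<xi> \<equiv> t powr (- 1 / 2) *\<^sub>R x"
  shows "laplacian (self_similar_wave \<alpha> a F t) x = a * t powr (- \<alpha> - 1) *
    (\<alpha> * F (norm \<xi>) + \<kappa> * W (norm \<xi>) powr q - slope_ratio DIM('a) \<alpha> W (norm \<xi>) * (norm \<xi>)\<^sup>2 / 2)"
proof -
  let ?E = "slope_defect DIM('a) q \<alpha> \<kappa> F W (norm \<xi>)"
  let ?Y = "slope_ratio DIM('a) \<alpha> W (norm \<xi>)"
  have n: "1 \<le> DIM('a)" by (simp add: DIM_ge_Suc0)
  have "laplacian (self_similar_wave \<alpha> a F t) x =
      a * t powr (- \<alpha> - 1) * (\<Sum>b\<in>Basis. second_profile DIM('a) q \<alpha> \<kappa> F W b b \<xi>)"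
    unfolding laplacian_def sum_distrib_left
    by (intro sum.cong refl) (simp add: second_partial_self_similar_wave[OF p t n] \<xi>_def)
  also have "(\<Sum>b\<in>Basis. second_profile DIM('a) q \<alpha> \<kappa> F W b b \<xi>) = (\<Sum>b\<in>Basis. ?E / (norm \<xi>)\<^sup>2 * ((\<xi> \<bullet> b) * (\<xi> \<bullet> b)) + ?Y)"
    by (intro sum.cong refl) (simp add: second_profile_def)
  also have "\<dots> = ?E / (norm \<xi>)\<^sup>2 * (norm \<xi>)\<^sup>2 + DIM('a) * ?Y"
    by (simp only: sum.distrib sum_distrib_left[symmetric] sum_inner_square sum_constant)
  also have "?E / (norm \<xi>)\<^sup>2 * (norm \<xi>)\<^sup>2 = ?E"
    using slope_defect_0[OF p n] by (cases "\<xi> = 0") auto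
  also have "?E + DIM('a) * ?Y = \<alpha> * F (norm \<xi>) + \<kappa> * W (norm \<xi>) powr q - ?Y * (norm \<xi>)\<^sup>2 / 2"
    by (simp add: slope_defect_def algebra_simps)
  finally show ?thesis .
qed

lemma self_similar_solution_wave:
  assumes p: "is_positive_profile DIM('a::euclidean_space) q \<alpha> \<kappa> F W" and q: "1 < q"
    and \<alpha>: "\<alpha> = (2 - q) / (2 * (q - 1))" and a: "0 < a" "a powr (q - 1) = \<kappa>"
  shows "self_similar_solution q (self_similar_wave \<alpha> a F :: real \<Rightarrow> 'a \<Rightarrow> real)"
  unfolding self_similar_solution_def solves_VHJ_def
proof (intro conjI allI impI)
  have n: "1 \<le> DIM('a)" by (simp add: DIM_ge_Suc0)
  show "C_2_1 (self_similar_wave \<alpha> a F :: real \<Rightarrow> 'a \<Rightarrow> real)" using q by (intro C_2_1_self_similar_wave[OF p n]) simp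
  fix t :: real and x :: 'a assume t: "0 < t"
  have "- \<alpha> = - (2 - q) / (2 * (q - 1))" by (simp only: \<alpha> minus_divide_left)
  then show "self_similar_wave \<alpha> a F t x =
      t powr (- (2 - q) / (2 * (q - 1))) * self_similar_wave \<alpha> a F 1 (t powr (- 1 / 2) *\<^sub>R x)"
    by (simp add: self_similar_wave_def)
  define \<xi> where "\<xi> = t powr (- 1 / 2) *\<^sub>R x"
  \<comment> \<open>Balance of the powers of t in the gradient term and in the linear terms; this
    fixes the value of \<open>\<alpha>\<close>.\<close>
  have "(- \<alpha> - 1 / 2) * q = - \<alpha> - 1" using q by (simp add: \<alpha> field_simps)
  moreover have "a powr q = a * \<kappa>" using a powr_add[of a 1 "q - 1"] by simp
  ultimately have "norm (grad (self_similar_wave \<alpha> a F t) x) powr q = a * t powr (- \<alpha> - 1) * (\<kappa> * W (norm \<xi>) powr q)"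
    unfolding norm_grad_self_similar_wave[OF p t a(1)] \<xi>_def[symmetric]
    using a is_positive_profileD(10)[OF p] by (simp add: powr_mult powr_powr)
  then show "deriv (\<lambda>s. self_similar_wave \<alpha> a F s x) t - laplacian (self_similar_wave \<alpha> a F t) x
      + norm (grad (self_similar_wave \<alpha> a F t) x) powr q = 0"
    using DERIV_imp_deriv[OF self_similar_wave_time_derivative[OF p t, of a x]]
    by (simp add: laplacian_self_similar_wave[OF p t] \<xi>_def algebra_simps)
qed

section \<open>Strong coupling forces a zero of the profile\<close>

lemma C_2_1_axis_derivs:
  assumes u: "C_2_1 u" and t: "0 < t"
  shows "((\<lambda>s. u s x) has_real_derivative deriv (\<lambda>s. u s x) t) (at t)"
    "b \<in> Basis \<Longrightarrow> axis_deriv (u t) (partial_deriv b (u t) x) b x"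
    "b \<in> Basis \<Longrightarrow> axis_deriv (partial_deriv b (u t)) (partial_deriv b (partial_deriv b (u t)) x) b x"
proof -
  have "(\<lambda>s. u s x) differentiable at t" using u t by (simp add: C_2_1_def)
  then show "((\<lambda>s. u s x) has_real_derivative deriv (\<lambda>s. u s x) t) (at t)"
    using DERIV_deriv_iff_real_differentiable by blast
  have ax: "axis_deriv f (partial_deriv b f x) b x" if "f differentiable at x" for f
  proof -
    have "(f has_derivative frechet_derivative f (at x)) (at (x + 0 *\<^sub>R b))"
      using that by (simp add: frechet_derivative_works)
    moreover have "((\<lambda>s. x + s *\<^sub>R b) has_derivative (\<lambda>s. s *\<^sub>R b)) (at 0)" by (auto intro!: derivative_eq_intros)
    ultimately have "((\<lambda>s. f (x + s *\<^sub>R b)) has_derivative (\<lambda>s. frechet_derivative f (at x) (s *\<^sub>R b))) (at 0)"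
      by (rule has_derivative_compose[rotated])
    moreover have "frechet_derivative f (at x) (s *\<^sub>R b) = partial_deriv b f x * s" for s
      using linear_frechet_derivative[OF that] by (simp add: linear_cmul partial_deriv_def)
    ultimately show ?thesis by (simp add: has_field_derivative_def)
  qed
  show "b \<in> Basis \<Longrightarrow> axis_deriv (u t) (partial_deriv b (u t) x) b x"
    using u t by (intro ax) (simp add: C_2_1_def)
  show "b \<in> Basis \<Longrightarrow> axis_deriv (partial_deriv b (u t)) (partial_deriv b (partial_deriv b (u t)) x) b x"
    using u t by (intro ax) (simp add: C_2_1_def)
qed

text \<open>A positive profile would give a wave whose size at the origin decays like t powr -
  \<open>\<alpha>\<close>. It starts above a / 2 on a ball of radius \<open>\<rho>\<close>, hence
  above a barrier with c0 = (a / 2) \<open>\<rho>\<close> powr - p. Since \<open>\<rho>\<close> is a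
  multiple of \<open>\<kappa>\<close> powr (- 1 / q), the quotient of a / 2 and c0 powr (1 - q / 2)
  is exactly c1 \<open>\<kappa>\<close>, which exceeds \<open>L\<close> for large
  \<open>\<kappa>\<close>; the barrier then never decays.\<close>

lemma profile_cannot_stay_positive:
  assumes q: "1 < q" "q < 2" and \<alpha>: "\<alpha> = (2 - q) / (2 * (q - 1))"
  obtains \<kappa>1 where "0 < \<kappa>1" "\<And>F W. \<not> is_positive_profile DIM('a::euclidean_space) q \<alpha> \<kappa>1 F W"
proof -
  define p where "p = q / (q - 1)"
  have \<alpha>0: "0 < \<alpha>" using q by (simp add: \<alpha>)
  have p2: "2 < p" using q by (simp add: p_def field_simps)
  obtain L where L: "0 < L"
    "\<And>(w :: real \<Rightarrow> 'a \<Rightarrow> real) x0 M0 c0 t. supersolution q w \<Longrightarrow> 0 < c0 \<Longrightarrow>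
       (\<And>x. M0 - c0 * norm (x - x0) powr p \<le> w 0 x) \<Longrightarrow> 0 \<le> t \<Longrightarrow>
       M0 - L * c0 powr (1 - q / 2) \<le> w t x0"
    by (rule supersolution_above_barrier[OF q p_def]) blast
  define e where "e = p * (2 - q) / 2"
  \<comment> \<open>Chosen so that \<open>\<kappa>\<close> (2 \<open>\<alpha>\<close>
    \<open>\<rho>\<close>) powr q = \<open>\<alpha>\<close> / 2 for \<open>\<rho>\<close> = d
    \<open>\<kappa>\<close> powr (- 1 / q), as the plateau estimate allows.\<close>
  define d where "d = (\<alpha> / 2) powr (1 / q) / (2 * \<alpha>)"
  have d: "0 < d" using \<alpha>0 by (simp add: d_def)
  define c1 where "c1 = (1 / 2) powr (q / 2) * d powr e"
  have c1: "0 < c1" using d by (simp add: c1_def)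
  \<comment> \<open>The second summand makes c1 \<open>\<kappa>\<close> exceed \<open>L\<close>,
    strictly thanks to the 1. The third gives \<open>\<alpha>\<close> \<open>\<rho>\<close>^2 \<le>
    1 / 2, so that F is at least 1 / 2 on the ball.\<close>
  define \<kappa> where "\<kappa> = 1 + L / c1 + (2 * \<alpha> * d\<^sup>2) powr (q / 2)"
  have "0 < L / c1" using L c1 by simp
  then have \<kappa>: "0 < \<kappa>" "L / c1 < \<kappa>" "(2 * \<alpha> * d\<^sup>2) powr (q / 2) \<le> \<kappa>" by (auto simp: \<kappa>_def intro!: add_pos_nonneg)
  then have \<kappa>L: "L < c1 * \<kappa>" using c1 by (simp add: divide_less_eq mult.commute)
  define a where "a = \<kappa> powr (1 / (q - 1))"
  have a: "0 < a" "a powr (q - 1) = \<kappa>" using \<kappa> q by (auto simp: a_def powr_powr)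
  define \<rho> where "\<rho> = d * \<kappa> powr (- 1 / q)"
  have \<rho>: "0 < \<rho>" using d \<kappa> by (simp add: \<rho>_def)
  have \<rho>1: "\<kappa> * (2 * \<alpha> * \<rho>) powr q < \<alpha>"
  proof -
    have "(2 * \<alpha> * \<rho>) powr q = ((\<alpha> / 2) powr (1 / q) * \<kappa> powr (- 1 / q)) powr q"
      using \<alpha>0 by (simp add: \<rho>_def d_def)
    also have "\<dots> = \<alpha> / 2 * \<kappa> powr - 1" using \<alpha>0 \<kappa> q by (simp add: powr_mult powr_powr)
    finally have "\<kappa> * (2 * \<alpha> * \<rho>) powr q = \<alpha> / 2" using \<kappa>(1) by (simp add: powr_minus field_simps)
    then show ?thesis using \<alpha>0 by simp
  qed
  have \<rho>2: "\<alpha> * \<rho>\<^sup>2 \<le> 1 / 2"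
  proof -
    have "2 * \<alpha> * d\<^sup>2 = ((2 * \<alpha> * d\<^sup>2) powr (q / 2)) powr (2 / q)" using \<alpha>0 d q by (simp add: powr_powr)
    also have "\<dots> \<le> \<kappa> powr (2 / q)" using \<kappa> q by (intro powr_mono2) auto
    finally have "2 * \<alpha> * d\<^sup>2 * \<kappa> powr (- 2 / q) \<le> \<kappa> powr (2 / q) * \<kappa> powr (- 2 / q)"
      by (rule mult_right_mono) simp
    also have "\<dots> = 1" using \<kappa> by (simp add: powr_add[symmetric])
    also have "\<kappa> powr (- 2 / q) = (\<kappa> powr (- 1 / q))\<^sup>2" by (simp add: power2_eq_square powr_add[symmetric])
    finally show ?thesis by (simp add: \<rho>_def power_mult_distrib)
  qed
  show ?thesis
  proof (rule that[OF \<kappa>(1)])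
    fix F W
    show "\<not> is_positive_profile DIM('a) q \<alpha> \<kappa> F W"
    proof
      assume P: "is_positive_profile DIM('a) q \<alpha> \<kappa> F W"
      note PD = is_positive_profileD[OF P]
      let ?V = "self_similar_wave \<alpha> a F :: real \<Rightarrow> 'a \<Rightarrow> real"
      have n: "1 \<le> DIM('a)" by (simp add: DIM_ge_Suc0)
      have sol: "self_similar_solution q ?V" by (rule self_similar_solution_wave[OF P q(1) \<alpha> a])
      then have C: "C_2_1 ?V" by (simp add: self_similar_solution_def solves_VHJ_def)
      have eq: "deriv (\<lambda>s. ?V s x) t - laplacian (?V t) x + norm (grad (?V t) x) powr q = 0" if "0 < t" for t x
        using sol that by (simp add: self_similar_solution_def solves_VHJ_def)
      define w where "w t x = - ?V (1 + t) x" for t x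
      have "supersolution q w"
        unfolding supersolution_def
      proof (intro conjI exI allI impI ballI)
        show "0 \<le> w t x" for t x using PD(9) a by (simp add: w_def self_similar_wave_def less_imp_le)
        have "continuous_on ({0<..} \<times> UNIV) (\<lambda>(t, x). ?V t x)" using C by (simp add: C_2_1_def)
        then have "continuous_on ({0..} \<times> UNIV) (\<lambda>z. (\<lambda>(t, x). ?V t x) (1 + fst z, snd z))"
          by (rule continuous_on_compose2) (auto intro!: continuous_intros)
        then show "continuous_on ({0..} \<times> UNIV) (\<lambda>(t, x). w t x)"
          by (simp add: w_def split_beta continuous_on_minus)
        fix t :: real and x :: 'a assume t: "0 < t"
        then have t1: "0 < 1 + t" by simp
        have "((\<lambda>s. ?V (1 + s) x) has_real_derivative deriv (\<lambda>s. ?V s x) (1 + t)) (at t)"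
          using C_2_1_axis_derivs(1)[OF C t1, of x] DERIV_shift[of "\<lambda>s. ?V s x" _ t 1] by (simp add: add.commute)
        then show "((\<lambda>s. w s x) has_real_derivative - deriv (\<lambda>s. ?V s x) (1 + t)) (at t)"
          unfolding w_def by (rule DERIV_minus)
        show "axis_deriv (w t) (- partial_deriv b (?V (1 + t)) x) b x" if "b \<in> Basis" for b
          unfolding w_def by (rule DERIV_minus[OF C_2_1_axis_derivs(2)[OF C t1 that]])
        show "axis_deriv (\<lambda>x. - partial_deriv b (?V (1 + t)) x) (- partial_deriv b (partial_deriv b (?V (1 + t))) x) b x" if "b \<in> Basis" for b
          by (rule DERIV_minus[OF C_2_1_axis_derivs(3)[OF C t1 that]])
        show "(\<Sum>b\<in>Basis. - partial_deriv b (partial_deriv b (?V (1 + t))) x) + norm (\<Sum>b\<in>Basis. (- partial_deriv b (?V (1 + t)) x) *\<^sub>R b) powr q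
            \<le> - deriv (\<lambda>s. ?V s x) (1 + t)"
          using eq[OF t1, of x] by (simp add: sum_negf laplacian_def grad_def)
      qed
      define c0 where "c0 = a / 2 * \<rho> powr - p"
      have c0: "0 < c0" using a \<rho> by (simp add: c0_def)
      have init: "a / 2 - c0 * norm (x - 0) powr p \<le> w 0 x" for x
      proof (cases "norm x \<le> \<rho>")
        case True
        obtain M where M: "0 < M" "is_profile DIM('a) q \<alpha> M \<kappa> F W" using P by (auto simp: is_positive_profile_def)
        have "1 - \<alpha> * (norm x)\<^sup>2 \<le> F (norm x)"
          by (rule profile_initial_plateau[OF M(2) n q(1) \<alpha>0 _ M(1) PD(9) \<rho>1]) (use \<kappa> True in auto)
        moreover have "\<alpha> * (norm x)\<^sup>2 \<le> \<alpha> * \<rho>\<^sup>2" using True \<alpha>0 by (intro mult_left_mono power_mono) auto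
        ultimately have "1 / 2 \<le> F (norm x)" using \<rho>2 by linarith
        then have "a * (1 / 2) \<le> a * F (norm x)" using a by (intro mult_left_mono) auto
        moreover have "0 \<le> c0 * norm x powr p" using c0 by simp
        ultimately show ?thesis by (simp add: w_def self_similar_wave_def)
      next
        case False
        then have "\<rho> powr p \<le> norm x powr p" using \<rho> p2 by (intro powr_mono2) auto
        then have "c0 * \<rho> powr p \<le> c0 * norm x powr p" using c0 by (intro mult_left_mono) auto
        moreover have "c0 * \<rho> powr p = a / 2" using \<rho> by (simp add: c0_def powr_minus)
        moreover have "0 \<le> w 0 x" using PD(9) a by (simp add: w_def self_similar_wave_def less_imp_le)
        ultimately show ?thesis by simp
      qed
      define m where "m = a / 2 - L * c0 powr (1 - q / 2)"
      have low: "m \<le> w t 0" if "0 \<le> t" for t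
        unfolding m_def by (rule L(2)[OF \<open>supersolution q w\<close> c0 init that])
      have "0 < m"
      proof -
        have "e * (- 1 / q) = 1 - p / 2" using q by (simp add: e_def p_def field_simps)
        then have "\<rho> powr e = d powr e * \<kappa> powr (1 - p / 2)" using d \<kappa>
          powr_mult[of d "\<kappa> powr (- 1 / q)" e] powr_powr[of \<kappa> "- 1 / q" e] by (simp add: \<rho>_def)
        moreover have "1 / (q - 1) * (q / 2) = p / 2" using q by (simp add: p_def)
        then have "a powr (q / 2) = \<kappa> powr (p / 2)" unfolding a_def powr_powr by (simp only:)
        ultimately have "(a / 2) powr (q / 2) * \<rho> powr e = c1 * (\<kappa> powr (p / 2) * \<kappa> powr (1 - p / 2))"
          using a powr_mult[of a "1 / 2" "q / 2"] by (simp add: c1_def)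
        also have "\<kappa> powr (p / 2) * \<kappa> powr (1 - p / 2) = \<kappa>" using \<kappa> by (simp add: powr_add[symmetric])
        finally have big: "L < (a / 2) powr (q / 2) * \<rho> powr e" using \<kappa>L by simp
        have "- p * (1 - q / 2) = - e" by (simp add: e_def field_simps)
        then have "c0 powr (1 - q / 2) = (a / 2) powr (1 - q / 2) * \<rho> powr - e"
          using a \<rho> powr_mult[of "a / 2" "\<rho> powr - p" "1 - q / 2"] powr_powr[of \<rho> "- p" "1 - q / 2"] by (simp add: c0_def)
        then have "L * c0 powr (1 - q / 2) < ((a / 2) powr (q / 2) * \<rho> powr e) * ((a / 2) powr (1 - q / 2) * \<rho> powr - e)"
          using big a \<rho> by simp
        also have "\<dots> = ((a / 2) powr (q / 2) * (a / 2) powr (1 - q / 2)) * (\<rho> powr e * \<rho> powr - e)" by (simp only: mult_ac)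
        also have "\<dots> = a / 2" using a \<rho> by (simp add: powr_add[symmetric])
        finally show ?thesis by (simp add: m_def)
      qed
      \<comment> \<open>Late enough for a t powr - \<open>\<alpha>\<close> to equal m / 2, half of
        the lower bound that the barrier guarantees.\<close>
      define t where "t = (2 * a / m) powr (1 / \<alpha>)"
      have "m \<le> w t 0" by (rule low) (simp add: t_def)
      also have "w t 0 = a * (1 + t) powr - \<alpha>" using PD(3) by (simp add: w_def self_similar_wave_def)
      also have "\<dots> \<le> a * t powr - \<alpha>" using a \<alpha>0 \<open>0 < m\<close> by (intro mult_left_mono powr_mono2') (auto simp: t_def)
      also have "t powr - \<alpha> = inverse (2 * a / m)" using \<alpha>0 a \<open>0 < m\<close> by (simp add: t_def powr_powr powr_minus)
      also have "a * inverse (2 * a / m) = m / 2" using a by simp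
      finally show False using \<open>0 < m\<close> by simp
    qed
  qed
qed

section \<open>Lebesgue norms\<close>

lemma continuous_measurable_lebesgue:
  fixes f :: "'a::euclidean_space \<Rightarrow> 'b::topological_space"
  assumes "continuous_on UNIV f"
  shows "f \<in> borel_measurable lebesgue"
  using borel_measurable_continuous_onI[OF assms] by (simp add: measurable_completion)

lemma nn_integral_inverse_1_plus_square: "(\<integral>\<^sup>+x. ennreal (1 / (1 + x\<^sup>2)) \<partial>(lborel :: real measure)) < \<infinity>"
proof -
  have "einterval (-\<infinity>) \<infinity> = (UNIV :: real set)" by (auto simp: einterval_def)
  then have "integrable lborel (\<lambda>x::real. inverse (1 + x\<^sup>2))"
    using integrable_inverse_1_plus_square by (simp add: set_integrable_def)
  then have "(\<integral>\<^sup>+x. ennreal (norm (inverse (1 + x\<^sup>2))) \<partial>(lborel :: real measure)) < \<infinity>"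
    by (simp add: integrable_iff_bounded)
  then show ?thesis by (simp add: divide_inverse)
qed

text \<open>The n-th power of 1 + |x|^2 dominates the product of the factors 1 + (x . b)^2, so the
  integral is at most the n-th power of the one-dimensional arctangent integral.\<close>

lemma nn_integral_decay_finite:
  "(\<integral>\<^sup>+x. ennreal (1 / (1 + (norm x)\<^sup>2) ^ DIM('a)) \<partial>(lborel :: 'a::euclidean_space measure)) < \<infinity>"
proof -
  have "(\<integral>\<^sup>+x. ennreal (1 / (1 + (norm x)\<^sup>2) ^ DIM('a)) \<partial>(lborel :: 'a measure))
      \<le> (\<integral>\<^sup>+x. (\<Prod>b\<in>Basis. ennreal (1 / (1 + (x \<bullet> b)\<^sup>2))) \<partial>(lborel :: 'a measure))"
  proof (rule nn_integral_mono)
    fix x :: 'a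
    have "(\<Prod>b::'a\<in>Basis. 1 / (1 + (norm x)\<^sup>2)) \<le> (\<Prod>b\<in>Basis. 1 / (1 + (x \<bullet> b)\<^sup>2))"
    proof (rule prod_mono)
      fix b :: 'a assume "b \<in> Basis"
      then have "(x \<bullet> b)\<^sup>2 \<le> (norm x)\<^sup>2" using Basis_le_norm[of b x] by (simp add: power2_le_iff_abs_le)
      then show "0 \<le> 1 / (1 + (norm x)\<^sup>2) \<and> 1 / (1 + (norm x)\<^sup>2) \<le> 1 / (1 + (x \<bullet> b)\<^sup>2)"
        by (auto intro!: divide_left_mono mult_pos_pos add_pos_nonneg)
    qed
    then show "ennreal (1 / (1 + (norm x)\<^sup>2) ^ DIM('a)) \<le> (\<Prod>b\<in>Basis. ennreal (1 / (1 + (x \<bullet> b)\<^sup>2)))"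
      by (simp add: prod_ennreal power_one_over ennreal_leI)
  qed
  also have "\<dots> = (\<Prod>b::'a\<in>Basis. \<integral>\<^sup>+x. ennreal (1 / (1 + x\<^sup>2)) \<partial>(lborel :: real measure))"
    by (rule nn_integral_lborel_prod) auto
  also have "\<dots> < \<infinity>"
    using nn_integral_inverse_1_plus_square by (simp add: power_less_top_ennreal)
  finally show ?thesis .
qed

lemma Lp_space_decay:
  fixes f :: "'a::euclidean_space \<Rightarrow> 'b::euclidean_space"
  assumes f: "continuous_on UNIV f" and B: "0 < B" and s: "0 < s"
    and bound: "\<And>x. norm (f x) \<le> B / (1 + (norm (s *\<^sub>R x))\<^sup>2) ^ DIM('a)" and p: "1 \<le> p"
  shows "f \<in> Lp_space p"
proof -
  have meas: "f \<in> borel_measurable lebesgue" by (rule continuous_measurable_lebesgue[OF f])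
  have one: "(1 + (norm (s *\<^sub>R x))\<^sup>2) ^ DIM('a) \<ge> 1" for x :: 'a by (rule one_le_power) simp
  have fB: "norm (f x) \<le> B" for x
  proof -
    have "B / (1 + (norm (s *\<^sub>R x))\<^sup>2) ^ DIM('a) \<le> B / 1" using B one[of x] less_le_trans[OF zero_less_one one[of x]]
      by (intro divide_left_mono) (auto simp del: norm_scaleR)
    with bound[of x] show ?thesis by simp
  qed
  have "Lp_norm p f < \<infinity>"
  proof (cases "p = \<infinity>")
    case True
    have "esssup lebesgue (\<lambda>x. ennreal (norm (f x))) \<le> ennreal B"
      using meas fB by (intro esssup_I) (auto intro: ennreal_leI)
    then show ?thesis using True by (auto simp: Lp_norm_def intro: le_less_trans)
  next
    case False
    define P where "P = enn2real p"
    have P: "1 \<le> P" using p False by (cases p) (auto simp: P_def)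
    \<comment> \<open>\<open>m\<close> compares the dilated weight with the fixed one: m (1 + |x|^2)
      \<le> 1 + |s x|^2.\<close>
    define m where "m = min 1 (s\<^sup>2)"
    have m: "0 < m" "m \<le> 1" "m \<le> s\<^sup>2" using s by (auto simp: m_def)
    define c where "c = B powr P / m ^ DIM('a)"
    have c: "0 \<le> c" using m by (simp add: c_def)
    have le: "norm (f x) powr P \<le> c * (1 / (1 + (norm x)\<^sup>2) ^ DIM('a))" for x
    proof -
      define d where "d = (1 + (norm (s *\<^sub>R x))\<^sup>2) ^ DIM('a)"
      have d: "1 \<le> d" unfolding d_def by (rule one)
      have "norm (f x) powr P \<le> (B / d) powr P" using bound[of x, folded d_def] P by (intro powr_mono2) auto
      also have "\<dots> = B powr P * (1 / d) powr P"
        using B d powr_mult[of B "1 / d" P] by simp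
      \<comment> \<open>Since d and P are at least 1, a larger exponent only helps, and
        integrability of the weight itself is enough for every finite exponent.\<close>
      also have "(1 / d) powr P \<le> (1 / d) powr 1" using P d by (intro powr_mono') auto
      also have "(1 / d) powr 1 = 1 / d" using d by simp
      also have "1 / d \<le> 1 / (m * (1 + (norm x)\<^sup>2)) ^ DIM('a)"
        unfolding d_def
      proof (intro divide_left_mono power_mono mult_pos_pos zero_less_power)
        have "m * (norm x)\<^sup>2 \<le> s\<^sup>2 * (norm x)\<^sup>2" using m by (intro mult_right_mono) auto
        then show "m * (1 + (norm x)\<^sup>2) \<le> 1 + (norm (s *\<^sub>R x))\<^sup>2" using m by (simp add: power_mult_distrib algebra_simps)
      qed (use m in \<open>auto intro!: add_pos_nonneg mult_pos_pos\<close>)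
      finally show ?thesis by (simp add: c_def power_mult_distrib mult_left_mono)
    qed
    have "(\<integral>\<^sup>+x. ennreal (norm (f x) powr P) \<partial>lebesgue) \<le> (\<integral>\<^sup>+x. ennreal c * ennreal (1 / (1 + (norm x)\<^sup>2) ^ DIM('a)) \<partial>(lebesgue :: 'a measure))"
      using le c by (intro nn_integral_mono) (simp add: ennreal_mult'[symmetric] ennreal_leI)
    also have "\<dots> = ennreal c * (\<integral>\<^sup>+x. ennreal (1 / (1 + (norm x)\<^sup>2) ^ DIM('a)) \<partial>(lborel :: 'a measure))"
      unfolding nn_integral_completion by (rule nn_integral_cmult) simp
    also have "\<dots> < \<infinity>" using nn_integral_decay_finite[where 'a = 'a] by (simp add: ennreal_mult_less_top)
    finally show ?thesis using False by (simp add: Lp_norm_def P_def Let_def)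
  qed
  then show ?thesis using meas by (simp add: Lp_space_def)
qed

text \<open>The cube has volume r^n and keeps a distance of order r from the origin, where the
  gradient of the wave vanishes.\<close>

lemma Lp_norm_cbox_lower_bound:
  fixes f :: "'a::euclidean_space \<Rightarrow> 'b::real_normed_vector"
  assumes f: "f \<in> Lp_space p" and p: "1 \<le> p" and v: "0 \<le> v" and r: "0 < r"
    and low: "\<And>x. x \<in> cbox (r *\<^sub>R One) ((2 * r) *\<^sub>R One) \<Longrightarrow> v \<le> norm (f x)"
  shows "ennreal (v * r powr (DIM('a) * enn2real (1 / p))) \<le> Lp_norm p f"
proof -
  define Q where "Q = cbox (r *\<^sub>R One) ((2 * r) *\<^sub>R (One::'a))"
  have Q: "emeasure lebesgue Q = ennreal (r ^ DIM('a))"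
  proof -
    have "emeasure lborel Q = ennreal (\<Prod>b::'a\<in>Basis. ((2 * r) *\<^sub>R One - r *\<^sub>R One) \<bullet> b)"
      unfolding Q_def using r by (intro emeasure_lborel_cbox) auto
    also have "(\<Prod>b::'a\<in>Basis. ((2 * r) *\<^sub>R One - r *\<^sub>R One) \<bullet> b) = (\<Prod>b::'a\<in>Basis. r)"
      by (intro prod.cong refl) (simp add: inner_diff_left)
    finally show ?thesis by (simp add: Q_def)
  qed
  have Qs: "Q \<in> sets lebesgue" by (simp add: Q_def)
  have meas: "f \<in> borel_measurable lebesgue" and fin: "Lp_norm p f < \<infinity>" using f by (auto simp: Lp_space_def)
  show ?thesis
  proof (cases "p = \<infinity>")
    case True
    have "ennreal v \<le> esssup lebesgue (\<lambda>x. ennreal (norm (f x)))"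
    proof (rule ccontr)
      assume "\<not> ?thesis"
      then have "esssup lebesgue (\<lambda>x. ennreal (norm (f x))) < ennreal v" by simp
      then have "Q \<subseteq> {x \<in> space lebesgue. esssup lebesgue (\<lambda>x. ennreal (norm (f x))) < ennreal (norm (f x))}"
      proof (intro subsetI CollectI conjI)
        fix x assume "x \<in> Q"
        then have "ennreal v \<le> ennreal (norm (f x))" using low by (auto simp: Q_def intro: ennreal_leI)
        with \<open>esssup lebesgue (\<lambda>x. ennreal (norm (f x))) < ennreal v\<close>
        show "esssup lebesgue (\<lambda>x. ennreal (norm (f x))) < ennreal (norm (f x))" by (rule less_le_trans)
      qed simp
      then have "emeasure lebesgue Q \<le> emeasure lebesgue {x \<in> space lebesgue. esssup lebesgue (\<lambda>x. ennreal (norm (f x))) < ennreal (norm (f x))}"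
        by (rule emeasure_mono) (use meas in measurable)
      also have "\<dots> = 0" by (rule esssup_zero_measure)
      finally show False using Q r by simp
    qed
    then show ?thesis using True r by (simp add: Lp_norm_def)
  next
    case False
    define P where "P = enn2real p"
    have pP: "p = ennreal P" using False by (cases p) (auto simp: P_def)
    have "ennreal 1 \<le> ennreal P" using p unfolding pP by simp
    moreover have "0 \<le> P" by (simp add: P_def)
    ultimately have P: "1 \<le> P" by (simp only: ennreal_le_iff)
    have ip: "enn2real (1 / p) = 1 / P"
      using P divide_ennreal[of 1 P] by (simp add: pP)
    define I where "I = (\<integral>\<^sup>+x. ennreal (norm (f x) powr P) \<partial>lebesgue)"
    have Ifin: "I \<noteq> \<infinity>" using fin False by (auto simp: Lp_norm_def Let_def I_def P_def split: if_splits)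
    have N: "Lp_norm p f = ennreal (enn2real I powr (1 / P))"
      using False Ifin unfolding Lp_norm_def ip[symmetric] by (simp add: Let_def I_def P_def)
    have "ennreal (v powr P * r ^ DIM('a)) = (\<integral>\<^sup>+x. ennreal (v powr P) * indicator Q x \<partial>lebesgue)"
      using Qs Q r by (simp add: nn_integral_cmult_indicator ennreal_mult)
    also have "\<dots> \<le> I" unfolding I_def
    proof (rule nn_integral_mono)
      fix x
      show "ennreal (v powr P) * indicator Q x \<le> ennreal (norm (f x) powr P)"
      proof (cases "x \<in> Q")
        case True
        then have "v \<le> norm (f x)" using low by (simp add: Q_def)
        then have "v powr P \<le> norm (f x) powr P" using v P by (intro powr_mono2) auto
        then show ?thesis using True by (simp add: ennreal_leI)
      qed simp
    qed
    finally have "enn2real (ennreal (v powr P * r ^ DIM('a))) \<le> enn2real I"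
      using Ifin by (intro enn2real_mono) (auto simp: less_top)
    then have "v powr P * r ^ DIM('a) \<le> enn2real I" using r by simp
    then have "(v powr P * r ^ DIM('a)) powr (1 / P) \<le> enn2real I powr (1 / P)"
      using P r by (intro powr_mono2) auto
    moreover have "(v powr P * r ^ DIM('a)) powr (1 / P) = v * r powr (DIM('a) * (1 / P))"
    proof -
      have "r ^ DIM('a) = r powr DIM('a)" using r by (simp add: powr_realpow)
      then have "(v powr P * r ^ DIM('a)) powr (1 / P) = (v powr P) powr (1 / P) * (r powr DIM('a)) powr (1 / P)"
        using v r by (simp only: powr_mult powr_ge_zero)
      then show ?thesis using v P by (simp only: powr_powr) simp
    qed
    ultimately show ?thesis unfolding N ip by (auto intro: ennreal_leI)
  qed
qed

section \<open>Divergence of the weighted norms and conclusion of a)\<close>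

lemma powr_at_top_at_top: "0 < e \<Longrightarrow> filterlim (\<lambda>t::real. t powr e) at_top at_top"
proof -
  assume e: "0 < e"
  have "filterlim (\<lambda>t. exp (e * ln t)) at_top at_top"
    by (intro filterlim_compose[OF exp_at_top] filterlim_tendsto_pos_mult_at_top[OF tendsto_const e] ln_at_top)
  then show ?thesis
    by (rule filterlim_cong[THEN iffD1, rotated -1])
       (auto simp: powr_def mult.commute intro!: eventually_mono[OF eventually_gt_at_top[of 0]])
qed

text \<open>The points with x / sqrt t in the fixed cube fill a cube of volume t powr (n / 2),
  contributing t powr (n / (2 p)) to the norm. This cancels the dependence of the weight on p and
  leaves t powr (n / 2 + \<open>\<delta>\<close> - \<open>\<beta>\<close>) for every
  exponent.\<close>

lemma weighted_Lp_norm_diverges: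
  fixes f :: "real \<Rightarrow> 'a::euclidean_space \<Rightarrow> 'b::real_normed_vector"
  assumes f: "\<And>t. 0 < t \<Longrightarrow> f t \<in> Lp_space p" and p: "1 \<le> p" and c: "0 < c"
    and low: "\<And>t x. 0 < t \<Longrightarrow> t powr (- 1 / 2) *\<^sub>R x \<in> cbox One (2 *\<^sub>R One) \<Longrightarrow> c * t powr - \<beta> \<le> norm (f t x)"
    and e: "\<beta> < DIM('a) / 2 + \<delta>"
  shows "((\<lambda>t. ennreal (t powr (DIM('a) / 2 * (1 - enn2real (1 / p)) + \<delta>)) * Lp_norm p (f t)) \<longlongrightarrow> \<infinity>) at_top"
proof -
  let ?i = "enn2real (1 / p)"
  have "filterlim (\<lambda>t. c * t powr (DIM('a) / 2 + \<delta> - \<beta>)) at_top at_top"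
    by (intro filterlim_tendsto_pos_mult_at_top[OF tendsto_const c] powr_at_top_at_top) (use e in simp)
  then have "((\<lambda>t. ennreal (c * t powr (DIM('a) / 2 + \<delta> - \<beta>))) \<longlongrightarrow> \<infinity>) at_top"
    by (simp add: ennreal_tendsto_top_eq_at_top)
  then show ?thesis
  proof (rule tendsto_sandwich[OF _ _ _ tendsto_const, rotated 2])
    show "\<forall>\<^sub>F t in at_top. ennreal (t powr (DIM('a) / 2 * (1 - ?i) + \<delta>)) * Lp_norm p (f t) \<le> \<infinity>" by simp
    show "\<forall>\<^sub>F t in at_top. ennreal (c * t powr (DIM('a) / 2 + \<delta> - \<beta>)) \<le> ennreal (t powr (DIM('a) / 2 * (1 - ?i) + \<delta>)) * Lp_norm p (f t)"
      using eventually_gt_at_top[of "0::real"]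
    proof eventually_elim
      case (elim t)
      have "ennreal (c * t powr - \<beta> * sqrt t powr (DIM('a) * ?i)) \<le> Lp_norm p (f t)"
      proof (rule Lp_norm_cbox_lower_bound[OF f[OF elim] p])
        fix x :: 'a assume x: "x \<in> cbox (sqrt t *\<^sub>R One) ((2 * sqrt t) *\<^sub>R One)"
        have s: "t powr - (1 / 2) = 1 / sqrt t" using elim by (simp add: powr_minus_divide powr_half_sqrt)
        show "c * t powr - \<beta> \<le> norm (f t x)"
          by (rule low[OF elim]) (use x elim in \<open>auto simp: mem_box s field_simps\<close>)
      qed (use c elim in auto)
      then have "ennreal (t powr (DIM('a) / 2 * (1 - ?i) + \<delta>)) * ennreal (c * t powr - \<beta> * sqrt t powr (DIM('a) * ?i))
          \<le> ennreal (t powr (DIM('a) / 2 * (1 - ?i) + \<delta>)) * Lp_norm p (f t)"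
        by (rule mult_left_mono) simp
      moreover have "ennreal (t powr (DIM('a) / 2 * (1 - ?i) + \<delta>)) * ennreal (c * t powr - \<beta> * sqrt t powr (DIM('a) * ?i))
         = ennreal (c * t powr (DIM('a) / 2 + \<delta> - \<beta>))"
      proof -
        have "sqrt t powr (DIM('a) * ?i) = t powr (1 / 2 * (DIM('a) * ?i))"
          using elim powr_powr[of t "1 / 2" "DIM('a) * ?i"] by (simp add: powr_half_sqrt)
        then have "t powr (DIM('a) / 2 * (1 - ?i) + \<delta>) * (c * t powr - \<beta> * sqrt t powr (DIM('a) * ?i))
            = c * (t powr (DIM('a) / 2 * (1 - ?i) + \<delta>) * t powr - \<beta> * t powr (1 / 2 * (DIM('a) * ?i)))"
          by (simp only: mult_ac)
        also have "t powr (DIM('a) / 2 * (1 - ?i) + \<delta>) * t powr - \<beta> * t powr (1 / 2 * (DIM('a) * ?i))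
            = t powr (DIM('a) / 2 * (1 - ?i) + \<delta> + - \<beta> + 1 / 2 * (DIM('a) * ?i))"
          by (simp only: powr_add)
        also have "DIM('a) / 2 * (1 - ?i) + \<delta> + - \<beta> + 1 / 2 * (DIM('a) * ?i) = DIM('a) / 2 + \<delta> - \<beta>"
          by (simp add: field_simps)
        finally show ?thesis using c by (simp add: ennreal_mult[symmetric])
      qed
      ultimately show ?case by simp
    qed
  qed
qed

lemma self_similar_part:
  assumes qc: "(real DIM('a::euclidean_space) + 2) / (real DIM('a) + 1) < q" and q2: "q < 2"
  shows "\<exists>V :: real \<Rightarrow> 'a \<Rightarrow> real. self_similar_solution q V \<and> (\<forall>t>0. \<forall>x. V t x \<le> 0) \<and>
        (\<forall>p::ennreal. 1 \<le> p \<longrightarrow>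
           (\<forall>t>0. V t \<in> Lp_space p \<and> grad (V t) \<in> Lp_space p) \<and>
           ((\<lambda>t. ennreal (t powr (real DIM('a) / 2 * (1 - enn2real (1 / p)))) * Lp_norm p (V t)) \<longlongrightarrow> \<infinity>) at_top \<and>
           ((\<lambda>t. ennreal (t powr (real DIM('a) / 2 * (1 - enn2real (1 / p)) + 1 / 2)) * Lp_norm p (grad (V t))) \<longlongrightarrow> \<infinity>) at_top)"
proof -
  define n where "n = DIM('a)"
  have n: "1 \<le> n" by (simp add: n_def DIM_ge_Suc0)
  have qn: "real n + 2 < q * (real n + 1)" using qc by (simp add: n_def divide_less_eq)
  have q1: "1 < q"
  proof -
    have "1 < (real n + 2) / (real n + 1)" by (simp add: less_divide_eq)
    then show ?thesis using qc unfolding n_def by (rule less_trans)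
  qed
  define \<alpha> where "\<alpha> = (2 - q) / (2 * (q - 1))"
  have \<alpha>: "0 < \<alpha>" "\<alpha> < real n / 2" using q1 q2 qn by (auto simp: \<alpha>_def field_simps)
  obtain \<kappa>1 where \<kappa>1: "0 < \<kappa>1" "\<And>F W. \<not> is_positive_profile n q \<alpha> \<kappa>1 F W"
    using profile_cannot_stay_positive[OF q1 q2 \<alpha>_def, where 'a = 'a] unfolding n_def by blast
  \<comment> \<open>The truncation level is the slope bound for the largest coupling, so that one
    level serves all couplings in [0, \<open>\<kappa>1\<close>] and is never reached from above by a
    positive profile.\<close>
  define M where "M = (1 + (2 - q) * (\<alpha> + \<kappa>1)) powr (1 / (2 - q))"
  have "0 < 1 + (2 - q) * (\<alpha> + \<kappa>1)" using q2 \<alpha> \<kappa>1 by (intro add_pos_nonneg) auto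
  then have M: "0 < M" by (simp add: M_def)
  have slope: "0 \<le> W r \<and> W r \<le> M" if "is_profile n q \<alpha> M \<kappa> F W" "0 \<le> \<kappa>" "\<kappa> \<le> \<kappa>1" "\<And>r. 0 \<le> r \<Longrightarrow> 0 < F r" "0 \<le> r" for \<kappa> F W r
    using profile_slope_bound[OF that(1) q1 q2 \<alpha>(1) that(2,3) M_def that(5)] that(4) by auto
  \<comment> \<open>The rate 2 n + 1 is admissible for the slow-decay trap, and fast enough to put F
    and W below a multiple of the integrable weight.\<close>
  have Z: "2 * \<alpha> < 2 * real n + 1" using \<alpha> n by simp
  have crossing: "\<exists>r\<ge>0. F r \<le> 0" if pr: "is_profile n q \<alpha> M \<kappa>1 F W" for F W
  proof (rule ccontr)
    assume "\<not> ?thesis"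
    then have pos: "\<And>r. 0 \<le> r \<Longrightarrow> 0 < F r" by force
    then have "is_positive_profile n q \<alpha> \<kappa>1 F W"
      unfolding is_positive_profile_def using pr M slope[OF pr] \<kappa>1 by auto
    then show False using \<kappa>1 by blast
  qed
  obtain \<kappa> F W R where \<kappa>: "0 < \<kappa>" "\<kappa> \<le> \<kappa>1" and pr: "is_profile n q \<alpha> M \<kappa> F W" and pos: "\<And>r. 0 \<le> r \<Longrightarrow> 0 < F r"
    and R: "1 \<le> R" "\<And>r. R \<le> r \<Longrightarrow> (2 * real n + 1) * F r \<le> r * W r"
    by (rule fast_profile_exists[OF n q1 q2 \<alpha> Z less_imp_le[OF \<kappa>1(1)] M], erule crossing) blast
  have W: "0 \<le> W r" "W r \<le> M" if "0 \<le> r" for r using slope[OF pr _ \<kappa>(2) pos that] \<kappa>(1) by auto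
  have P: "is_positive_profile n q \<alpha> \<kappa> F W"
    unfolding is_positive_profile_def using pr M pos W by blast
  note PD = is_positive_profileD[OF P]
  obtain C where C: "0 < C" "\<And>r. 0 \<le> r \<Longrightarrow> F r \<le> C / (1 + r\<^sup>2) ^ n" "\<And>r. 0 \<le> r \<Longrightarrow> W r \<le> C / (1 + r\<^sup>2) ^ n"
    by (rule fast_profile_decay[OF pr n q1 \<alpha>(1) less_imp_le[OF \<kappa>(1)] M pos W R]) auto
  define a where "a = \<kappa> powr (1 / (q - 1))"
  have a: "0 < a" "a powr (q - 1) = \<kappa>" using \<kappa> q1 by (auto simp: a_def powr_powr)
  define V where "V = (self_similar_wave \<alpha> a F :: real \<Rightarrow> 'a \<Rightarrow> real)"
  have sol: "self_similar_solution q V" unfolding V_def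
    by (rule self_similar_solution_wave[OF P[unfolded n_def] q1 \<alpha>_def a])
  have norm_V: "norm (V t x) = a * t powr - \<alpha> * F (norm (t powr (- 1 / 2) *\<^sub>R x))" for t x
    using a PD(9)[of "norm (t powr (- 1 / 2) *\<^sub>R x)"] by (simp add: V_def self_similar_wave_def abs_mult)
  have norm_gV: "norm (grad (V t) x) = a * t powr (- \<alpha> - 1 / 2) * W (norm (t powr (- 1 / 2) *\<^sub>R x))" if "0 < t" for t x
    unfolding V_def by (rule norm_grad_self_similar_wave[OF P that a(1)])
  have Vc: "continuous_on UNIV (V t)" if "0 < t" for t
    unfolding V_def
    by (intro continuous_at_imp_continuous_on ballI has_derivative_continuous[OF self_similar_wave_derivative[OF P that]])
  have gVc: "continuous_on UNIV (grad (V t))" if t: "0 < t" for t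
  proof -
    have "continuous_on UNIV (partial_deriv b (V t))" if "b \<in> Basis" for b
      unfolding V_def
      by (intro continuous_at_imp_continuous_on ballI has_derivative_continuous[OF self_similar_wave_second_derivative[OF P t n that]])
    then show ?thesis unfolding grad_def[abs_def] by (intro continuous_intros) auto
  qed
  have VL: "V t \<in> Lp_space p" if "0 < t" "1 \<le> p" for t p
  proof (rule Lp_space_decay[OF Vc[OF that(1)] _ _ _ that(2), of "a * t powr - \<alpha> * C" "t powr (- 1 / 2)"])
    show "norm (V t x) \<le> a * t powr - \<alpha> * C / (1 + (norm (t powr (- 1 / 2) *\<^sub>R x))\<^sup>2) ^ DIM('a)" for x
      unfolding norm_V times_divide_eq_right[symmetric] using a C(2)[of "norm (t powr (- 1 / 2) *\<^sub>R x)"]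
      by (intro mult_left_mono) (auto simp: n_def)
  qed (use a C that in auto)
  have gVL: "grad (V t) \<in> Lp_space p" if "0 < t" "1 \<le> p" for t p
  proof (rule Lp_space_decay[OF gVc[OF that(1)] _ _ _ that(2), of "a * t powr (- \<alpha> - 1 / 2) * C" "t powr (- 1 / 2)"])
    show "norm (grad (V t) x) \<le> a * t powr (- \<alpha> - 1 / 2) * C / (1 + (norm (t powr (- 1 / 2) *\<^sub>R x))\<^sup>2) ^ DIM('a)" for x
      unfolding norm_gV[OF that(1)] times_divide_eq_right[symmetric] using a C(3)[of "norm (t powr (- 1 / 2) *\<^sub>R x)"]
      by (intro mult_left_mono) (auto simp: n_def)
  qed (use a C that in auto)
  \<comment> \<open>A compact cube that avoids the origin, because W(0) = 0 rules out a positive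
    lower bound for the gradient near it.\<close>
  let ?Q = "cbox One (2 *\<^sub>R (One::'a))"
  have Q: "compact ?Q" "?Q \<noteq> {}" by (auto simp: box_ne_empty)
  have Q0: "x \<noteq> 0" if "x \<in> ?Q" for x
  proof
    assume "x = 0"
    obtain b :: 'a where "b \<in> Basis" using nonempty_Basis by blast
    then show False using that \<open>x = 0\<close> by (auto simp: mem_box)
  qed
  have low: "\<exists>c>0. \<forall>x\<in>?Q. c \<le> G (norm x)" if Gc: "continuous_on UNIV (\<lambda>x::'a. G (norm x))" and G0: "\<And>r. 0 < r \<Longrightarrow> 0 < G r" for G :: "real \<Rightarrow> real"
  proof -
    obtain z where z: "z \<in> ?Q" "\<And>x. x \<in> ?Q \<Longrightarrow> G (norm z) \<le> G (norm x)"
      using continuous_attains_inf[OF Q continuous_on_subset[OF Gc subset_UNIV]] by auto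
    then show ?thesis using G0[of "norm z"] Q0[OF z(1)] by (intro exI[of _ "G (norm z)"]) auto
  qed
  obtain cF where cF: "0 < cF" "\<And>x. x \<in> ?Q \<Longrightarrow> cF \<le> F (norm x)"
    using low[OF profile_norm_continuous(1)[OF P]] PD(9) by auto
  obtain cW where cW: "0 < cW" "\<And>x. x \<in> ?Q \<Longrightarrow> cW \<le> W (norm x)"
    using low[OF profile_norm_continuous(2)[OF P]] PD(11) by auto
  have "((\<lambda>t. ennreal (t powr (real DIM('a) / 2 * (1 - enn2real (1 / p)) + 0)) * Lp_norm p (V t)) \<longlongrightarrow> \<infinity>) at_top" if p: "1 \<le> p" for p
  proof (rule weighted_Lp_norm_diverges[OF VL[OF _ p] p, where c = "a * cF" and \<beta> = \<alpha>])
    show "a * cF * t powr - \<alpha> \<le> norm (V t x)" if "0 < t" "t powr (- 1 / 2) *\<^sub>R x \<in> ?Q" for t x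
      unfolding norm_V using mult_left_mono[OF cF(2)[OF that(2)], of "a * t powr - \<alpha>"] a by (simp add: mult_ac)
  qed (use a cF \<alpha> in \<open>auto simp: n_def\<close>)
  moreover have "((\<lambda>t. ennreal (t powr (real DIM('a) / 2 * (1 - enn2real (1 / p)) + 1 / 2)) * Lp_norm p (grad (V t))) \<longlongrightarrow> \<infinity>) at_top" if p: "1 \<le> p" for p
  proof (rule weighted_Lp_norm_diverges[OF gVL[OF _ p] p, where c = "a * cW" and \<beta> = "\<alpha> + 1 / 2"])
    show "a * cW * t powr - (\<alpha> + 1 / 2) \<le> norm (grad (V t) x)" if "0 < t" "t powr (- 1 / 2) *\<^sub>R x \<in> ?Q" for t x
    proof -
      have "- (\<alpha> + 1 / 2) = - \<alpha> - 1 / 2" by simp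
      then show ?thesis unfolding norm_gV[OF that(1)]
        using mult_left_mono[OF cW(2)[OF that(2)], of "a * t powr (- \<alpha> - 1 / 2)"] a by (simp add: mult_ac)
    qed
  qed (use a cW \<alpha> in \<open>auto simp: n_def\<close>)
  moreover have "V t x \<le> 0" for t x
    using a PD(9)[of "norm (t powr (- 1 / 2) *\<^sub>R x)"] by (simp add: V_def self_similar_wave_def less_imp_le)
  ultimately show ?thesis using sol VL gVL by (intro exI[of _ V]) simp
qed

section \<open>Bump functions and the weak Laplacian\<close>

text \<open>The case j = 0 is the usual smooth cut-off, as a function of the squared radius; the
  index j makes the family closed under differentiation up to linear combinations.\<close>

definition bump :: "nat \<Rightarrow> real \<Rightarrow> real" where
  "bump j s = (if s < 1 then exp (- 1 / (1 - s)) / (1 - s) ^ j else 0)"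

lemma power_over_fact_le_exp:
  assumes "0 \<le> (x::real)"
  shows "x ^ n / fact n \<le> exp x"
proof -
  have s: "summable (\<lambda>k. x ^ k /\<^sub>R fact k)" by (rule summable_exp_generic)
  have "(\<Sum>k\<in>{n}. x ^ k /\<^sub>R fact k) \<le> (\<Sum>k. x ^ k /\<^sub>R fact k)"
    by (rule sum_le_suminf[OF s]) (use assms in auto)
  then show ?thesis by (simp add: exp_def divide_inverse mult.commute)
qed

text \<open>Compare exp (1 / (1 - s)) with the term of order j + 2 of its series. Quadratic
  vanishing at s = 1 makes every bump differentiable across that point, with derivative 0.\<close>

lemma bump_bounds:
  "0 \<le> bump j s" "\<bar>bump j s\<bar> \<le> fact (j + 2) * (1 - s)\<^sup>2"
proof -
  show "0 \<le> bump j s" by (simp add: bump_def)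
  show "\<bar>bump j s\<bar> \<le> fact (j + 2) * (1 - s)\<^sup>2"
  proof (cases "s < 1")
    case True
    define y where "y = 1 - s"
    have y: "0 < y" using True by (simp add: y_def)
    have "(1 / y) ^ (j + 2) / fact (j + 2) \<le> exp (1 / y)" by (rule power_over_fact_le_exp) (use y in simp)
    then have "1 \<le> exp (1 / y) * (fact (j + 2) * y ^ (j + 2))"
      using y by (simp add: power_divide divide_le_eq mult_ac)
    then have "exp (- (1 / y)) * 1 \<le> exp (- (1 / y)) * (exp (1 / y) * (fact (j + 2) * y ^ (j + 2)))"
      by (rule mult_left_mono) simp
    then have "exp (- (1 / y)) \<le> fact (j + 2) * y ^ (j + 2)"
      by (simp add: mult.assoc[symmetric] exp_add[symmetric])
    then have "exp (- (1 / y)) / y ^ j \<le> fact (j + 2) * y\<^sup>2"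
      using y by (simp add: divide_le_eq power_add power2_eq_square mult_ac)
    then show ?thesis using True y by (simp add: bump_def y_def)
  qed (simp add: bump_def)
qed

lemma bump_derivative:
  "(bump j has_real_derivative real j * bump (j + 1) s - bump (j + 2) s) (at s)"
proof -
  consider "s < 1" | "s > 1" | "s = 1" by linarith
  then show ?thesis
  proof cases
    case 1
    define e where "e = exp (- 1 / (1 - s))"
    have "((\<lambda>s. exp (- 1 / (1 - s))) has_real_derivative e * (- 1 / (1 - s)\<^sup>2)) (at s)"
      using 1 by (auto intro!: derivative_eq_intros simp: e_def power2_eq_square)
    moreover have "((\<lambda>s. (1 - s) ^ j) has_real_derivative - (real j * (1 - s) ^ (j - 1))) (at s)"
      by (auto intro!: derivative_eq_intros)
    ultimately have "((\<lambda>s. exp (- 1 / (1 - s)) / (1 - s) ^ j) has_real_derivative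
       (e * (- 1 / (1 - s)\<^sup>2) * (1 - s) ^ j - e * (- (real j * (1 - s) ^ (j - 1)))) / ((1 - s) ^ j * (1 - s) ^ j)) (at s)"
      unfolding e_def by (rule DERIV_divide) (use 1 in simp)
    moreover have "(e * (- 1 / (1 - s)\<^sup>2) * (1 - s) ^ j - e * (- (real j * (1 - s) ^ (j - 1)))) / ((1 - s) ^ j * (1 - s) ^ j)
       = real j * bump (j + 1) s - bump (j + 2) s"
    proof -
      have m: "real j * (1 - s) ^ (j - 1) = real j * (1 - s) ^ j / (1 - s)" using 1 by (cases j) auto
      have "(e * (- 1 / y\<^sup>2) * z - e * (- (c * z / y))) / (z * z) = c * (e / (z * y)) - e / (z * y\<^sup>2)"
        if "y \<noteq> 0" "z \<noteq> 0" for c y z :: real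
        using that by (simp add: field_simps power2_eq_square)
      from this[of "1 - s" "(1 - s) ^ j" "real j"]
      have "(e * (- 1 / (1 - s)\<^sup>2) * (1 - s) ^ j - e * (- (real j * (1 - s) ^ j / (1 - s)))) / ((1 - s) ^ j * (1 - s) ^ j)
         = real j * (e / (1 - s) ^ (j + 1)) - e / (1 - s) ^ (j + 2)"
        using 1 by (simp add: power_add power2_eq_square mult.commute)
      then show ?thesis using 1 unfolding m by (simp add: bump_def e_def)
    qed
    ultimately have "((\<lambda>s. exp (- 1 / (1 - s)) / (1 - s) ^ j) has_real_derivative real j * bump (j + 1) s - bump (j + 2) s) (at s)" by simp
    then show ?thesis
      by (rule has_field_derivative_transform_within_open[where S = "{..<1}"]) (use 1 in \<open>auto simp: bump_def\<close>)
  next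
    case 2
    have "((\<lambda>s. 0) has_real_derivative 0) (at s)" by simp
    then have "(bump j has_real_derivative 0) (at s)"
      by (rule has_field_derivative_transform_within_open[where S = "{1<..}"]) (use 2 in \<open>auto simp: bump_def\<close>)
    then show ?thesis using 2 by (simp add: bump_def)
  next
    case 3
    have "((\<lambda>x::real. fact (j + 2) * \<bar>x - 1\<bar>) \<longlongrightarrow> fact (j + 2) * \<bar>1 - 1\<bar>) (at 1)" by (intro tendsto_intros)
    then have "((\<lambda>x::real. fact (j + 2) * \<bar>x - 1\<bar>) \<longlongrightarrow> 0) (at 1)" by simp
    moreover have "\<forall>\<^sub>F x in at 1. norm ((bump j x - bump j 1) / (x - 1)) \<le> fact (j + 2) * \<bar>x - 1\<bar>"
    proof (rule always_eventually, rule allI)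
      fix x :: real
      have "(1 - x)\<^sup>2 = \<bar>x - 1\<bar> * \<bar>x - 1\<bar>" by (simp add: power2_eq_square abs_mult_self_eq algebra_simps)
      then show "norm ((bump j x - bump j 1) / (x - 1)) \<le> fact (j + 2) * \<bar>x - 1\<bar>"
        using bump_bounds(2)[of j x] by (cases "x = 1") (simp_all add: bump_def[of j 1] divide_le_eq mult.assoc)
    qed
    ultimately have "((\<lambda>x. (bump j x - bump j 1) / (x - 1)) \<longlongrightarrow> 0) (at 1)"
      by (rule Lim_null_comparison[rotated])
    then have "(bump j has_real_derivative 0) (at 1)" by (simp add: has_field_derivative_iff)
    then show ?thesis using 3 by (simp add: bump_def)
  qed
qed

text \<open>A class closed under directional derivatives that contains the bumps. Membership gives
  \<open>C_k\<close> for all k by a single induction, without formulas for higher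
  derivatives.\<close>

inductive_set bump_algebra :: "'a::euclidean_space \<Rightarrow> real \<Rightarrow> ('a \<Rightarrow> real) set" for x0 r where
  const: "(\<lambda>x. c) \<in> bump_algebra x0 r"
| coord: "(\<lambda>x. x \<bullet> b) \<in> bump_algebra x0 r"
| bump: "(\<lambda>x. bump j ((norm (x - x0))\<^sup>2 / r\<^sup>2)) \<in> bump_algebra x0 r"
| add: "f \<in> bump_algebra x0 r \<Longrightarrow> g \<in> bump_algebra x0 r \<Longrightarrow> (\<lambda>x. f x + g x) \<in> bump_algebra x0 r"
| mult: "f \<in> bump_algebra x0 r \<Longrightarrow> g \<in> bump_algebra x0 r \<Longrightarrow> (\<lambda>x. f x * g x) \<in> bump_algebra x0 r"

lemma bump_norm_derivative:
  fixes x :: "'a::euclidean_space"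
  shows "((\<lambda>x. bump j ((norm (x - x0))\<^sup>2 / r\<^sup>2)) has_derivative
     (\<lambda>h. (real j * bump (j + 1) ((norm (x - x0))\<^sup>2 / r\<^sup>2) - bump (j + 2) ((norm (x - x0))\<^sup>2 / r\<^sup>2)) * (2 / r\<^sup>2 * ((x - x0) \<bullet> h)))) (at x)"
proof -
  have "((\<lambda>x. (x - x0) \<bullet> (x - x0) / r\<^sup>2) has_derivative (\<lambda>h. 2 / r\<^sup>2 * ((x - x0) \<bullet> h))) (at x)"
    unfolding divide_inverse by (auto intro!: derivative_eq_intros simp: inner_commute)
  then have "((\<lambda>x. (norm (x - x0))\<^sup>2 / r\<^sup>2) has_derivative (\<lambda>h. 2 / r\<^sup>2 * ((x - x0) \<bullet> h))) (at x)"
    by (simp add: power2_norm_eq_inner)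
  from has_derivative_compose[OF this bump_derivative[unfolded has_field_derivative_def]]
  show ?thesis .
qed

lemma bump_algebra_derivative:
  assumes "f \<in> bump_algebra (x0::'a::euclidean_space) r"
  shows "\<exists>f'. (\<forall>x. (f has_derivative f' x) (at x)) \<and> (\<forall>b. (\<lambda>x. f' x b) \<in> bump_algebra x0 r)"
  using assms
proof induction
  case (const c)
  show ?case by (rule exI[of _ "\<lambda>x h. 0"]) (auto intro: bump_algebra.const)
next
  case (coord b)
  show ?case by (rule exI[of _ "\<lambda>x h. h \<bullet> b"]) (auto intro: bump_algebra.const intro!: derivative_eq_intros)
next
  case (bump j)
  let ?E = "\<lambda>j x. bump j ((norm (x - x0))\<^sup>2 / r\<^sup>2)"
  let ?f = "\<lambda>x h. (real j * ?E (j + 1) x - ?E (j + 2) x) * (2 / r\<^sup>2 * ((x - x0) \<bullet> h))"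
  have "(\<lambda>x. ?f x b) \<in> bump_algebra x0 r" for b
  proof -
    have "(\<lambda>x. (real j * ?E (j + 1) x + (- 1) * ?E (j + 2) x) * (2 / r\<^sup>2 * ((x \<bullet> b) + - (x0 \<bullet> b)))) \<in> bump_algebra x0 r"
      by (intro bump_algebra.intros)
    then show ?thesis by (simp add: inner_diff_left)
  qed
  then show ?case by (intro exI[of _ ?f] conjI allI bump_norm_derivative)
next
  case (add f g)
  then obtain f' g' where "\<And>x. (f has_derivative f' x) (at x)" "\<And>b. (\<lambda>x. f' x b) \<in> bump_algebra x0 r"
    "\<And>x. (g has_derivative g' x) (at x)" "\<And>b. (\<lambda>x. g' x b) \<in> bump_algebra x0 r" by blast
  then show ?case
    by (intro exI[of _ "\<lambda>x h. f' x h + g' x h"]) (auto intro: has_derivative_add bump_algebra.add)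
next
  case (mult f g)
  then obtain f' g' where "\<And>x. (f has_derivative f' x) (at x)" "\<And>b. (\<lambda>x. f' x b) \<in> bump_algebra x0 r"
    "\<And>x. (g has_derivative g' x) (at x)" "\<And>b. (\<lambda>x. g' x b) \<in> bump_algebra x0 r" by blast
  note f'g' = this
  show ?case
  proof (intro exI[of _ "\<lambda>x h. f x * g' x h + f' x h * g x"] conjI allI)
    show "((\<lambda>x. f x * g x) has_derivative (\<lambda>h. f x * g' x h + f' x h * g x)) (at x)" for x
      by (rule has_derivative_mult[OF f'g'(1,3)])
    show "(\<lambda>x. f x * g' x b + f' x b * g x) \<in> bump_algebra x0 r" for b
      by (intro bump_algebra.add bump_algebra.mult mult.hyps f'g'(2,4))
  qed
qed

lemma C_k_bump_algebra:
  assumes "f \<in> bump_algebra x0 r"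
  shows "C_k k f"
  using assms
proof (induction k arbitrary: f)
  case 0
  then obtain f' where "\<And>x. (f has_derivative f' x) (at x)" using bump_algebra_derivative by blast
  then have "isCont f x" for x by (rule has_derivative_continuous)
  then show ?case by (simp add: continuous_at_imp_continuous_on)
next
  case (Suc k)
  then obtain f' where f': "\<And>x. (f has_derivative f' x) (at x)" "\<And>b. (\<lambda>x. f' x b) \<in> bump_algebra x0 r"
    using bump_algebra_derivative by blast
  have "partial_deriv b f = (\<lambda>x. f' x b)" for b
    by (rule ext) (rule partial_deriv_eq[OF f'(1)])
  then show ?case using Suc.IH[OF f'(2)] f'(1) by (auto simp: differentiable_def)
qed

lemma test_function_bump:
  fixes x0 :: "'a::euclidean_space"
  assumes "0 < r"
  shows "test_function (\<lambda>x. c * bump j ((norm (x - x0))\<^sup>2 / r\<^sup>2))"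
  unfolding test_function_def
proof (intro conjI allI)
  show "C_k k (\<lambda>x. c * bump j ((norm (x - x0))\<^sup>2 / r\<^sup>2))" for k
    by (rule C_k_bump_algebra[of _ x0 r]) (intro bump_algebra.intros)
  have "{x. c * bump j ((norm (x - x0))\<^sup>2 / r\<^sup>2) \<noteq> 0} \<subseteq> cball x0 r"
  proof
    fix x assume "x \<in> {x. c * bump j ((norm (x - x0))\<^sup>2 / r\<^sup>2) \<noteq> 0}"
    then have "(norm (x - x0))\<^sup>2 < r\<^sup>2" using assms by (auto simp: bump_def split: if_splits)
    then have "norm (x - x0) < r" using assms power_less_imp_less_base[of "norm (x - x0)" 2 r] by simp
    then show "x \<in> cball x0 r" by (simp add: dist_norm norm_minus_commute)
  qed
  then show "compact (closure {x. c * bump j ((norm (x - x0))\<^sup>2 / r\<^sup>2) \<noteq> 0})"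
    using bounded_subset[OF bounded_cball] by (simp add: compact_closure)
qed

lemma test_function_partial:
  fixes \<phi> :: "'a::euclidean_space \<Rightarrow> real"
  assumes "test_function \<phi>" and b: "b \<in> Basis"
  shows "test_function (partial_deriv b \<phi>)"
  unfolding test_function_def
proof (intro conjI allI)
  show "C_k k (partial_deriv b \<phi>)" for k
    using assms C_k.simps(2)[of k \<phi>] unfolding test_function_def by blast
  have "{x. partial_deriv b \<phi> x \<noteq> 0} \<subseteq> closure {x. \<phi> x \<noteq> 0}"
  proof (rule subsetI, rule ccontr)
    fix x assume x: "x \<in> {x. partial_deriv b \<phi> x \<noteq> 0}" "x \<notin> closure {x. \<phi> x \<noteq> 0}"
    have "((\<lambda>x. 0) has_derivative (\<lambda>h. 0)) (at x)" by simp
    then have "(\<phi> has_derivative (\<lambda>h. 0)) (at x)"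
      by (rule has_derivative_transform_within_open[where s = "- closure {x. \<phi> x \<noteq> 0}"])
         (use x closure_subset[of "{x. \<phi> x \<noteq> 0}"] in auto)
    from partial_deriv_eq[OF this] x show False by simp
  qed
  then show "compact (closure {x. partial_deriv b \<phi> x \<noteq> 0})"
  proof -
    assume "{x. partial_deriv b \<phi> x \<noteq> 0} \<subseteq> closure {x. \<phi> x \<noteq> 0}"
    then have "closure {x. partial_deriv b \<phi> x \<noteq> 0} \<subseteq> closure {x. \<phi> x \<noteq> 0}"
      by (rule closure_minimal) simp
    moreover have "bounded (closure {x. \<phi> x \<noteq> 0})"
      using assms(1) by (simp add: test_function_def compact_imp_bounded)
    ultimately show ?thesis by (simp add: compact_eq_bounded_closed bounded_subset)
  qed
qed

lemma test_function_continuous: "test_function \<phi> \<Longrightarrow> continuous_on UNIV \<phi>"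
  unfolding test_function_def by (metis C_k.simps(1))

lemma locally_integrable_mult_test:
  fixes f :: "'a::euclidean_space \<Rightarrow> real"
  assumes f: "locally_integrable f" and \<phi>: "test_function \<phi>"
  shows "integrable lebesgue (\<lambda>x. f x * \<phi> x)"
proof -
  define K where "K = closure {x. \<phi> x \<noteq> 0}"
  have K: "compact K" using \<phi> by (simp add: K_def test_function_def)
  have \<phi>c: "continuous_on UNIV \<phi>" by (rule test_function_continuous[OF \<phi>])
  have "bounded (\<phi> ` K)" by (intro compact_imp_bounded compact_continuous_image K continuous_on_subset[OF \<phi>c]) auto
  then obtain B where B: "\<And>x. x \<in> K \<Longrightarrow> \<bar>\<phi> x\<bar> \<le> B" unfolding bounded_iff by auto
  have fK: "integrable lebesgue (\<lambda>x. indicat_real K x * f x)"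
    using f K by (simp add: locally_integrable_def set_integrable_def)
  have out: "\<phi> x = 0" if "x \<notin> K" for x using that closure_subset[of "{x. \<phi> x \<noteq> 0}"] by (auto simp: K_def)
  have "integrable lebesgue (\<lambda>x. (indicat_real K x * f x) * \<phi> x)"
  proof (rule Bochner_Integration.integrable_bound)
    show "integrable lebesgue (\<lambda>x. B * (indicat_real K x * f x))" using fK by simp
    have "\<phi> \<in> borel_measurable lebesgue"
      using borel_measurable_continuous_onI[OF \<phi>c] by (simp add: measurable_completion)
    then show "(\<lambda>x. (indicat_real K x * f x) * \<phi> x) \<in> borel_measurable lebesgue"
      by (rule borel_measurable_times[OF borel_measurable_integrable[OF fK]])
    show "AE x in lebesgue. norm (indicat_real K x * f x * \<phi> x) \<le> norm (B * (indicat_real K x * f x))"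
    proof (rule AE_I2)
      fix x
      show "norm (indicat_real K x * f x * \<phi> x) \<le> norm (B * (indicat_real K x * f x))"
      proof (cases "x \<in> K")
        case True
        then have "\<bar>f x\<bar> * \<bar>\<phi> x\<bar> \<le> \<bar>f x\<bar> * \<bar>B\<bar>" using B[of x] by (intro mult_left_mono) auto
        then show ?thesis using True by (simp add: abs_mult mult.commute)
      qed simp
    qed
  qed
  moreover have "indicat_real K x * f x * \<phi> x = f x * \<phi> x" for x using out[of x] by (cases "x \<in> K") auto
  ultimately show ?thesis by simp
qed

lemma weak_laplacian_test:
  fixes f :: "'a::euclidean_space \<Rightarrow> real"
  assumes f: "f \<in> W_inf 2" and \<phi>: "test_function \<phi>"
  shows "integrable lebesgue (\<lambda>x. f x * laplacian \<phi> x)" "integrable lebesgue (\<lambda>x. weak_laplacian f x * \<phi> x)"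
    "(LINT x|lebesgue. f x * laplacian \<phi> x) = (LINT x|lebesgue. weak_laplacian f x * \<phi> x)"
proof -
  have wp: "has_weak_partial b (weak_partial b f) (weak_partial b (weak_partial b f)) \<and> has_weak_partial b f (weak_partial b f)"
    if b: "b \<in> Basis" for b
  proof -
    have "f \<in> W_inf (Suc (Suc 0))" using f by (simp add: numeral_2_eq_2)
    then obtain g h where g: "has_weak_partial b f g" and h: "has_weak_partial b g h" using b by force
    have w: "has_weak_partial b f (weak_partial b f)" unfolding weak_partial_def
      by (rule someI[where P = "\<lambda>g. has_weak_partial b f g", OF g])
    \<comment> \<open>The chosen \<open>weak_partial b f\<close> need not be the function
      \<open>g\<close> whose weak derivative \<open>h\<close> is known. But both have the same
      integrals against derivatives of test functions, so \<open>h\<close> serves for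
      either.\<close>
    have "has_weak_partial b (weak_partial b f) h"
      unfolding has_weak_partial_def
    proof (intro conjI allI impI)
      show "locally_integrable (weak_partial b f)" "locally_integrable h" using w h by (auto simp: has_weak_partial_def)
      fix \<psi> :: "'a \<Rightarrow> real" assume \<psi>: "test_function \<psi>"
      note t = test_function_partial[OF \<psi> b]
      show "(LINT x|lebesgue. weak_partial b f x * partial_deriv b \<psi> x) = - (LINT x|lebesgue. h x * \<psi> x)"
      proof -
        have "(LINT x|lebesgue. f x * partial_deriv b (partial_deriv b \<psi>) x) = - (LINT x|lebesgue. weak_partial b f x * partial_deriv b \<psi> x)"
          "(LINT x|lebesgue. f x * partial_deriv b (partial_deriv b \<psi>) x) = - (LINT x|lebesgue. g x * partial_deriv b \<psi> x)"
          "(LINT x|lebesgue. g x * partial_deriv b \<psi> x) = - (LINT x|lebesgue. h x * \<psi> x)"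
          using w g h t \<psi> unfolding has_weak_partial_def by blast+
        then show ?thesis by linarith
      qed
    qed
    then have "has_weak_partial b (weak_partial b f) (weak_partial b (weak_partial b f))"
      unfolding weak_partial_def[of b "weak_partial b f"]
      by (rule someI[where P = "\<lambda>g. has_weak_partial b (weak_partial b f) g"])
    then show ?thesis using w by blast
  qed
  note t = test_function_partial[OF \<phi>] and t2 = test_function_partial[OF test_function_partial[OF \<phi>]]
  have i1: "integrable lebesgue (\<lambda>x. f x * partial_deriv b (partial_deriv b \<phi>) x)" if "b \<in> Basis" for b
    using wp[OF that] by (intro locally_integrable_mult_test t2 that) (auto simp: has_weak_partial_def)
  have i2: "integrable lebesgue (\<lambda>x. weak_partial b (weak_partial b f) x * \<phi> x)" if "b \<in> Basis" for b
    using wp[OF that] by (intro locally_integrable_mult_test \<phi>) (auto simp: has_weak_partial_def)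
  have e1: "f x * laplacian \<phi> x = (\<Sum>b\<in>Basis. f x * partial_deriv b (partial_deriv b \<phi>) x)" for x
    by (simp add: laplacian_def sum_distrib_left)
  have e2: "weak_laplacian f x * \<phi> x = (\<Sum>b\<in>Basis. weak_partial b (weak_partial b f) x * \<phi> x)" for x
    by (simp add: weak_laplacian_def sum_distrib_right)
  show "integrable lebesgue (\<lambda>x. f x * laplacian \<phi> x)" unfolding e1 by (intro Bochner_Integration.integrable_sum i1)
  show "integrable lebesgue (\<lambda>x. weak_laplacian f x * \<phi> x)" unfolding e2 by (intro Bochner_Integration.integrable_sum i2)
  have "(LINT x|lebesgue. f x * partial_deriv b (partial_deriv b \<phi>) x) = (LINT x|lebesgue. weak_partial b (weak_partial b f) x * \<phi> x)"
    if b: "b \<in> Basis" for b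
  proof -
    have "(LINT x|lebesgue. f x * partial_deriv b (partial_deriv b \<phi>) x) = - (LINT x|lebesgue. weak_partial b f x * partial_deriv b \<phi> x)"
      "(LINT x|lebesgue. weak_partial b f x * partial_deriv b \<phi> x) = - (LINT x|lebesgue. weak_partial b (weak_partial b f) x * \<phi> x)"
      using wp[OF b] t[OF b] \<phi> unfolding has_weak_partial_def by blast+
    then show ?thesis by linarith
  qed
  then show "(LINT x|lebesgue. f x * laplacian \<phi> x) = (LINT x|lebesgue. weak_laplacian f x * \<phi> x)"
    unfolding e1 e2 by (simp add: Bochner_Integration.integral_sum i1 i2)
qed

lemma laplacian_bounded_above:
  fixes f :: "'a::euclidean_space \<Rightarrow> real"
  assumes f: "f \<in> W_inf 2" and \<phi>: "test_function \<phi>" "\<And>x. 0 \<le> \<phi> x"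
    and A: "AE x in lebesgue. weak_laplacian f x \<le> A"
  shows "(LINT x|lebesgue. f x * laplacian \<phi> x) \<le> A * (LINT x|lebesgue. \<phi> x)"
proof -
  have "locally_integrable (\<lambda>x::'a. 1)"
    unfolding locally_integrable_def set_integrable_def
  proof (intro allI impI)
    fix S :: "'a set" assume "compact S"
    then have "S \<in> lmeasurable" by (rule lmeasurable_compact)
    then have "integrable lebesgue (indicat_real S)"
      by (intro integrable_real_indicator) (auto simp: fmeasurable_def simp del: emeasure_completion)
    then show "integrable lebesgue (\<lambda>x. indicat_real S x *\<^sub>R 1)" by simp
  qed
  from locally_integrable_mult_test[OF this \<phi>(1)] have "integrable lebesgue \<phi>" by simp
  then have "(LINT x|lebesgue. weak_laplacian f x * \<phi> x) \<le> (LINT x|lebesgue. A * \<phi> x)"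
    using A \<phi>(2) by (intro integral_mono_AE weak_laplacian_test[OF f \<phi>(1)]) (auto intro: mult_right_mono)
  then show ?thesis by (simp add: weak_laplacian_test(3)[OF f \<phi>(1)])
qed

section \<open>Mean values\<close>

text \<open>Write K for this kernel. As \<open>bump 2\<close> is minus the derivative of
  \<open>bump 0\<close>, the field (y - x0) K / r is minus the gradient of r / r^n times the bump
  with j = 0. K is a dilate of a fixed profile with constant mass, so its r-derivative is - (1 / r)
  div ((y - x0) K), which is therefore a Laplacian.\<close>

definition mean_kernel :: "'a::euclidean_space \<Rightarrow> real \<Rightarrow> 'a \<Rightarrow> real" where
  "mean_kernel x0 r y = 2 * bump 2 ((norm (y - x0))\<^sup>2 / r\<^sup>2) / r ^ DIM('a)"

definition mean_mass :: "'a::euclidean_space itself \<Rightarrow> real" where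
  "mean_mass _ = integral (cbox (- One) One) (\<lambda>z::'a. 2 * bump 2 ((norm z)\<^sup>2))"

abbreviation cube :: "'a::euclidean_space \<Rightarrow> real \<Rightarrow> 'a set" where
  "cube x r \<equiv> cbox (x - r *\<^sub>R One) (x + r *\<^sub>R One)"

lemma measure_cube:
  fixes x :: "'a::euclidean_space"
  assumes "0 < h"
  shows "measure lborel (cube x h) = (2 * h) ^ DIM('a)"
proof -
  have "measure lborel (cube x h) = (\<Prod>i::'a\<in>Basis. (x + h *\<^sub>R One) \<bullet> i - (x - h *\<^sub>R One) \<bullet> i)"
    by (rule content_cbox) (use assms in \<open>auto simp: inner_simps\<close>)
  also have "\<dots> = (\<Prod>i::'a\<in>Basis. 2 * h)" by (intro prod.cong refl) (simp add: inner_simps)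
  finally show ?thesis by simp
qed

lemma bump_continuous: "continuous_on UNIV (bump j)"
  by (intro continuous_at_imp_continuous_on ballI DERIV_isCont[OF bump_derivative])

lemma mean_kernel_continuous: "continuous_on S (mean_kernel x0 r)"
proof -
  have "continuous_on UNIV (\<lambda>y. bump 2 ((norm (y - x0))\<^sup>2 / r\<^sup>2))"
    unfolding divide_inverse by (rule continuous_on_compose2[OF bump_continuous]) (auto intro!: continuous_intros)
  then have "continuous_on UNIV (mean_kernel x0 r)"
    unfolding mean_kernel_def[abs_def] divide_inverse by (intro continuous_on_mult continuous_on_const)
  then show ?thesis by (rule continuous_on_subset) simp
qed

lemma mean_kernel_nonneg: "0 < r \<Longrightarrow> 0 \<le> mean_kernel x0 r y"
  using bump_bounds(1) by (simp add: mean_kernel_def)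

lemma bump_outside:
  assumes "0 < r" "r \<le> norm (y - x0)"
  shows "bump j ((norm (y - x0))\<^sup>2 / r\<^sup>2) = 0"
proof -
  have "r\<^sup>2 \<le> (norm (y - x0))\<^sup>2" using assms by (intro power_mono) auto
  then have "1 \<le> (norm (y - x0))\<^sup>2 / r\<^sup>2" using assms by (simp add: le_divide_eq)
  then show ?thesis unfolding bump_def by (intro if_not_P) linarith
qed

lemma outside_cube:
  assumes "y \<notin> cube x0 r"
  shows "r \<le> norm (y - x0)"
proof -
  obtain b :: 'a where b: "b \<in> Basis" "\<not> \<bar>(y - x0) \<bullet> b\<bar> \<le> r"
    using assms by (auto simp: mem_box inner_diff_left inner_add_left abs_le_iff)
  then show ?thesis using Basis_le_norm[OF b(1), of "y - x0"] by linarith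
qed

lemma mean_kernel_integral:
  fixes x0 :: "'a::euclidean_space"
  assumes r: "0 < r" "r \<le> R"
  shows "(mean_kernel x0 r has_integral mean_mass TYPE('a)) (cube x0 R)"
proof -
  let ?g = "\<lambda>z::'a. 2 * bump 2 ((norm z)\<^sup>2)"
  have "continuous_on (cbox (- One) One) ?g"
    by (intro continuous_on_mult continuous_on_const continuous_on_compose2[OF bump_continuous]) (auto intro!: continuous_intros)
  then have "(?g has_integral mean_mass TYPE('a)) (cbox (- One) One)"
    unfolding mean_mass_def by (intro integrable_integral integrable_continuous)
  from has_integral_affinity'[OF this, of "1 / r" "- ((1 / r) *\<^sub>R x0)"]
  have "((\<lambda>x. ?g ((1 / r) *\<^sub>R x + - ((1 / r) *\<^sub>R x0))) has_integral (mean_mass TYPE('a) /\<^sub>R (1 / r) ^ DIM('a)))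
     (cbox ((- One - - ((1 / r) *\<^sub>R x0)) /\<^sub>R (1 / r)) ((One - - ((1 / r) *\<^sub>R x0)) /\<^sub>R (1 / r)))" using r by simp
  moreover have "(- One - - ((1 / r) *\<^sub>R x0)) /\<^sub>R (1 / r) = x0 - r *\<^sub>R One" "(One - - ((1 / r) *\<^sub>R x0)) /\<^sub>R (1 / r) = x0 + r *\<^sub>R One"
    using r by (simp_all add: algebra_simps)
  moreover have "(norm ((1 / r) *\<^sub>R x + - ((1 / r) *\<^sub>R x0)))\<^sup>2 = (norm (x - x0))\<^sup>2 / r\<^sup>2" for x
  proof -
    have "(1 / r) *\<^sub>R x + - ((1 / r) *\<^sub>R x0) = (1 / r) *\<^sub>R (x - x0)" by (simp add: scaleR_diff_right)
    then show ?thesis using r by (simp add: power_divide)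
  qed
  ultimately have "((\<lambda>x. 2 * bump 2 ((norm (x - x0))\<^sup>2 / r\<^sup>2)) has_integral (mean_mass TYPE('a) /\<^sub>R (1 / r) ^ DIM('a))) (cube x0 r)"
    by (simp only:)
  from has_integral_divide[OF this, of "r ^ DIM('a)"]
  have "(mean_kernel x0 r has_integral mean_mass TYPE('a)) (cube x0 r)"
    using r by (simp add: mean_kernel_def[abs_def] power_one_over)
  then show ?thesis
  proof (rule has_integral_on_superset)
    show "mean_kernel x0 r x = 0" if "x \<notin> cube x0 r" for x
      using bump_outside[OF r(1) outside_cube[OF that], of 2] by (simp add: mean_kernel_def)
    show "cube x0 r \<subseteq> cube x0 R" using r by (auto simp: subset_box inner_simps)
  qed
qed

text \<open>The derivative of \<open>mean_kernel x0 r y\<close> in \<open>r\<close> is also the Laplacian in \<open>y\<close> of a bump function; this is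
  what turns a bound on the weak Laplacian into a mean value inequality.\<close>

definition mean_kernel_rate :: "'a::euclidean_space \<Rightarrow> real \<Rightarrow> 'a \<Rightarrow> real" where
  "mean_kernel_rate x0 r y = - (2 / (r * r ^ DIM('a))) *
     (2 * ((norm (y - x0))\<^sup>2 / r\<^sup>2) * (2 * bump 3 ((norm (y - x0))\<^sup>2 / r\<^sup>2) - bump 4 ((norm (y - x0))\<^sup>2 / r\<^sup>2))
       + DIM('a) * bump 2 ((norm (y - x0))\<^sup>2 / r\<^sup>2))"

lemma mean_kernel_derivative:
  fixes x0 y :: "'a::euclidean_space"
  assumes r: "0 < r"
  shows "((\<lambda>r. mean_kernel x0 r y) has_real_derivative mean_kernel_rate x0 r y) (at r)"
proof -
  define s where "s = (norm (y - x0))\<^sup>2"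
  have "((\<lambda>r. s / r\<^sup>2) has_real_derivative (0 * r\<^sup>2 - s * (2 * r)) / (r\<^sup>2 * r\<^sup>2)) (at r)"
    by (intro DERIV_divide DERIV_const) (use r in \<open>auto intro!: derivative_eq_intros\<close>)
  from DERIV_chain2[OF bump_derivative[of 2] this]
  have "((\<lambda>r. bump 2 (s / r\<^sup>2)) has_real_derivative (2 * bump 3 (s / r\<^sup>2) - bump 4 (s / r\<^sup>2)) * ((0 * r\<^sup>2 - s * (2 * r)) / (r\<^sup>2 * r\<^sup>2))) (at r)"
    by simp
  from DERIV_divide[OF DERIV_cmult[OF this, of 2] DERIV_pow[of "DIM('a)" r]]
  have "((\<lambda>r. 2 * bump 2 (s / r\<^sup>2) / r ^ DIM('a)) has_real_derivative
     (2 * ((2 * bump 3 (s / r\<^sup>2) - bump 4 (s / r\<^sup>2)) * ((0 * r\<^sup>2 - s * (2 * r)) / (r\<^sup>2 * r\<^sup>2))) * r ^ DIM('a)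
      - 2 * bump 2 (s / r\<^sup>2) * (real DIM('a) * r ^ (DIM('a) - Suc 0))) / (r ^ DIM('a) * r ^ DIM('a))) (at r)"
    using r by simp
  moreover have "(2 * (B * ((0 * r\<^sup>2 - s * (2 * r)) / (r\<^sup>2 * r\<^sup>2))) * r ^ DIM('a)
      - 2 * C * (real DIM('a) * r ^ (DIM('a) - Suc 0))) / (r ^ DIM('a) * r ^ DIM('a))
      = - (2 / (r * r ^ DIM('a))) * (2 * (s / r\<^sup>2) * B + DIM('a) * C)" for B C :: real
  proof -
    have e: "r ^ (DIM('a) - Suc 0) = r ^ DIM('a) / r" using r DIM_ge_Suc0[where 'a = 'a] by (simp add: power_diff)
    have "(2 * (B * ((0 * r\<^sup>2 - s * (2 * r)) / (r\<^sup>2 * r\<^sup>2))) * P - 2 * C * (d * (P / r))) / (P * P)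
      = - (2 / (r * P)) * (2 * (s / r\<^sup>2) * B + d * C)" if "P \<noteq> 0" for P d :: real
      using r that by (simp add: field_simps power2_eq_square)
    from this[of "r ^ DIM('a)" "real DIM('a)"] show ?thesis using r unfolding e by simp
  qed
  ultimately show ?thesis by (simp only: mean_kernel_def mean_kernel_rate_def s_def[symmetric])
qed

lemma laplacian_bump:
  fixes x0 y :: "'a::euclidean_space"
  assumes r: "0 < r"
  shows "laplacian (\<lambda>y. r / r ^ DIM('a) * bump 0 ((norm (y - x0))\<^sup>2 / r\<^sup>2)) y = mean_kernel_rate x0 r y"
proof -
  define c where "c = r / r ^ DIM('a)"
  let ?E = "\<lambda>j y. bump j ((norm (y - x0))\<^sup>2 / r\<^sup>2)"
  have p1: "partial_deriv b (\<lambda>y. c * ?E 0 y) = (\<lambda>y. - (2 * c / r\<^sup>2) * (?E 2 y * ((y - x0) \<bullet> b)))" for b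
  proof
    fix y
    have "((\<lambda>y. c * ?E 0 y) has_derivative (\<lambda>h. c * ((real 0 * ?E (0 + 1) y - ?E (0 + 2) y) * (2 / r\<^sup>2 * ((y - x0) \<bullet> h))))) (at y)"
      by (intro has_derivative_mult_right bump_norm_derivative)
    from partial_deriv_eq[OF this] show "partial_deriv b (\<lambda>y. c * ?E 0 y) y = - (2 * c / r\<^sup>2) * (?E 2 y * ((y - x0) \<bullet> b))"
      by (simp add: numeral_2_eq_2)
  qed
  define B where "B = 2 * ?E 3 y - ?E 4 y"
  have p2: "partial_deriv b (partial_deriv b (\<lambda>y. c * ?E 0 y)) y = - (2 * c / r\<^sup>2) * (?E 2 y + B * (2 / r\<^sup>2) * (((y - x0) \<bullet> b) * ((y - x0) \<bullet> b)))"
    if b: "b \<in> Basis" for b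
  proof -
    have "((\<lambda>y. (y - x0) \<bullet> b) has_derivative (\<lambda>h. h \<bullet> b)) (at y)" by (auto intro!: derivative_eq_intros)
    from has_derivative_mult_right[OF has_derivative_mult[OF bump_norm_derivative this]]
    have "((\<lambda>y. - (2 * c / r\<^sup>2) * (?E 2 y * ((y - x0) \<bullet> b))) has_derivative
       (\<lambda>h. - (2 * c / r\<^sup>2) * (?E 2 y * (h \<bullet> b) + (real 2 * ?E (2 + 1) y - ?E (2 + 2) y) * (2 / r\<^sup>2 * ((y - x0) \<bullet> h)) * ((y - x0) \<bullet> b)))) (at y)" .
    from partial_deriv_eq[OF this, of b] show ?thesis using b by (simp add: p1 B_def)
  qed
  have "laplacian (\<lambda>y. c * ?E 0 y) y = (\<Sum>b::'a\<in>Basis. - (2 * c / r\<^sup>2) * (?E 2 y + B * (2 / r\<^sup>2) * (((y - x0) \<bullet> b) * ((y - x0) \<bullet> b))))"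
    unfolding laplacian_def by (intro sum.cong refl p2)
  also have "\<dots> = - (2 * c / r\<^sup>2) * (DIM('a) * ?E 2 y + B * (2 / r\<^sup>2) * (norm (y - x0))\<^sup>2)"
    by (simp only: sum_distrib_left[symmetric] sum.distrib sum_inner_square sum_constant)
  also have "2 * c / r\<^sup>2 = 2 / (r * r ^ DIM('a))" using r by (simp add: c_def power2_eq_square)
  finally show ?thesis by (simp add: mean_kernel_rate_def c_def[symmetric] B_def algebra_simps)
qed

lemma integral_eq_lebesgue_integral_cube:
  fixes f :: "'a::euclidean_space \<Rightarrow> real"
  assumes "integrable lebesgue f" "\<And>x. x \<notin> cbox a b \<Longrightarrow> f x = 0"
  shows "integral (cbox a b) f = (LINT x|lebesgue. f x)"
proof -
  have "(f has_integral (LINT x|lebesgue. f x)) UNIV" by (rule has_integral_integral_lebesgue[OF assms(1)])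
  moreover have "(\<lambda>x. if x \<in> cbox a b then f x else 0) = f" using assms(2) by (auto simp: fun_eq_iff)
  ultimately have "(f has_integral (LINT x|lebesgue. f x)) (cbox a b)"
    using has_integral_restrict_UNIV[of "cbox a b" f "LINT x|lebesgue. f x"] by simp
  then show ?thesis by (rule integral_unique)
qed


lemma mean_kernel_rate_continuous:
  "continuous_on ({0<..} \<times> S) (\<lambda>(r, y). mean_kernel_rate (x0::'a::euclidean_space) r y)"
proof -
  have q: "continuous_on ({0<..} \<times> S) (\<lambda>z::real \<times> 'a. (norm (snd z - x0))\<^sup>2 / (fst z)\<^sup>2)"
    by (auto intro!: continuous_intros)
  have b: "continuous_on ({0<..} \<times> S) (\<lambda>z::real \<times> 'a. bump j ((norm (snd z - x0))\<^sup>2 / (fst z)\<^sup>2))" for j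
    by (rule continuous_on_compose2[OF bump_continuous q]) auto
  have "continuous_on ({0<..} \<times> S) (\<lambda>z::real \<times> 'a. - (2 / (fst z * fst z ^ DIM('a))))"
    by (auto intro!: continuous_intros)
  then show ?thesis unfolding mean_kernel_rate_def split_beta
    by (intro continuous_on_mult continuous_on_add continuous_on_diff continuous_on_const q b)
qed

text \<open>The r-derivative of the integral is that of f times the Laplacian of a non-negative test
  function, so \<open>lap\<close> bounds it by A times the integral of this function. The latter is
  at most r / r^n and lives in a cube of side 2 r, which gives the rate A 2^n r; integrate in
  r.\<close>

lemma mean_value_growth:
  fixes f :: "'a::euclidean_space \<Rightarrow> real"
  assumes f: "continuous_on UNIV f" and A: "0 \<le> A" and rs: "0 < r" "r \<le> s" "s \<le> R"
    and lap: "\<And>\<phi>. test_function \<phi> \<Longrightarrow> (\<And>x. 0 \<le> \<phi> x) \<Longrightarrow>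
       integrable lebesgue (\<lambda>x. f x * laplacian \<phi> x) \<and> (LINT x|lebesgue. f x * laplacian \<phi> x) \<le> A * (LINT x|lebesgue. \<phi> x)"
  shows "integral (cube x0 R) (\<lambda>y. mean_kernel x0 s y * f y) \<le> integral (cube x0 R) (\<lambda>y. mean_kernel x0 r y * f y) + A * 2 ^ DIM('a) * s\<^sup>2"
proof -
  define \<Phi> where "\<Phi> r = integral (cube x0 R) (\<lambda>y. mean_kernel x0 r y * f y)" for r
  define D where "D r = integral (cube x0 R) (\<lambda>y. mean_kernel_rate x0 r y * f y)" for r
  have fc: "continuous_on S f" for S by (rule continuous_on_subset[OF f]) simp
  have d\<Phi>: "(\<Phi> has_real_derivative D r) (at r)" if r: "0 < r" for r
  proof -
    have "(\<Phi> has_real_derivative D r) (at r within {0<..})"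
      unfolding \<Phi>_def D_def
    proof (rule leibniz_rule_field_derivative)
      show "((\<lambda>r. mean_kernel x0 r y * f y) has_real_derivative mean_kernel_rate x0 r y * f y) (at r within {0<..})"
        if "r \<in> {0<..}" for r y
        using that by (intro DERIV_cmult_right has_field_derivative_at_within[OF mean_kernel_derivative]) auto
      show "(\<lambda>y. mean_kernel x0 r y * f y) integrable_on cube x0 R" for r
        by (intro integrable_continuous continuous_on_mult mean_kernel_continuous fc)
      have "continuous_on ({0<..} \<times> cube x0 R) (\<lambda>z. f (snd z))"
        by (rule continuous_on_compose2[OF f]) (auto intro!: continuous_intros)
      from continuous_on_mult[OF mean_kernel_rate_continuous[unfolded split_beta] this]
      show "continuous_on ({0<..} \<times> cube x0 R) (\<lambda>(r, y). mean_kernel_rate x0 r y * f y)"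
        by (simp add: split_beta)
    qed (use r in auto)
    with at_within_open[of r "{0<..}"] r show ?thesis by simp
  qed
  have D_le: "D r \<le> A * 2 ^ DIM('a) * r" if r: "0 < r" "r \<le> R" for r
  proof -
    define c where "c = r / r ^ DIM('a)"
    define \<Theta> where "\<Theta> = (\<lambda>y. c * bump 0 ((norm (y - x0))\<^sup>2 / r\<^sup>2))"
    have c: "0 < c" using r by (simp add: c_def)
    have \<Theta>: "test_function \<Theta>" "\<And>x. 0 \<le> \<Theta> x"
      using c test_function_bump[OF r(1)] bump_bounds(1) by (auto simp: \<Theta>_def)
    have lt: "laplacian \<Theta> y = mean_kernel_rate x0 r y" for y
      unfolding \<Theta>_def c_def by (rule laplacian_bump[OF r(1)])
    have sub: "cube x0 r \<subseteq> cube x0 R" using r by (auto simp: subset_box inner_simps)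
    have "D r = integral (cube x0 R) (\<lambda>x. f x * laplacian \<Theta> x)" by (simp add: D_def lt mult.commute)
    also have "\<dots> = (LINT x|lebesgue. f x * laplacian \<Theta> x)"
    proof (rule integral_eq_lebesgue_integral_cube)
      fix x assume "x \<notin> cube x0 R"
      then have "x \<notin> cube x0 r" using sub by blast
      from bump_outside[OF r(1) outside_cube[OF this]] show "f x * laplacian \<Theta> x = 0"
        by (simp add: lt mean_kernel_rate_def)
    qed (use lap[OF \<Theta>] in blast)
    also have "\<dots> \<le> A * (LINT x|lebesgue. \<Theta> x)" using lap[OF \<Theta>] by blast
    also have "(LINT x|lebesgue. \<Theta> x) \<le> (LINT x|lebesgue. c * indicat_real (cube x0 r) x)"
    proof (rule integral_mono)
      have cm: "cube x0 r \<in> lmeasurable" by (rule lmeasurable_cbox)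
      have ind: "integrable lebesgue (indicat_real (cube x0 r))"
        by (intro integrable_real_indicator) (use cm in \<open>auto simp: fmeasurable_def simp del: emeasure_completion\<close>)
      then show i: "integrable lebesgue (\<lambda>x. c * indicat_real (cube x0 r) x)" by simp
      show le: "\<Theta> x \<le> c * indicat_real (cube x0 r) x" for x
      proof (cases "x \<in> cube x0 r")
        case True
        have "bump 0 ((norm (x - x0))\<^sup>2 / r\<^sup>2) \<le> 1" by (simp add: bump_def)
        then show ?thesis using True c by (simp add: \<Theta>_def)
      next
        case False
        from bump_outside[OF r(1) outside_cube[OF this]] False show ?thesis by (simp add: \<Theta>_def)
      qed
      show "integrable lebesgue \<Theta>"
      proof (rule Bochner_Integration.integrable_bound[OF i])
        show "\<Theta> \<in> borel_measurable lebesgue"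
          using borel_measurable_continuous_onI[OF test_function_continuous[OF \<Theta>(1)]] by (simp add: measurable_completion)
        show "AE x in lebesgue. norm (\<Theta> x) \<le> norm (c * indicat_real (cube x0 r) x)"
        proof (rule AE_I2)
          show "norm (\<Theta> x) \<le> norm (c * indicat_real (cube x0 r) x)" for x
            using le[of x] \<Theta>(2)[of x] unfolding real_norm_def by linarith
        qed
      qed
    qed
    also have "(LINT x|lebesgue. c * indicat_real (cube x0 r) x) = c * measure lebesgue (cube x0 r)" by simp
    also have "measure lebesgue (cube x0 r) = (2 * r) ^ DIM('a)"
      using measure_cube[OF r(1), of x0] by simp
    also have "c * (2 * r) ^ DIM('a) = 2 ^ DIM('a) * r" using r by (simp add: c_def power_mult_distrib)
    finally show ?thesis using A by (simp add: mult_left_mono mult.assoc)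
  qed
  have "\<Phi> s - A * 2 ^ DIM('a) * s\<^sup>2 \<le> \<Phi> r - A * 2 ^ DIM('a) * r\<^sup>2"
  proof (rule DERIV_nonpos_imp_nonincreasing[OF rs(2)])
    fix x assume x: "r \<le> x" "x \<le> s"
    then have x0: "0 < x" "x \<le> R" using rs by auto
    have "((\<lambda>x. \<Phi> x - A * 2 ^ DIM('a) * x\<^sup>2) has_real_derivative D x - A * 2 ^ DIM('a) * (2 * x)) (at x)"
      by (intro DERIV_diff d\<Phi> x0 DERIV_cmult) (auto intro!: derivative_eq_intros)
    moreover have "0 \<le> A * 2 ^ DIM('a) * x" using A x0 by simp
    then have "D x - A * 2 ^ DIM('a) * (2 * x) \<le> 0" using D_le[OF x0] by simp
    ultimately show "\<exists>y. ((\<lambda>x. \<Phi> x - A * 2 ^ DIM('a) * x\<^sup>2) has_real_derivative y) (at x) \<and> y \<le> 0" by blast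
  qed
  moreover have "0 \<le> A * 2 ^ DIM('a) * r\<^sup>2" using A by simp
  ultimately show ?thesis unfolding \<Phi>_def by linarith
qed

lemma norm_le_cube:
  fixes x y :: "'a::euclidean_space" and h :: real
  assumes "y \<in> cube x h"
  shows "norm (y - x) \<le> DIM('a) * h"
proof -
  have "norm (y - x) \<le> (\<Sum>b\<in>Basis. \<bar>(y - x) \<bullet> b\<bar>)" by (rule norm_le_l1)
  also have "\<dots> \<le> (\<Sum>b::'a\<in>Basis. h)"
    by (rule sum_mono) (use assms in \<open>auto simp: mem_box inner_simps abs_le_iff\<close>)
  finally show ?thesis by simp
qed

text \<open>At a tiny radius continuity bounds the kernel integral of m + f by 2
  \<open>\<delta>\<close> times the mass of the kernel; \<open>mean_value_growth\<close> carries
  this to radius R at the cost of a multiple of A R^2. Since m + f is non-negative and the kernel is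
  bounded below on half the radius, all small cubes there are controlled, for every centre
  \<open>x\<close> near \<open>x0\<close>.\<close>

lemma mean_value_estimate:
  obtains C where "0 < C"
    "\<And>(f :: 'a::euclidean_space \<Rightarrow> real) m A \<delta> R x0 x. continuous_on UNIV f \<Longrightarrow> (\<And>y. - m \<le> f y) \<Longrightarrow> 0 \<le> A \<Longrightarrow> 0 < \<delta> \<Longrightarrow> 0 < R \<Longrightarrow>
      (\<And>\<phi>. test_function \<phi> \<Longrightarrow> (\<And>x. 0 \<le> \<phi> x) \<Longrightarrow>
       integrable lebesgue (\<lambda>x. f x * laplacian \<phi> x) \<and> (LINT x|lebesgue. f x * laplacian \<phi> x) \<le> A * (LINT x|lebesgue. \<phi> x)) \<Longrightarrow>
      f x0 \<le> - m + \<delta> \<Longrightarrow> norm (x - x0) \<le> R / 4 \<Longrightarrow>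
      integral (cube x (R / (4 * DIM('a)))) (\<lambda>y. m + f y) \<le> C * (\<delta> + A * R\<^sup>2) * (R / (2 * DIM('a))) ^ DIM('a)"
proof -
  define N where "N = DIM('a)"
  have N: "0 < N" by (simp add: N_def)
  define I where "I = mean_mass TYPE('a)"
  define C where "C = (2 * N) ^ N * (exp 2 / 2) * (2 * \<bar>I\<bar> + 2 ^ N)"
  have C: "0 < C" using N by (auto simp: C_def intro!: mult_pos_pos add_nonneg_pos)
  show ?thesis
  proof (rule that[OF C])
    fix f :: "'a \<Rightarrow> real" and m A \<delta> R :: real and x0 x :: 'a
    assume f: "continuous_on UNIV f" and fm: "\<And>y. - m \<le> f y" and A: "0 \<le> A" and \<delta>: "0 < \<delta>" and R: "0 < R"
      and lap: "\<And>\<phi>. test_function \<phi> \<Longrightarrow> (\<And>x. 0 \<le> \<phi> x) \<Longrightarrow>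
       integrable lebesgue (\<lambda>x. f x * laplacian \<phi> x) \<and> (LINT x|lebesgue. f x * laplacian \<phi> x) \<le> A * (LINT x|lebesgue. \<phi> x)"
      and fx0: "f x0 \<le> - m + \<delta>" and x: "norm (x - x0) \<le> R / 4"
    have fc: "continuous_on S f" for S by (rule continuous_on_subset[OF f]) simp
    obtain e where e: "e > 0" "\<And>y. dist y x0 < e \<Longrightarrow> dist (f y) (f x0) < \<delta>"
      using f \<delta> unfolding continuous_on_iff by (metis UNIV_I)
    define r where "r = min e R"
    have r: "0 < r" "r \<le> R" "r \<le> e" using e R by (auto simp: r_def)
    let ?k = "\<lambda>r y. mean_kernel x0 r y"
    have ki: "?k r integrable_on cbox a b" and kfi: "(\<lambda>y. ?k r y * f y) integrable_on cbox a b"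
      and kmi: "(\<lambda>y. ?k r y * (m + f y)) integrable_on cbox a b" for r a b
      by (intro integrable_continuous continuous_on_mult continuous_on_add continuous_on_const mean_kernel_continuous fc)+
    have split: "integral (cube x0 R) (\<lambda>y. ?k s y * (m + f y)) = m * I + integral (cube x0 R) (\<lambda>y. ?k s y * f y)"
      if "0 < s" "s \<le> R" for s
    proof -
      have "integral (cube x0 R) (\<lambda>y. ?k s y * (m + f y)) = integral (cube x0 R) (\<lambda>y. m * ?k s y + ?k s y * f y)"
        by (simp add: algebra_simps)
      also have "\<dots> = m * integral (cube x0 R) (?k s) + integral (cube x0 R) (\<lambda>y. ?k s y * f y)"
        by (subst integral_add[OF integrable_on_mult_right[OF ki] kfi]) simp
      finally show ?thesis using integral_unique[OF mean_kernel_integral[OF that, of x0]] by (simp add: I_def)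
    qed
    have "integral (cube x0 R) (\<lambda>y. ?k r y * (m + f y)) \<le> integral (cube x0 R) (\<lambda>y. ?k r y * (2 * \<delta>))"
    proof (rule integral_le[OF kmi])
      show "(\<lambda>y. ?k r y * (2 * \<delta>)) integrable_on cube x0 R" by (rule integrable_on_mult_left[OF ki])
      fix y
      show "?k r y * (m + f y) \<le> ?k r y * (2 * \<delta>)"
      proof (cases "norm (y - x0) < r")
        case True
        then have "dist (f y) (f x0) < \<delta>" using e(2)[of y] r by (simp add: dist_norm)
        then have "m + f y \<le> 2 * \<delta>" using fx0 by (simp add: dist_real_def)
        then show ?thesis using mean_kernel_nonneg[OF r(1)] by (intro mult_left_mono) auto
      next
        case False
        then show ?thesis using bump_outside[OF r(1), of y x0] by (simp add: mean_kernel_def)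
      qed
    qed
    also have "\<dots> = 2 * \<delta> * I" using integral_unique[OF mean_kernel_integral[OF r(1,2), of x0]] by (simp add: I_def)
    finally have small: "m * I + integral (cube x0 R) (\<lambda>y. ?k r y * f y) \<le> 2 * \<delta> * I" using split[OF r(1,2)] by simp
    have "integral (cube x0 R) (\<lambda>y. ?k R y * (m + f y)) \<le> 2 * \<delta> * I + A * 2 ^ N * R\<^sup>2"
      using split[OF R] small mean_value_growth[OF f A r(1,2) order_refl lap, of x0] by (simp add: N_def)
    also have "\<dots> \<le> 2 * \<delta> * \<bar>I\<bar> + A * 2 ^ N * R\<^sup>2" using \<delta> by simp
    also have "\<dots> \<le> (2 * \<bar>I\<bar> + 2 ^ N) * (\<delta> + A * R\<^sup>2)" using \<delta> A by (simp add: algebra_simps)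
    finally have big: "integral (cube x0 R) (\<lambda>y. ?k R y * (m + f y)) \<le> (2 * \<bar>I\<bar> + 2 ^ N) * (\<delta> + A * R\<^sup>2)" .
    \<comment> \<open>A cube of half side h lies within n h = R / 4 of its centre \<open>x\<close>,
      hence within R / 2 of \<open>x0\<close>.\<close>
    define h where "h = R / (4 * real N)"
    have Nh: "N * h = R / 4" using N by (simp add: h_def)
    have near: "norm (y - x0) \<le> R / 2" if "y \<in> cube x h" for y
      using norm_le_cube[OF that] x Nh norm_triangle_ineq[of "y - x" "x - x0"] by (simp add: N_def)
    have sub: "cube x h \<subseteq> cube x0 R"
    proof
      fix y assume y: "y \<in> cube x h"
      show "y \<in> cube x0 R" using outside_cube[of y x0 R] near[OF y] R by (cases "y \<in> cube x0 R") auto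
    qed
    \<comment> \<open>On half the radius the argument s of the bump is at most 1 / 4, whence 1 / (1
      - s) \<le> 2 and the factor exp (- 2).\<close>
    have low: "2 * exp (- 2) / R ^ N \<le> ?k R y" if "y \<in> cube x h" for y
    proof -
      have "(norm (y - x0))\<^sup>2 \<le> (R / 2)\<^sup>2" using near[OF that] by (intro power_mono) auto
      then have s: "(norm (y - x0))\<^sup>2 / R\<^sup>2 \<le> 1 / 4" using R by (simp add: divide_le_eq power_divide)
      define s where "s = (norm (y - x0))\<^sup>2 / R\<^sup>2"
      have s: "0 \<le> s" "s \<le> 1 / 4" using s by (auto simp: s_def)
      have "1 / (1 - s) \<le> 2" using s by (simp add: divide_le_eq)
      then have "exp (- 2) \<le> exp (- 1 / (1 - s))" by simp
      also have "\<dots> \<le> exp (- 1 / (1 - s)) / (1 - s)\<^sup>2"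
        using s power_le_one[of "1 - s" 2] by (simp add: le_divide_eq mult_le_cancel_left1)
      also have "\<dots> = bump 2 s" using s by (simp add: bump_def)
      finally have "2 * exp (- 2) \<le> 2 * bump 2 s" by simp
      then show ?thesis using R by (simp add: mean_kernel_def s_def N_def divide_right_mono)
    qed
    have mfi: "(\<lambda>y. m + f y) integrable_on cube x h"
      by (auto intro!: integrable_continuous continuous_on_add fc)
    have "2 * exp (- 2) / R ^ N * integral (cube x h) (\<lambda>y. m + f y) = integral (cube x h) (\<lambda>y. 2 * exp (- 2) / R ^ N * (m + f y))"
      by (rule integral_mult_right[symmetric])
    also have "\<dots> \<le> integral (cube x h) (\<lambda>y. ?k R y * (m + f y))"
    proof (rule integral_le)
      show "(\<lambda>y. 2 * exp (- 2) / R ^ N * (m + f y)) integrable_on cube x h" by (rule integrable_on_mult_right[OF mfi])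
      show "(\<lambda>y. ?k R y * (m + f y)) integrable_on cube x h" by (rule kmi)
      show "2 * exp (- 2) / R ^ N * (m + f y) \<le> ?k R y * (m + f y)" if "y \<in> cube x h" for y
        using low[OF that] fm[of y] by (intro mult_right_mono) auto
    qed
    also have "\<dots> \<le> integral (cube x0 R) (\<lambda>y. ?k R y * (m + f y))"
    proof (rule integral_subset_le[OF sub])
      show "(\<lambda>y. ?k R y * (m + f y)) integrable_on cube x h" "(\<lambda>y. ?k R y * (m + f y)) integrable_on cube x0 R"
        by (rule kmi)+
      have "0 \<le> ?k R y * (m + f y)" for y
        using mean_kernel_nonneg[OF R, of x0 y] fm[of y] by simp
      then show "\<forall>y\<in>cube x0 R. 0 \<le> ?k R y * (m + f y)" by blast
    qed
    also note big
    finally have "2 * exp (- 2) / R ^ N * integral (cube x h) (\<lambda>y. m + f y) \<le> (2 * \<bar>I\<bar> + 2 ^ N) * (\<delta> + A * R\<^sup>2)" .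
    then have "(R ^ N * (exp 2 / 2)) * (2 * exp (- 2) / R ^ N * integral (cube x h) (\<lambda>y. m + f y))
       \<le> (R ^ N * (exp 2 / 2)) * ((2 * \<bar>I\<bar> + 2 ^ N) * (\<delta> + A * R\<^sup>2))"
      using R by (intro mult_left_mono) auto
    moreover have "(R ^ N * (exp 2 / 2)) * (2 * exp (- 2) / R ^ N * X) = X" for X
      using R by (simp add: exp_minus field_simps)
    moreover have "R ^ N = (2 * N) ^ N * (R / (2 * N)) ^ N" 
      using power_mult_distrib[of "real (2 * N)" "R / real (2 * N)" N] N by simp
    ultimately have "integral (cube x h) (\<lambda>y. m + f y) \<le> (2 * N) ^ N * (R / (2 * N)) ^ N * (exp 2 / 2) * ((2 * \<bar>I\<bar> + 2 ^ N) * (\<delta> + A * R\<^sup>2))"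
      by simp
    also have "\<dots> = C * (\<delta> + A * R\<^sup>2) * (R / (2 * N)) ^ N" by (simp add: C_def mult_ac)
    finally show "integral (cube x (R / (4 * DIM('a)))) (\<lambda>y. m + f y) \<le> C * (\<delta> + A * R\<^sup>2) * (R / (2 * DIM('a))) ^ DIM('a)"
      by (simp add: h_def N_def)
  qed
qed

section \<open>Spatial averages of solutions\<close>

lemma powr_tangent:
  fixes z g q :: real
  assumes q: "1 < q" and z: "0 < z" and g: "0 \<le> g"
  shows "z powr q + q * z powr (q - 1) * (g - z) \<le> g powr q"
proof -
  have d: "((\<lambda>x. x powr q) has_derivative (*) (q * x powr (q - 1))) (at x)" if "0 < x" for x
    using has_real_derivative_powr[OF that] by (simp add: has_field_derivative_def)
  have c: "continuous_on {a..b} (\<lambda>x. x powr q)" if "0 \<le> a" for a b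
    using q that by (intro continuous_on_powr') (auto intro!: continuous_intros)
  consider "g = z" | "g < z" | "z < g" by linarith
  then show ?thesis
  proof cases
    case 2
    have "((\<lambda>x. x powr q) has_derivative (*) (q * x powr (q - 1))) (at x)" if "g < x" "x < z" for x
      using d[of x] g that by simp
    from mvt[OF 2 c[OF g] this] obtain \<xi>
      where \<xi>: "g < \<xi>" "\<xi> < z" "z powr q - g powr q = q * \<xi> powr (q - 1) * (z - g)" by blast
    have "q * \<xi> powr (q - 1) * (z - g) \<le> q * z powr (q - 1) * (z - g)"
      using \<xi> 2 q g by (intro mult_right_mono mult_left_mono powr_mono2) auto
    with \<xi>(3) show ?thesis by (simp add: algebra_simps)
  next
    case 3
    have "((\<lambda>x. x powr q) has_derivative (*) (q * x powr (q - 1))) (at x)" if "z < x" "x < g" for x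
      using d[of x] z that by simp
    from mvt[OF 3 c[OF less_imp_le[OF z]] this] obtain \<xi>
      where \<xi>: "z < \<xi>" "\<xi> < g" "g powr q - z powr q = q * \<xi> powr (q - 1) * (g - z)" by blast
    have "q * z powr (q - 1) * (g - z) \<le> q * \<xi> powr (q - 1) * (g - z)"
      using \<xi> 3 q z by (intro mult_right_mono mult_left_mono powr_mono2) auto
    with \<xi>(3) show ?thesis by (simp add: algebra_simps)
  qed simp
qed

text \<open>The tangent plane to |.| powr q at \<open>\<zeta>\<close>, reduced by Cauchy-Schwarz to
  the tangent of the scalar power. In the form with exponent q - 2 the left side is 0 for
  \<open>\<zeta>\<close> = 0, by \<open>0 powr a = 0\<close>.\<close>

lemma norm_powr_tangent:
  fixes G \<zeta> :: "'a::euclidean_space"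
  assumes q: "1 < q"
  shows "norm \<zeta> powr q + q * norm \<zeta> powr (q - 2) * (\<zeta> \<bullet> G - (norm \<zeta>)\<^sup>2) \<le> norm G powr q"
proof (cases "\<zeta> = 0")
  case False
  define z where "z = norm \<zeta>"
  have z: "0 < z" using False by (simp add: z_def)
  have "\<zeta> \<bullet> G - z\<^sup>2 \<le> z * (norm G - z)"
    using norm_cauchy_schwarz[of \<zeta> G] by (simp add: z_def algebra_simps power2_eq_square)
  then have "q * z powr (q - 2) * (\<zeta> \<bullet> G - z\<^sup>2) \<le> q * z powr (q - 2) * (z * (norm G - z))"
    using q by (intro mult_left_mono) auto
  also have "z powr (q - 2) * z = z powr (q - 1)" using z powr_add[of z "q - 2" 1] by simp
  then have "q * z powr (q - 2) * (z * (norm G - z)) = q * z powr (q - 1) * (norm G - z)"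
    by (metis mult.assoc)
  finally show ?thesis using powr_tangent[OF q z norm_ge_zero[of G]] by (simp add: z_def)
qed simp

text \<open>Over a fixed compact cube the Leibniz rule exchanges all derivatives with the average,
  so that the linear terms are carried over exactly; only the gradient term changes, and Jensen's
  inequality gives the right sign.\<close>

lemma averaged_supersolution:
  fixes u :: "real \<Rightarrow> 'a::euclidean_space \<Rightarrow> real"
  assumes q: "1 < q" and h: "0 < h" and sol: "solves_VHJ q u"
    and cont: "continuous_on ({0..} \<times> UNIV) (\<lambda>(t, x). u t x)" and nonpos: "\<And>t x. 0 \<le> t \<Longrightarrow> u t x \<le> 0"
  shows "supersolution q (\<lambda>t x. - (1 / (2 * h) ^ DIM('a)) * integral (cube 0 h) (\<lambda>y. u t (x + y)))"
proof -
  define Q where "Q = cube (0::'a) h"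
  define a where "a = - (1 / (2 * h) ^ DIM('a))"
  have a: "a < 0" using h by (simp add: a_def)
  have C: "C_2_1 u" and eq: "\<And>t x. 0 < t \<Longrightarrow> deriv (\<lambda>s. u s x) t - laplacian (u t) x + norm (grad (u t) x) powr q = 0"
    using sol by (auto simp: solves_VHJ_def)
  note ax = C_2_1_axis_derivs[OF C]
  define ut where "ut t x = deriv (\<lambda>s. u s x) t" for t x
  define u1 where "u1 b t x = partial_deriv b (u t) x" for b t x
  define u2 where "u2 b t x = partial_deriv b (partial_deriv b (u t)) x" for b t x
  have uc: "continuous_on ({0<..} \<times> UNIV) (\<lambda>(t, x). u t x)"
    and utc: "continuous_on ({0<..} \<times> UNIV) (\<lambda>(t, x). ut t x)"
    and u1c: "\<And>b. b \<in> Basis \<Longrightarrow> continuous_on ({0<..} \<times> UNIV) (\<lambda>(t, x). u1 b t x)"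
    and u2c: "\<And>b. b \<in> Basis \<Longrightarrow> continuous_on ({0<..} \<times> UNIV) (\<lambda>(t, x). u2 b t x)"
    using C by (auto simp: C_2_1_def ut_def u1_def u2_def)
  have slice: "continuous_on S (\<lambda>y. g t (f y))" if "continuous_on ({0<..} \<times> UNIV) (\<lambda>(t, x). g t x)" "0 < t" "continuous_on S f"
    for g :: "real \<Rightarrow> 'a \<Rightarrow> real" and t and S :: "'b::topological_space set" and f
  proof -
    have "continuous_on S (\<lambda>y. (\<lambda>(t, x). g t x) (t, f y))"
      by (rule continuous_on_compose2[OF that(1)]) (use that in \<open>auto intro!: continuous_intros\<close>)
    then show ?thesis by simp
  qed
  have int: "(\<lambda>y. g t (x + y)) integrable_on Q" if "continuous_on ({0<..} \<times> UNIV) (\<lambda>(t, x). g t x)" "0 < t"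
    for g :: "real \<Rightarrow> 'a \<Rightarrow> real" and t x
    unfolding Q_def by (intro integrable_continuous slice[OF that] continuous_intros)
  define I where "I g t x = integral Q (\<lambda>y. g t (x + y))" for g :: "real \<Rightarrow> 'a \<Rightarrow> real" and t x
  have dt: "((\<lambda>s. I u s x) has_real_derivative I ut t x) (at t)" if t: "0 < t" for t x
  proof -
    have "((\<lambda>s. I u s x) has_real_derivative I ut t x) (at t within {0<..})"
      unfolding I_def Q_def
    proof (rule leibniz_rule_field_derivative)
      show "((\<lambda>s. u s (x + y)) has_real_derivative ut s (x + y)) (at s within {0<..})" if "s \<in> {0<..}" for s y
        using that unfolding ut_def by (intro has_field_derivative_at_within[OF ax(1)]) auto
      show "(\<lambda>y. u s (x + y)) integrable_on cube 0 h" if "s \<in> {0<..}" for s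
        using int[OF uc, of s x] that by (simp add: Q_def)
      have "continuous_on ({0<..} \<times> cube 0 h) (\<lambda>z. (\<lambda>(t, x). ut t x) (fst z, x + snd z))"
        by (rule continuous_on_compose2[OF utc]) (auto intro!: continuous_intros)
      then show "continuous_on ({0<..} \<times> cube 0 h) (\<lambda>(s, y). ut s (x + y))" by (simp add: split_beta)
    qed (use t in auto)
    with at_within_open[of t "{0<..}"] t show ?thesis by simp
  qed
  have dx: "axis_deriv (I g t) (I g' t x) b x"
    if t: "0 < t" and g: "continuous_on ({0<..} \<times> UNIV) (\<lambda>(t, x). g t x)" and g': "continuous_on ({0<..} \<times> UNIV) (\<lambda>(t, x). g' t x)"
      and d: "\<And>x. axis_deriv (g t) (g' t x) b x" for g g' :: "real \<Rightarrow> 'a \<Rightarrow> real" and t x b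
  proof -
    have "((\<lambda>s. integral (cube 0 h) (\<lambda>y. g t ((x + y) + s *\<^sub>R b))) has_real_derivative integral (cube 0 h) (\<lambda>y. g' t ((x + y) + 0 *\<^sub>R b))) (at 0 within UNIV)"
    proof (rule leibniz_rule_field_derivative)
      show "((\<lambda>s. g t ((x + y) + s *\<^sub>R b)) has_real_derivative g' t ((x + y) + s *\<^sub>R b)) (at s within UNIV)" for s y
        by (rule axis_deriv_shift[OF d])
      show "(\<lambda>y. g t ((x + y) + s *\<^sub>R b)) integrable_on cube 0 h" for s
        by (intro integrable_continuous slice[OF g t] continuous_intros)
      show "continuous_on (UNIV \<times> cube 0 h) (\<lambda>(s, y). g' t ((x + y) + s *\<^sub>R b))"
        unfolding split_beta by (intro slice[OF g' t] continuous_intros)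
    qed auto
    then show ?thesis by (simp add: I_def Q_def add_ac)
  qed
  have Qc: "measure lborel Q = (2 * h) ^ DIM('a)"
    unfolding Q_def by (rule measure_cube[OF h])
  have V: "measure lborel Q * - a = 1" using h by (simp add: Qc a_def)
  have w: "(\<lambda>t x. - (1 / (2 * h) ^ DIM('a)) * integral (cube 0 h) (\<lambda>y. u t (x + y))) = (\<lambda>t x. a * I u t x)"
    by (simp add: a_def I_def Q_def)
  show ?thesis unfolding w supersolution_def
  proof (intro conjI exI allI impI ballI)
    have uc0: "continuous_on ({0..} \<times> Q) (\<lambda>z. u (fst z) (x + snd z))" for x
    proof -
      have "continuous_on ({0..} \<times> Q) (\<lambda>z. (\<lambda>(t, x). u t x) (fst z, x + snd z))"
        by (rule continuous_on_compose2[OF cont]) (auto intro!: continuous_intros)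
      then show ?thesis by simp
    qed
    show "0 \<le> a * I u t x" if t: "0 \<le> t" for t x
    proof -
      have "continuous_on Q (\<lambda>y. (\<lambda>z. u (fst z) (x + snd z)) (t, y))"
        by (rule continuous_on_compose2[OF uc0]) (use t in \<open>auto intro!: continuous_intros\<close>)
      then have "(\<lambda>y. u t (x + y)) integrable_on Q" unfolding Q_def by (intro integrable_continuous) simp
      then have "I u t x \<le> integral Q (\<lambda>y. 0)" unfolding I_def
        by (rule integral_le[OF _ integrable_0]) (use nonpos t in auto)
      then show ?thesis using a by (simp add: mult_nonpos_nonpos)
    qed
    have "continuous_on (({0..} \<times> UNIV) \<times> cube 0 h) (\<lambda>z. (\<lambda>(t, x). u t x) (fst (fst z), snd (fst z) + snd z))"
      by (rule continuous_on_compose2[OF cont]) (auto intro!: continuous_intros)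
    then have "continuous_on (({0..} \<times> UNIV) \<times> cube 0 h) (\<lambda>(z, y). u (fst z) (snd z + y))" by (simp add: split_beta)
    then have "continuous_on ({0..} \<times> UNIV) (\<lambda>z. integral (cube 0 h) (\<lambda>y. u (fst z) (snd z + y)))"
      by (rule integral_continuous_on_param)
    then show "continuous_on ({0..} \<times> UNIV) (\<lambda>(t, x). a * I u t x)"
      unfolding I_def Q_def split_beta by (intro continuous_on_mult continuous_on_const)
    fix t :: real and x :: 'a assume t: "0 < t"
    show "((\<lambda>s. a * I u s x) has_real_derivative a * I ut t x) (at t)" by (rule DERIV_cmult[OF dt[OF t]])
    show "axis_deriv (\<lambda>x. a * I u t x) (a * I (u1 b) t x) b x" if b: "b \<in> Basis" for b
      by (rule DERIV_cmult[OF dx[OF t uc u1c[OF b]]]) (use ax(2)[OF t b] in \<open>simp add: u1_def\<close>)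
    show "axis_deriv (\<lambda>x. a * I (u1 b) t x) (a * I (u2 b) t x) b x" if b: "b \<in> Basis" for b
      by (rule DERIV_cmult[OF dx[OF t u1c[OF b] u2c[OF b]]]) (use ax(3)[OF t b] in \<open>simp add: u1_def[abs_def] u2_def\<close>)
    define \<zeta> where "\<zeta> = (\<Sum>b\<in>Basis. (a * I (u1 b) t x) *\<^sub>R b)"
    define G where "G y = - grad (u t) (x + y)" for y
    have Gb: "G y \<bullet> b = - u1 b t (x + y)" if "b \<in> Basis" for y b
      using that by (simp add: G_def grad_def u1_def)
    have \<zeta>b: "\<zeta> \<bullet> b = a * I (u1 b) t x" if "b \<in> Basis" for b
      using that by (simp add: \<zeta>_def)
    have ic: "(\<lambda>y. u1 b t (x + y)) integrable_on Q" "(\<lambda>y. u2 b t (x + y)) integrable_on Q" if "b \<in> Basis" for b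
      by (rule int[OF u1c[OF that] t], rule int[OF u2c[OF that] t])
    have \<zeta>G: "\<zeta> \<bullet> G y = (\<Sum>b\<in>Basis. (- (\<zeta> \<bullet> b)) * u1 b t (x + y))" for y
      unfolding euclidean_inner[of \<zeta> "G y"] by (intro sum.cong refl) (simp add: Gb)
    have i\<zeta>G: "(\<lambda>y. \<zeta> \<bullet> G y) integrable_on Q"
      unfolding \<zeta>G by (intro integrable_sum integrable_on_mult_right ic) auto
    have "integral Q (\<lambda>y. \<zeta> \<bullet> G y) = (\<Sum>b\<in>Basis. integral Q (\<lambda>y. (- (\<zeta> \<bullet> b)) * u1 b t (x + y)))"
      unfolding \<zeta>G by (intro integral_sum integrable_on_mult_right ic) auto
    also have "\<dots> = (\<Sum>b\<in>Basis. (- (\<zeta> \<bullet> b)) * I (u1 b) t x)" by (simp only: integral_mult_right I_def)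
    also have "\<dots> = (\<Sum>b\<in>Basis. measure lborel Q * ((\<zeta> \<bullet> b) * (\<zeta> \<bullet> b)))"
    proof (intro sum.cong refl)
      fix b :: 'a assume b: "b \<in> Basis"
      have "(- (\<zeta> \<bullet> b)) * I (u1 b) t x = (measure lborel Q * - a) * ((- (\<zeta> \<bullet> b)) * I (u1 b) t x)" by (simp only: V)
      also have "\<dots> = measure lborel Q * ((\<zeta> \<bullet> b) * (\<zeta> \<bullet> b))" unfolding \<zeta>b[OF b] by (simp add: algebra_simps)
      finally show "(- (\<zeta> \<bullet> b)) * I (u1 b) t x = measure lborel Q * ((\<zeta> \<bullet> b) * (\<zeta> \<bullet> b))" .
    qed
    also have "\<dots> = measure lborel Q * (norm \<zeta>)\<^sup>2" by (simp only: sum_distrib_left[symmetric] sum_inner_square)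
    \<comment> \<open>\<open>\<zeta>\<close> is the mean of \<open>G\<close> over the cube, so after
      integration the first-order part of the tangent inequality at \<open>\<zeta>\<close> drops
      out; what is left is Jensen's inequality.\<close>
    finally have mean: "integral Q (\<lambda>y. \<zeta> \<bullet> G y) = measure lborel Q * (norm \<zeta>)\<^sup>2" .
    have const: "(\<lambda>y. c) integrable_on Q" for c :: real unfolding Q_def by (rule integrable_const)
    have ci: "integral Q (\<lambda>y. c) = measure lborel Q * c" for c :: real unfolding Q_def by simp
    let ?d = "q * norm \<zeta> powr (q - 2)"
    have iN: "(\<lambda>y. norm \<zeta> powr q + ?d * (\<zeta> \<bullet> G y - (norm \<zeta>)\<^sup>2)) integrable_on Q"
      by (intro integrable_add const integrable_on_mult_right integrable_diff i\<zeta>G)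
    have lap: "norm (G y) powr q = (\<Sum>b\<in>Basis. u2 b t (x + y)) - ut t (x + y)" for y
      using eq[OF t, of "x + y"] by (simp add: G_def laplacian_def u2_def ut_def)
    have isum: "(\<lambda>y. \<Sum>b\<in>Basis. u2 b t (x + y)) integrable_on Q" by (intro integrable_sum ic) auto
    have iut: "(\<lambda>y. ut t (x + y)) integrable_on Q" by (rule int[OF utc t])
    have "measure lborel Q * norm \<zeta> powr q = integral Q (\<lambda>y. norm \<zeta> powr q + ?d * (\<zeta> \<bullet> G y - (norm \<zeta>)\<^sup>2))"
      by (simp add: integral_add[OF const integrable_on_mult_right[OF integrable_diff[OF i\<zeta>G const]]]
          integral_mult_right integral_diff[OF i\<zeta>G const] mean ci)
    also have "\<dots> \<le> integral Q (\<lambda>y. norm (G y) powr q)"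
    proof (rule integral_le[OF iN])
      show "(\<lambda>y. norm (G y) powr q) integrable_on Q" unfolding lap by (rule integrable_diff[OF isum iut])
      show "norm \<zeta> powr q + ?d * (\<zeta> \<bullet> G y - (norm \<zeta>)\<^sup>2) \<le> norm (G y) powr q" for y
        by (rule norm_powr_tangent[OF q])
    qed
    also have "\<dots> = integral Q (\<lambda>y. \<Sum>b\<in>Basis. u2 b t (x + y)) - I ut t x"
      unfolding lap I_def by (rule integral_diff[OF isum iut])
    also have "integral Q (\<lambda>y. \<Sum>b\<in>Basis. u2 b t (x + y)) = (\<Sum>b\<in>Basis. I (u2 b) t x)"
      unfolding I_def by (rule integral_sum) (use ic in auto)
    finally have "(measure lborel Q * norm \<zeta> powr q) * - a \<le> ((\<Sum>b\<in>Basis. I (u2 b) t x) - I ut t x) * - a"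
      using a by (intro mult_right_mono) auto
    moreover have "(measure lborel Q * norm \<zeta> powr q) * - a = norm \<zeta> powr q"
      using V by (metis mult.assoc mult.commute mult_1)
    ultimately show "(\<Sum>b\<in>Basis. a * I (u2 b) t x) + norm (\<Sum>b\<in>Basis. (a * I (u1 b) t x) *\<^sub>R b) powr q \<le> a * I ut t x"
      unfolding \<zeta>_def[symmetric] sum_distrib_left[symmetric] by (simp add: algebra_simps)
  qed
qed

section \<open>Maximum principles\<close>

text \<open>Adding a penalty e(t) (1 + |x|^2) to the bounded lower side of \<open>g\<close> makes
  the boundary of a large ball harmless, so that comparison on compact sets reaches the whole space.
  \<open>key\<close> is tested where the gradient of \<open>g\<close> is minus that of the penalty,
  with a slack that the growth of e pays for.\<close>

lemma quadratic_comparison: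
  fixes g :: "real \<Rightarrow> 'a::euclidean_space \<Rightarrow> real"
  assumes cont: "continuous_on ({s..T} \<times> UNIV) (\<lambda>(t, x). g t x)"
    and bd: "\<And>t x. s \<le> t \<Longrightarrow> t \<le> T \<Longrightarrow> - B \<le> g t x" and init: "\<And>x. 0 \<le> g s x"
    and dt: "\<And>t x. s < t \<Longrightarrow> t \<le> T \<Longrightarrow> ((\<lambda>s. g s x) has_real_derivative gt t x) (at t)"
    and d1: "\<And>t x b. s < t \<Longrightarrow> t \<le> T \<Longrightarrow> b \<in> Basis \<Longrightarrow> axis_deriv (g t) (g1 b t x) b x"
    and d2: "\<And>t x b. s < t \<Longrightarrow> t \<le> T \<Longrightarrow> b \<in> Basis \<Longrightarrow> axis_deriv (g1 b t) (g2 b t x) b x"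
    and key: "\<And>t x \<eta>. s < t \<Longrightarrow> t \<le> T \<Longrightarrow> 0 < \<eta> \<Longrightarrow> \<eta> \<le> 1 \<Longrightarrow> (\<And>b. b \<in> Basis \<Longrightarrow> g1 b t x = - (2 * \<eta> * (x \<bullet> b))) \<Longrightarrow>
       (\<Sum>b\<in>Basis. g2 b t x) - 5 * \<eta> * (1 + (norm x)\<^sup>2) < gt t x"
    and t: "s \<le> t" "t \<le> T"
  shows "0 \<le> g t x"
proof (rule ccontr)
  assume "\<not> 0 \<le> g t x"
  then have neg: "g t x < 0" by simp
  \<comment> \<open>2 n pays for the Laplacian of the penalty, 5 for the slack in
    \<open>key\<close>.\<close>
  define l where "l = 2 * real DIM('a) + 5"
  define E where "E = exp (l * (T - s))"
  have l: "0 < l" by (simp add: l_def)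
  have E: "1 \<le> E" "0 < E" using l t by (auto simp: E_def)
  have x1: "0 < 1 + (norm x)\<^sup>2" by (simp add: add_pos_nonneg)
  \<comment> \<open>The first bound keeps e(t) at most 1, which \<open>key\<close> may assume; the
    second keeps the penalty at the given point at most half of - g t x.\<close>
  define \<epsilon> where "\<epsilon> = min (1 / E) (- g t x / (2 * E * (1 + (norm x)\<^sup>2)))"
  have "0 < - g t x / (2 * E * (1 + (norm x)\<^sup>2))" using neg E x1 by (intro divide_pos_pos mult_pos_pos) auto
  then have \<epsilon>: "0 < \<epsilon>" "\<epsilon> \<le> 1 / E" "\<epsilon> \<le> - g t x / (2 * E * (1 + (norm x)\<^sup>2))" using E by (auto simp: \<epsilon>_def)
  define e where "e t = \<epsilon> * exp (l * (t - s))" for t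
  have e: "0 < e t" for t using \<epsilon> by (simp add: e_def)
  have eE: "e t \<le> \<epsilon> * E" if "t \<le> T" for t using that l \<epsilon> by (simp add: e_def E_def)
  have e1: "e t \<le> 1" if "t \<le> T" for t
    using eE[OF that] \<epsilon>(2) E by (simp add: le_divide_eq)
  have ege: "\<epsilon> \<le> e t" if "s \<le> t" for t using that l \<epsilon> by (simp add: e_def)
  define \<rho> where "\<rho> = norm x + \<bar>B\<bar> / \<epsilon> + 1"
  have \<rho>1: "1 \<le> \<rho>" "norm x \<le> \<rho>" "\<bar>B\<bar> / \<epsilon> \<le> \<rho>" using \<epsilon> by (auto simp: \<rho>_def)
  have "0 \<le> g t x + e t * (1 + (norm x)\<^sup>2)"
  proof (rule parabolic_comparison[where K = "cball 0 \<rho>" and a = s and T = T and D = "\<lambda>t x. g t x + e t * (1 + (norm x)\<^sup>2)"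
        and Dt = "\<lambda>t x. gt t x + l * e t * (1 + (norm x)\<^sup>2)" and ?D1.0 = "\<lambda>b t x. g1 b t x + e t * (2 * (x \<bullet> b))"
        and ?D2.0 = "\<lambda>b t x. g2 b t x + e t * 2"])
    have "continuous_on ({s..T} \<times> cball 0 \<rho>) (\<lambda>z. g (fst z) (snd z))"
    proof -
      have "{s..T} \<times> cball 0 \<rho> \<subseteq> {s..T} \<times> (UNIV :: 'a set)" by auto
      from continuous_on_subset[OF cont this] show ?thesis by (simp add: split_beta)
    qed
    then show "continuous_on ({s..T} \<times> cball 0 \<rho>) (\<lambda>(t, x). g t x + e t * (1 + (norm x)\<^sup>2))"
      unfolding split_beta e_def by (intro continuous_on_add) (auto intro!: continuous_intros)
    show "0 \<le> g s x + e s * (1 + (norm x)\<^sup>2)" for x using init[of x] e[of s] by (simp add: add_nonneg_nonneg)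
    show "0 \<le> g t x + e t * (1 + (norm x)\<^sup>2)" if "s < t" "t \<le> T" "x \<in> cball 0 \<rho>" "x \<notin> interior (cball 0 \<rho>)" for t x
    proof -
      have x: "norm x = \<rho>" using that by (simp add: interior_cball)
      have "\<bar>B\<bar> \<le> \<epsilon> * \<rho>" using \<rho>1 \<epsilon> by (simp add: divide_le_eq mult.commute)
      also have "\<dots> \<le> e t * (1 + \<rho>\<^sup>2)"
      proof (rule mult_mono)
        have "\<rho> * 1 \<le> \<rho> * \<rho>" using \<rho>1 by (intro mult_left_mono) auto
        then show "\<rho> \<le> 1 + \<rho>\<^sup>2" by (simp add: power2_eq_square)
      qed (use ege[of t] that \<epsilon> \<rho>1 e[of t] in auto)
      finally show ?thesis using bd[of t x] that x by simp
    qed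
    show "((\<lambda>s. g s x + e s * (1 + (norm x)\<^sup>2)) has_real_derivative gt t x + l * e t * (1 + (norm x)\<^sup>2)) (at t)"
      if "s < t" "t \<le> T" for t x
      by (intro DERIV_add dt that DERIV_cmult_right) (auto intro!: derivative_eq_intros simp: e_def)
    have n2: "axis_deriv (\<lambda>x. 1 + (norm x)\<^sup>2) (2 * (x \<bullet> b)) b x" for x b :: 'a
      unfolding power2_norm_eq_inner
      by (auto intro!: derivative_eq_intros simp: inner_commute has_field_derivative_def fun_eq_iff)
    show "axis_deriv (\<lambda>x. g t x + e t * (1 + (norm x)\<^sup>2)) (g1 b t x + e t * (2 * (x \<bullet> b))) b x"
      if "s < t" "t \<le> T" "b \<in> Basis" for t x b
      by (intro DERIV_add d1 that DERIV_cmult n2)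
    show "axis_deriv (\<lambda>x. g1 b t x + e t * (2 * (x \<bullet> b))) (g2 b t x + e t * 2) b x"
      if "s < t" "t \<le> T" "b \<in> Basis" for t x b
      by (intro DERIV_add d2 that DERIV_cmult)
         (use that in \<open>auto intro!: derivative_eq_intros simp: inner_simps\<close>)
    show "(\<Sum>b\<in>Basis. g2 b t x + e t * 2) < gt t x + l * e t * (1 + (norm x)\<^sup>2)"
      if tt: "s < t" "t \<le> T" and z: "\<And>b. b \<in> Basis \<Longrightarrow> g1 b t x + e t * (2 * (x \<bullet> b)) = 0" for t x
    proof -
      have "(\<Sum>b\<in>Basis. g2 b t x) - 5 * e t * (1 + (norm x)\<^sup>2) < gt t x"
        by (rule key[OF tt e e1[OF tt(2)]]) (use z in \<open>simp add: eq_neg_iff_add_eq_0 mult_ac\<close>)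
      moreover have "0 \<le> real DIM('a) * e t * (norm x)\<^sup>2" using e[of t] by simp
      ultimately show ?thesis by (simp add: sum.distrib l_def algebra_simps)
    qed
  qed (use t \<rho>1 in auto)
  moreover have "e t * (1 + (norm x)\<^sup>2) \<le> \<epsilon> * E * (1 + (norm x)\<^sup>2)"
    using eE[OF t(2)] x1 by (intro mult_right_mono) auto
  moreover have "\<epsilon> * (2 * E * (1 + (norm x)\<^sup>2)) \<le> - g t x"
    using \<epsilon>(3) E x1 by (subst (asm) pos_le_divide_eq) auto
  ultimately show False using neg by (simp add: algebra_simps)
qed

lemma solution_nonpositive:
  fixes u :: "real \<Rightarrow> 'a::euclidean_space \<Rightarrow> real"
  assumes sol: "solves_VHJ q u" and cont: "continuous_on ({0..} \<times> UNIV) (\<lambda>(t, x). u t x)"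
    and bd: "\<And>t x. 0 \<le> t \<Longrightarrow> \<bar>u t x\<bar> \<le> B" and init: "\<And>x. u 0 x \<le> 0" and t: "0 \<le> t"
  shows "u t x \<le> 0"
proof -
  have C: "C_2_1 u" and eq: "\<And>t x. 0 < t \<Longrightarrow> deriv (\<lambda>s. u s x) t - laplacian (u t) x + norm (grad (u t) x) powr q = 0"
    using sol by (auto simp: solves_VHJ_def)
  note ax = C_2_1_axis_derivs[OF C]
  have "0 \<le> - u t x"
  proof (rule quadratic_comparison[where g = "\<lambda>t x. - u t x" and s = 0 and T = t and B = B
        and gt = "\<lambda>t x. - deriv (\<lambda>s. u s x) t" and ?g1.0 = "\<lambda>b t x. - partial_deriv b (u t) x"
        and ?g2.0 = "\<lambda>b t x. - partial_deriv b (partial_deriv b (u t)) x"])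
    show "continuous_on ({0..t} \<times> UNIV) (\<lambda>(t, x). - u t x)"
    proof -
      have "{0..t} \<times> UNIV \<subseteq> {0..} \<times> (UNIV :: 'a set)" by auto
      from continuous_on_minus[OF continuous_on_subset[OF cont this]] show ?thesis by (simp add: split_beta)
    qed
    show "- B \<le> - u t x" if "0 \<le> t" for t x using bd[OF that, of x] by linarith
    show "(\<Sum>b\<in>Basis. - partial_deriv b (partial_deriv b (u t)) x) - 5 * \<eta> * (1 + (norm x)\<^sup>2) < - deriv (\<lambda>s. u s x) t"
      if "0 < t" "0 < \<eta>" for t x \<eta>
    proof -
      have "0 < 5 * \<eta> * (1 + (norm x)\<^sup>2)" using that by (simp add: add_pos_nonneg)
      moreover have "(\<Sum>b\<in>Basis. - partial_deriv b (partial_deriv b (u t)) x) = - laplacian (u t) x"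
        by (simp add: sum_negf laplacian_def)
      ultimately show ?thesis using eq[OF that(1), of x] powr_ge_zero[of "norm (grad (u t) x)" q] by linarith
    qed
  qed (use init t in \<open>auto intro!: DERIV_minus ax\<close>)
  then show ?thesis by simp
qed

text \<open>Constants solve the equation, while the penalty adds |2 \<open>\<eta>\<close> x| powr q.
  For q < 2 and \<open>\<eta>\<close> \<le> 1 this is at most 4 \<open>\<eta>\<close> (1 + |x|^2),
  below the slack with factor 5. The starting time \<open>s\<close> is arbitrary so that the norm
  can be shown not to increase.\<close>

lemma solution_lower_bound:
  fixes u :: "real \<Rightarrow> 'a::euclidean_space \<Rightarrow> real"
  assumes q: "1 < q" "q < 2" and sol: "solves_VHJ q u" and cont: "continuous_on ({0..} \<times> UNIV) (\<lambda>(t, x). u t x)"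
    and bd: "\<And>t x. 0 \<le> t \<Longrightarrow> \<bar>u t x\<bar> \<le> B" and s: "0 \<le> s" and init: "\<And>x. - M \<le> u s x" and t: "s \<le> t"
  shows "- M \<le> u t x"
proof -
  have C: "C_2_1 u" and eq: "\<And>t x. 0 < t \<Longrightarrow> deriv (\<lambda>s. u s x) t - laplacian (u t) x + norm (grad (u t) x) powr q = 0"
    using sol by (auto simp: solves_VHJ_def)
  note ax = C_2_1_axis_derivs[OF C]
  have "0 \<le> u t x + M"
  proof (rule quadratic_comparison[where g = "\<lambda>t x. u t x + M" and s = s and T = t and B = "B + \<bar>M\<bar>"
        and gt = "\<lambda>t x. deriv (\<lambda>s. u s x) t" and ?g1.0 = "\<lambda>b t x. partial_deriv b (u t) x"
        and ?g2.0 = "\<lambda>b t x. partial_deriv b (partial_deriv b (u t)) x"])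
    show "continuous_on ({s..t} \<times> UNIV) (\<lambda>(t, x). u t x + M)"
    proof -
      have "{s..t} \<times> UNIV \<subseteq> {0..} \<times> (UNIV :: 'a set)" using s by auto
      from continuous_on_add[OF continuous_on_subset[OF cont this] continuous_on_const[of _ M]]
      show ?thesis by (simp add: split_beta)
    qed
    show "- (B + \<bar>M\<bar>) \<le> u t x + M" if "s \<le> t" for t x using bd[of t x] that s by linarith
    show "0 \<le> u s x + M" for x using init[of x] by simp
    fix t :: real and x :: 'a assume "s < t"
    then have t: "0 < t" using s by simp
    show "((\<lambda>s. u s x + M) has_real_derivative deriv (\<lambda>s. u s x) t) (at t)"
      using DERIV_add[OF ax(1)[OF t] DERIV_const[of M]] by simp
    show "axis_deriv (\<lambda>x. u t x + M) (partial_deriv b (u t) x) b x" if "b \<in> Basis" for b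
      using DERIV_add[OF ax(2)[OF t that] DERIV_const[of M]] by simp
    show "axis_deriv (partial_deriv b (u t)) (partial_deriv b (partial_deriv b (u t)) x) b x" if "b \<in> Basis" for b
      by (rule ax(3)[OF t that])
    fix \<eta> :: real assume \<eta>: "0 < \<eta>" "\<eta> \<le> 1"
      and z: "\<And>b. b \<in> Basis \<Longrightarrow> partial_deriv b (u t) x = - (2 * \<eta> * (x \<bullet> b))"
    have "grad (u t) x = (\<Sum>b\<in>Basis. (- (2 * \<eta>)) *\<^sub>R ((x \<bullet> b) *\<^sub>R b))"
      unfolding grad_def by (intro sum.cong refl) (simp add: z)
    also have "\<dots> = (- (2 * \<eta>)) *\<^sub>R x" by (simp only: scaleR_sum_right[symmetric] euclidean_representation)
    finally have "norm (grad (u t) x) = 2 * \<eta> * norm x" using \<eta> by simp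
    then have "norm (grad (u t) x) powr q = 2 powr q * \<eta> powr q * norm x powr q"
      using \<eta> by (simp add: powr_mult)
    also have "\<dots> \<le> 4 * \<eta> * (1 + (norm x)\<^sup>2)"
    proof (intro mult_mono)
      show "2 powr q \<le> 4" using powr_mono[of q 2 2] q by (simp add: powr_numeral)
      show "\<eta> powr q \<le> \<eta>" using powr_mono'[of 1 q \<eta>] \<eta> q by simp
      show "norm x powr q \<le> 1 + (norm x)\<^sup>2"
      proof (cases "norm x \<le> 1")
        case True
        then have "norm x powr q \<le> 1 powr q" using q by (intro powr_mono2) auto
        then show ?thesis by (simp add: add_increasing2)
      next
        case False
        then have "norm x powr q \<le> norm x powr 2" using q by (intro powr_mono) auto
        also have "norm x powr 2 = (norm x)\<^sup>2" using False by simp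
        finally show ?thesis by simp
      qed
    qed (use \<eta> in auto)
    finally have g: "norm (grad (u t) x) powr q \<le> 4 * (\<eta> * (1 + (norm x)\<^sup>2))" by simp
    have "0 < \<eta> * (1 + (norm x)\<^sup>2)" using \<eta> by (simp add: add_pos_nonneg)
    then show "(\<Sum>b\<in>Basis. partial_deriv b (partial_deriv b (u t)) x) - 5 * \<eta> * (1 + (norm x)\<^sup>2) < deriv (\<lambda>s. u s x) t"
      using eq[OF t, of x] g unfolding laplacian_def by simp
  qed (use t in auto)
  then show ?thesis by simp
qed

section \<open>Non-decaying solutions\<close>

lemma Lp_norm_infinity_le:
  fixes f :: "'a::euclidean_space \<Rightarrow> real"
  assumes "continuous_on UNIV f" "\<And>x. \<bar>f x\<bar> \<le> c"
  shows "Lp_norm \<infinity> f \<le> ennreal c"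
  using continuous_measurable_lebesgue[OF assms(1)] assms(2)
  by (auto simp: Lp_norm_def intro!: esssup_I ennreal_leI)

text \<open>By continuity the set where the bound holds is closed, and a closed set containing
  almost every point is the whole space.\<close>

lemma Lp_norm_infinity_bound:
  fixes f :: "'a::euclidean_space \<Rightarrow> real"
  assumes f: "continuous_on UNIV f" and c: "0 \<le> c" and le: "Lp_norm \<infinity> f \<le> ennreal c"
  shows "\<bar>f x\<bar> \<le> c"
proof -
  have "AE x in lebesgue. ennreal (norm (f x)) \<le> esssup lebesgue (\<lambda>x. ennreal (norm (f x)))" by (rule esssup_AE)
  then have "AE x in lebesgue. x \<in> {x. \<bar>f x\<bar> \<le> c}"
    using le c by (auto simp: Lp_norm_def elim!: eventually_mono dest: order.trans)
  then have "AE x \<in> UNIV in lebesgue. x \<in> {x. \<bar>f x\<bar> \<le> c}" by simp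
  moreover have "closed {x. \<bar>f x\<bar> \<le> c}"
    using continuous_closed_preimage[OF f closed_UNIV, of "{- c..c}"] by (simp add: vimage_def abs_le_iff)
       (metis (no_types, lifting) Collect_cong minus_le_iff)
  ultimately show ?thesis using mem_closed_if_AE_lebesgue_open[of UNIV "{x. \<bar>f x\<bar> \<le> c}" x] by simp
qed

lemma integral_cube_shift:
  fixes f :: "'a::euclidean_space \<Rightarrow> real"
  assumes "continuous_on UNIV f"
  shows "integral (cube 0 h) (\<lambda>y. f (x + y)) = integral (cube x h) f"
proof -
  have "f integrable_on cube x h" by (intro integrable_continuous continuous_on_subset[OF assms]) simp
  from has_integral_affinity'[OF integrable_integral[OF this], of 1 x]
  have "((\<lambda>y. f (y + x)) has_integral integral (cube x h) f) (cube 0 h)" by simp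
  then show ?thesis by (simp add: integral_unique add.commute)
qed

lemma antimono_tendsto_Inf:
  fixes g :: "real \<Rightarrow> ennreal"
  assumes "\<And>s t. 0 \<le> s \<Longrightarrow> s \<le> t \<Longrightarrow> g t \<le> g s"
  shows "(g \<longlongrightarrow> Inf (g ` {0..})) at_top"
proof (rule order_tendstoI)
  fix a assume "a < Inf (g ` {0..})"
  then have lt: "a < g t" if "0 \<le> t" for t using that by (auto intro: less_le_trans Inf_lower)
  show "\<forall>\<^sub>F t in at_top. a < g t"
    by (rule eventually_mono[OF eventually_ge_at_top[of "0::real"]]) (rule lt)
next
  fix a assume "Inf (g ` {0..}) < a"
  then obtain s where "0 \<le> s" "g s < a" by (auto simp: Inf_less_iff)
  then have lt: "g t < a" if "s \<le> t" for t using assms[OF _ that] le_less_trans by blast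
  show "\<forall>\<^sub>F t in at_top. g t < a"
    by (rule eventually_mono[OF eventually_ge_at_top[of s]]) (rule lt)
qed

lemma continuous_slice:
  assumes "continuous_on ({0..} \<times> UNIV) (\<lambda>(t, x). u t x)" "(0::real) \<le> t"
  shows "continuous_on UNIV (u t)"
proof -
  have "continuous_on UNIV (\<lambda>x. (\<lambda>(t, x). u t x) (t, x))"
    by (rule continuous_on_compose2[OF assms(1)]) (use assms(2) in \<open>auto intro!: continuous_intros\<close>)
  then show ?thesis by simp
qed

text \<open>Inserting R^2 = m / (4 C A) turns the claim into a lower bound for m powr
  \<open>\<sigma>\<close> A powr (- e / 2). By (1 - 2 / q) \<open>\<sigma>\<close> = - e / 2 this is
  the \<open>\<sigma>\<close>-th power of m A powr (1 - 2 / q), so a threshold for that product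
  alone suffices; this is where the exponent 1 - 2 / q comes from.\<close>

lemma barrier_threshold:
  fixes q :: real
  assumes q: "1 < q" "q < 2" and p: "p = q / (q - 1)" and L: "0 < L" and C: "0 < C"
  obtains K where "0 \<le> K"
    "\<And>m A R. 0 < m \<Longrightarrow> 0 < A \<Longrightarrow> R = sqrt (m / (4 * C * A)) \<Longrightarrow> K < m * A powr (1 - 2 / q) \<Longrightarrow>
       L * (m / 2 * (R / 4) powr - p) powr (1 - q / 2) < m / 2"
proof -
  define e where "e = p * (2 - q) / 2"
  define \<sigma> where "\<sigma> = q / 2 + e / 2"
  have e: "0 < e" using q by (simp add: e_def p)
  have \<sigma>: "0 < \<sigma>" using q e by (simp add: \<sigma>_def)
  have \<sigma>': "(1 - 2 / q) * \<sigma> = - (e / 2)"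
  proof -
    have "q * (q - 1) \<noteq> 0" using q by simp
    then show ?thesis by (simp add: \<sigma>_def e_def p field_simps)
  qed
  define B where "B = L * (2 powr (q / 2) * (64 * C) powr (e / 2))"
  have B: "0 < B" using L C by (simp add: B_def)
  show ?thesis
  proof (rule that[of "B powr (1 / \<sigma>)"])
    fix m A R :: real
    assume m: "0 < m" and A: "0 < A" and R: "R = sqrt (m / (4 * C * A))" and K: "B powr (1 / \<sigma>) < m * A powr (1 - 2 / q)"
    have R0: "0 < R" using m A C by (simp add: R)
    have "(B powr (1 / \<sigma>)) powr \<sigma> < (m * A powr (1 - 2 / q)) powr \<sigma>"
      using K \<sigma> by (intro powr_less_mono2) auto
    then have "B < m powr \<sigma> * A powr (- (e / 2))"
      using m A B \<sigma> by (simp add: powr_mult powr_powr \<sigma>')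
    also have "m powr \<sigma> = m powr (q / 2) * m powr (e / 2)" by (simp add: \<sigma>_def powr_add)
    finally have "L * (2 powr (q / 2) * (64 * C) powr (e / 2)) < m powr (q / 2) * m powr (e / 2) * A powr (- (e / 2))"
      by (simp add: B_def)
    then have "L * (2 powr (q / 2) * (64 * C) powr (e / 2)) * (2 powr (- (q / 2)) * (64 * C) powr (- (e / 2)))
       < m powr (q / 2) * m powr (e / 2) * A powr (- (e / 2)) * (2 powr (- (q / 2)) * (64 * C) powr (- (e / 2)))"
      using C by (intro mult_strict_right_mono) auto
    moreover have "L * (2 powr (q / 2) * (64 * C) powr (e / 2)) * (2 powr (- (q / 2)) * (64 * C) powr (- (e / 2))) = L"
      using C by (simp add: powr_minus field_simps)
    moreover have "m powr (q / 2) * m powr (e / 2) * A powr (- (e / 2)) * (2 powr (- (q / 2)) * (64 * C) powr (- (e / 2)))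
       = (m / 2) powr (q / 2) * (m / (64 * C * A)) powr (e / 2)"
      using m A C by (simp add: powr_divide powr_mult powr_minus field_simps)
    moreover have "(m / (64 * C * A)) powr (e / 2) = (R / 4) powr e"
    proof -
      have "m / (64 * C * A) = (R / 4)\<^sup>2" using m A C by (simp add: R power_divide)
      also have "\<dots> = (R / 4) powr 2" using R0 by simp
      finally have r: "m / (64 * C * A) = (R / 4) powr 2" .
      show ?thesis unfolding r powr_powr by simp
    qed
    ultimately have big: "L < (m / 2) powr (q / 2) * (R / 4) powr e" by simp
    have "- p * (1 - q / 2) = - e" by (simp add: e_def field_simps)
    then have "(m / 2 * (R / 4) powr - p) powr (1 - q / 2) = (m / 2) powr (1 - q / 2) * (R / 4) powr - e"
      using m R0 powr_mult[of "m / 2" "(R / 4) powr - p" "1 - q / 2"] powr_powr[of "R / 4" "- p" "1 - q / 2"] by simp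
    then have "L * (m / 2 * (R / 4) powr - p) powr (1 - q / 2)
        < ((m / 2) powr (q / 2) * (R / 4) powr e) * ((m / 2) powr (1 - q / 2) * (R / 4) powr - e)"
      using big m R0 by simp
    also have "\<dots> = ((m / 2) powr (q / 2) * (m / 2) powr (1 - q / 2)) * ((R / 4) powr e * (R / 4) powr - e)" by (simp only: mult_ac)
    also have "\<dots> = m / 2" using m R0 by (simp add: powr_add[symmetric])
    finally show "L * (m / 2 * (R / 4) powr - p) powr (1 - q / 2) < m / 2" .
  qed simp
qed

text \<open>The barrier constant and the mean value constant depend on q and the dimension only,
  hence so does \<open>K\<close>. The limit exists by monotonicity and is positive because an
  average of |u| around a fixed point stays above the barrier.\<close>

lemma non_decaying_part:
  fixes q :: real
  assumes q: "1 < q" "q < 2"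
  shows "\<exists>K::real. K \<ge> 0 \<and>
        (\<forall>(u0 :: 'a::euclidean_space \<Rightarrow> real) u.
           u0 \<in> W_inf 2 \<longrightarrow> (\<forall>x. u0 x \<le> 0) \<longrightarrow> is_the_solution q u0 u \<longrightarrow>
           enn2real (Lp_norm \<infinity> u0)
             * enn2real (Lp_norm \<infinity> (\<lambda>x. max (weak_laplacian u0 x) 0)) powr (1 - 2 / q) > K \<longrightarrow>
           (\<exists>l::real. l > 0 \<and> ((\<lambda>t. Lp_norm \<infinity> (u t)) \<longlongrightarrow> ennreal l) at_top))"
proof -
  define p where "p = q / (q - 1)"
  have p0: "0 < p" using q by (simp add: p_def)
  obtain L where L: "0 < L"
    "\<And>(w :: real \<Rightarrow> 'a \<Rightarrow> real) x0 M0 c0 t. supersolution q w \<Longrightarrow> 0 < c0 \<Longrightarrow>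
       (\<And>x. M0 - c0 * norm (x - x0) powr p \<le> w 0 x) \<Longrightarrow> 0 \<le> t \<Longrightarrow>
       M0 - L * c0 powr (1 - q / 2) \<le> w t x0"
    by (rule supersolution_above_barrier[OF q p_def]) blast
  obtain C0 where C0: "0 < C0" and mve:
    "\<And>(f :: 'a \<Rightarrow> real) m A \<delta> R x0 x. continuous_on UNIV f \<Longrightarrow> (\<And>y. - m \<le> f y) \<Longrightarrow> 0 \<le> A \<Longrightarrow> 0 < \<delta> \<Longrightarrow> 0 < R \<Longrightarrow>
      (\<And>\<phi>. test_function \<phi> \<Longrightarrow> (\<And>x. 0 \<le> \<phi> x) \<Longrightarrow>
       integrable lebesgue (\<lambda>x. f x * laplacian \<phi> x) \<and> (LINT x|lebesgue. f x * laplacian \<phi> x) \<le> A * (LINT x|lebesgue. \<phi> x)) \<Longrightarrow>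
      f x0 \<le> - m + \<delta> \<Longrightarrow> norm (x - x0) \<le> R / 4 \<Longrightarrow>
      integral (cube x (R / (4 * DIM('a)))) (\<lambda>y. m + f y) \<le> C0 * (\<delta> + A * R\<^sup>2) * (R / (2 * DIM('a))) ^ DIM('a)"
    by (rule mean_value_estimate[where 'a = 'a]) blast
  define C where "C = C0 + 1"
  have C: "0 < C" "1 < C" "C0 \<le> C" using C0 by (auto simp: C_def)
  obtain K where K: "0 \<le> K" "\<And>m A R. 0 < m \<Longrightarrow> 0 < A \<Longrightarrow> R = sqrt (m / (4 * C * A)) \<Longrightarrow> K < m * A powr (1 - 2 / q) \<Longrightarrow>
       L * (m / 2 * (R / 4) powr - p) powr (1 - q / 2) < m / 2"
    by (rule barrier_threshold[OF q p_def L(1) C(1)]) blast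
  show ?thesis
  proof (rule exI[of _ K], intro conjI allI impI K(1))
    fix u0 :: "'a \<Rightarrow> real" and u
    assume W: "u0 \<in> W_inf 2" and u0: "\<forall>x. u0 x \<le> 0" and is_sol: "is_the_solution q u0 u"
      and large: "K < enn2real (Lp_norm \<infinity> u0) * enn2real (Lp_norm \<infinity> (\<lambda>x. max (weak_laplacian u0 x) 0)) powr (1 - 2 / q)"
    define m where "m = enn2real (Lp_norm \<infinity> u0)"
    define A where "A = enn2real (Lp_norm \<infinity> (\<lambda>x. max (weak_laplacian u0 x) 0))"
    have mA: "K < m * A powr (1 - 2 / q)" using large by (simp add: m_def A_def)
    \<comment> \<open>A zero factor would make the product 0, since \<open>0 powr a = 0\<close> also
      for the negative exponent. As \<open>enn2real\<close> sends infinity to 0, positivity also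
      shows that both norms are finite.\<close>
    have "m \<noteq> 0" "A \<noteq> 0" using mA K(1) by auto
    then have m: "0 < m" and A: "0 < A" by (auto simp: m_def A_def less_le)
    have Lm: "Lp_norm \<infinity> u0 = ennreal m" using m by (cases "Lp_norm \<infinity> u0") (auto simp: m_def)
    have LA: "Lp_norm \<infinity> (\<lambda>x. max (weak_laplacian u0 x) 0) = ennreal A"
      using A by (cases "Lp_norm \<infinity> (\<lambda>x. max (weak_laplacian u0 x) 0)") (auto simp: A_def)
    have cont: "continuous_on ({0..} \<times> UNIV) (\<lambda>(t, x). u t x)" and sol: "solves_VHJ q u" and u00: "u 0 = u0"
      and dec: "\<And>t. 0 < t \<Longrightarrow> Lp_norm \<infinity> (u t) \<le> Lp_norm \<infinity> u0"
      using is_sol by (auto simp: is_the_solution_def)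
    note slice = continuous_slice[OF cont]
    have bd: "\<bar>u t x\<bar> \<le> m" if "0 \<le> t" for t x
    proof (rule Lp_norm_infinity_bound[OF slice[OF that]])
      show "Lp_norm \<infinity> (u t) \<le> ennreal m" using dec[of t] that u00 Lm by (cases "t = 0") auto
    qed (use m in simp)
    have nonpos: "u t x \<le> 0" if "0 \<le> t" for t x
      by (rule solution_nonpositive[OF sol cont bd _ that]) (use u0 u00 in auto)
    \<comment> \<open>Comparison restarted at time \<open>s\<close> with the constant given by the
      norm at that time.\<close>
    have mono: "Lp_norm \<infinity> (u t) \<le> Lp_norm \<infinity> (u s)" if st: "0 \<le> s" "s \<le> t" for s t
    proof -
      have "Lp_norm \<infinity> (u s) \<le> ennreal m" by (rule Lp_norm_infinity_le[OF slice[OF st(1)] bd[OF st(1)]])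
      then have fin: "Lp_norm \<infinity> (u s) < top" by (rule le_less_trans) simp
      define M where "M = enn2real (Lp_norm \<infinity> (u s))"
      have M: "Lp_norm \<infinity> (u s) = ennreal M" using fin by (simp add: M_def)
      have "\<bar>u s x\<bar> \<le> M" for x
        by (rule Lp_norm_infinity_bound[OF slice[OF st(1)] _ eq_refl[OF M]]) (simp add: M_def)
      then have "- M \<le> u s x" for x by (meson abs_le_D2 minus_le_iff)
      from solution_lower_bound[OF q sol cont bd st(1) this st(2)] have "- M \<le> u t x" for x .
      then have "\<bar>u t x\<bar> \<le> M" for x using nonpos[of t x] st by (simp add: abs_le_iff minus_le_iff)
      then show ?thesis unfolding M using st by (intro Lp_norm_infinity_le slice) auto
    qed
    \<comment> \<open>\<open>\<delta>\<close> and A R^2 both equal m / (4 C), so that averages of m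
      + u0 are at most m / 2 and those of - u0 at least m / 2. C > 1 ensures \<open>\<delta>\<close>
      < m.\<close>
    define \<delta> where "\<delta> = m / (4 * C)"
    have \<delta>: "0 < \<delta>" "\<delta> < m" using m C by (auto simp: \<delta>_def divide_less_eq)
    define R where "R = sqrt (m / (4 * C * A))"
    have R: "0 < R" using m A C by (simp add: R_def)
    have AR: "A * R\<^sup>2 = m / (4 * C)" using m A C by (simp add: R_def)
    have "\<exists>x0. u0 x0 \<le> - m + \<delta>"
    proof (rule ccontr)
      assume "\<not> ?thesis"
      then have "\<bar>u0 x\<bar> \<le> m - \<delta>" for x using u0 by (simp add: not_le abs_if) (smt (verit))
      then have "ennreal m \<le> ennreal (m - \<delta>)" unfolding Lm[symmetric] using slice[of 0] u00 by (intro Lp_norm_infinity_le) auto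
      then show False using \<delta> by (simp add: ennreal_le_iff2)
    qed
    then obtain x0 where x0: "u0 x0 \<le> - m + \<delta>" by blast
    have "AE x in lebesgue. ennreal (norm (max (weak_laplacian u0 x) 0)) \<le> ennreal A"
      using esssup_AE[of "\<lambda>x. ennreal (norm (max (weak_laplacian u0 x) 0))" lebesgue] LA by (simp add: Lp_norm_def)
    then have wA: "AE x in lebesgue. weak_laplacian u0 x \<le> A"
      using A by (auto elim!: eventually_mono simp: ennreal_le_iff)
    have lap: "integrable lebesgue (\<lambda>x. u0 x * laplacian \<phi> x) \<and> (LINT x|lebesgue. u0 x * laplacian \<phi> x) \<le> A * (LINT x|lebesgue. \<phi> x)"
      if "test_function \<phi>" "\<And>x. 0 \<le> \<phi> x" for \<phi>
      using weak_laplacian_test(1)[OF W that(1)] laplacian_bounded_above[OF W that wA] by blast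
    define h where "h = R / (4 * DIM('a))"
    have h: "0 < h" using R by (simp add: h_def)
    have h2: "R / (2 * DIM('a)) = 2 * h" by (simp add: h_def)
    define V where "V = (2 * h) ^ DIM('a)"
    have V: "0 < V" using h by (simp add: V_def)
    define w where "w t x = - (1 / V) * integral (cube 0 h) (\<lambda>y. u t (x + y))" for t x
    have sup: "supersolution q w"
      unfolding w_def V_def by (rule averaged_supersolution[OF q(1) h sol cont nonpos])
    have cV: "integral (cube x h) (\<lambda>y. c) = c * V" for c :: real and x :: 'a
      using measure_cube[OF h, of x] by (simp add: V_def)
    have wx: "w t x = - (1 / V) * integral (cube x h) (u t)" if "0 \<le> t" for t x
      unfolding w_def integral_cube_shift[OF slice[OF that]] ..
    have ui: "u t integrable_on cube x h" if "0 \<le> t" for t x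
      by (intro integrable_continuous continuous_on_subset[OF slice[OF that]]) simp
    have near: "m / 2 \<le> w 0 x" if x: "norm (x - x0) \<le> R / 4" for x
    proof -
      have "u0 integrable_on cube x h" using ui[of 0 x] u00 by simp
      from integral_add[OF integrable_const this, of m]
      have "m * V + integral (cube x h) u0 = integral (cube x h) (\<lambda>y. m + u0 y)" by (simp only: cV)
      also have "\<dots> \<le> C0 * (\<delta> + A * R\<^sup>2) * (2 * h) ^ DIM('a)"
        unfolding h_def h2[unfolded h_def, symmetric]
      proof (rule mve[OF _ _ _ \<delta>(1) R lap x0 x])
        show "continuous_on UNIV u0" using slice[of 0] u00 by simp
        show "- m \<le> u0 y" for y using bd[of 0 y] u00 by (simp add: abs_le_iff)
      qed (use A in auto)
      also have "\<dots> \<le> C * (\<delta> + A * R\<^sup>2) * V"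
        unfolding V_def using C \<delta> AR m h by (intro mult_right_mono) auto
      also have "C * (\<delta> + A * R\<^sup>2) = m / 2" using C by (simp add: \<delta>_def AR field_simps)
      finally have "m / 2 * V \<le> - integral (cube x h) u0" by (simp add: algebra_simps)
      then have "m / 2 \<le> - integral (cube x h) u0 / V" by (simp only: pos_le_divide_eq[OF V])
      then show ?thesis using wx[of 0 x] u00 by simp
    qed
    \<comment> \<open>The barrier has height m / 2 at \<open>x0\<close> and reaches 0 at distance R
      / 4, where the control of the averages ends.\<close>
    define c0 where "c0 = m / 2 * (R / 4) powr - p"
    have c0: "0 < c0" using m R by (simp add: c0_def)
    have init: "m / 2 - c0 * norm (x - x0) powr p \<le> w 0 x" for x
    proof (cases "norm (x - x0) \<le> R / 4")
      case True
      have "0 \<le> c0 * norm (x - x0) powr p" using c0 by simp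
      then show ?thesis using near[OF True] by linarith
    next
      case False
      then have "(R / 4) powr p \<le> norm (x - x0) powr p" using R p0 by (intro powr_mono2) auto
      then have "c0 * (R / 4) powr p \<le> c0 * norm (x - x0) powr p" using c0 by (intro mult_left_mono) auto
      moreover have "c0 * (R / 4) powr p = m / 2" using R by (simp add: c0_def powr_minus)
      moreover have "0 \<le> w 0 x" using sup by (simp add: supersolution_def)
      ultimately show ?thesis by simp
    qed
    define \<mu> where "\<mu> = m / 2 - L * c0 powr (1 - q / 2)"
    have \<mu>: "0 < \<mu>" using K(2)[OF m A R_def mA] by (simp add: \<mu>_def c0_def)
    have low: "\<mu> \<le> w t x0" if "0 \<le> t" for t
      unfolding \<mu>_def by (rule L(2)[OF sup c0 init that])
    have norm_low: "ennreal \<mu> \<le> Lp_norm \<infinity> (u t)" if t: "0 \<le> t" for t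
    proof (rule ccontr)
      assume "\<not> ?thesis"
      then have less: "Lp_norm \<infinity> (u t) < ennreal \<mu>" by simp
      define v where "v = enn2real (Lp_norm \<infinity> (u t))"
      have "Lp_norm \<infinity> (u t) < top" using less by (rule order.strict_trans) simp
      then have v: "Lp_norm \<infinity> (u t) = ennreal v" "0 \<le> v" by (auto simp: v_def)
      have "v < \<mu>" using less v by (simp add: ennreal_less_iff)
      have "\<bar>u t y\<bar> \<le> v" for y using v by (intro Lp_norm_infinity_bound[OF slice[OF t]]) auto
      then have "- v \<le> u t y" for y by (meson abs_le_D2 minus_le_iff)
      then have "integral (cube x0 h) (\<lambda>y. - v) \<le> integral (cube x0 h) (u t)"
        using ui[OF t] by (intro integral_le) (auto simp: integrable_const)
      then have "- v * V \<le> integral (cube x0 h) (u t)" by (simp only: cV)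
      then have "- integral (cube x0 h) (u t) / V \<le> v" by (simp only: pos_divide_le_eq[OF V])
      then have "w t x0 \<le> v" using wx[OF t] by simp
      then show False using low[OF t] \<open>v < \<mu>\<close> by simp
    qed
    define l where "l = enn2real (Inf ((\<lambda>t. Lp_norm \<infinity> (u t)) ` {0..}))"
    have "Inf ((\<lambda>t. Lp_norm \<infinity> (u t)) ` {0..}) \<le> Lp_norm \<infinity> (u 0)" by (rule Inf_lower) simp
    then have "Inf ((\<lambda>t. Lp_norm \<infinity> (u t)) ` {0..}) < top" unfolding u00 Lm by (rule le_less_trans) simp
    then have l: "Inf ((\<lambda>t. Lp_norm \<infinity> (u t)) ` {0..}) = ennreal l" by (simp add: l_def)
    have "ennreal \<mu> \<le> ennreal l" unfolding l[symmetric] by (rule Inf_greatest) (use norm_low in auto)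
    then have "0 < l" using \<mu> by (simp add: ennreal_le_iff2)
    moreover have "((\<lambda>t. Lp_norm \<infinity> (u t)) \<longlongrightarrow> ennreal l) at_top"
      unfolding l[symmetric] by (rule antimono_tendsto_Inf) (rule mono)
    ultimately show "\<exists>l>0. ((\<lambda>t. Lp_norm \<infinity> (u t)) \<longlongrightarrow> ennreal l) at_top" by blast
  qed
qed

theorem theorem2p4:
  fixes q :: real
  assumes "(real CARD('n::finite) + 2) / (real CARD('n) + 1) < q" and "q < 2"
  shows
    "(\<exists>V :: real \<Rightarrow> real ^ 'n \<Rightarrow> real.
        self_similar_solution q V \<and>
        (\<forall>t>0. \<forall>x. V t x \<le> 0) \<and>
        (\<forall>p::ennreal. 1 \<le> p \<longrightarrow>
           (\<forall>t>0. V t \<in> Lp_space p \<and> grad (V t) \<in> Lp_space p) \<and>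
           ((\<lambda>t. ennreal (t powr (real CARD('n) / 2 * (1 - enn2real (1 / p)))) * Lp_norm p (V t))
              \<longlongrightarrow> \<infinity>) at_top \<and>
           ((\<lambda>t. ennreal (t powr (real CARD('n) / 2 * (1 - enn2real (1 / p)) + 1 / 2))
                   * Lp_norm p (grad (V t)))
              \<longlongrightarrow> \<infinity>) at_top))
     \<and>
     (\<exists>K::real. K \<ge> 0 \<and>
        (\<forall>(u0 :: real ^ 'n \<Rightarrow> real) u.
           u0 \<in> Lp_space 1 \<longrightarrow> u0 \<in> W_inf 1 \<longrightarrow>
           (\<forall>x. u0 x \<le> 0) \<longrightarrow> (\<exists>x. u0 x \<noteq> 0) \<longrightarrow>
           is_the_solution q u0 u \<longrightarrow>
           u0 \<in> W_inf 2 \<longrightarrow>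
           enn2real (Lp_norm \<infinity> u0)
             * enn2real (Lp_norm \<infinity> (\<lambda>x. max (weak_laplacian u0 x) 0)) powr (1 - 2 / q) > K \<longrightarrow>
           (\<exists>l::real. l > 0 \<and> ((\<lambda>t. Lp_norm \<infinity> (u t)) \<longlongrightarrow> ennreal l) at_top)))"
proof (rule conjI, goal_cases)
  case 1
  show ?case using self_similar_part[where 'a = "real ^ 'n", of q] assms by simp
next
  case 2
  have "1 < (real CARD('n) + 2) / (real CARD('n) + 1)" by (simp add: less_divide_eq)
  then have "1 < q" using assms(1) by (rule less_trans)
  from non_decaying_part[OF this assms(2), where 'a = "real ^ 'n"] show ?case by blast
qed

end
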